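(* Let $K$ be an imaginary quadratic field with discriminant $\Delta$ and ring of integers $\mathcal{O}$, and let $\Gamma=\mathrm{PSL}_2(\mathcal{O})$. Let $\delta\in\mathcal{O}$ have maximal magnitude among proper divisors of $\Delta$ in $\mathcal{O}$, and let $J\in\mathbb{Z}$ be such that $\mathcal{J}\big(2\max(|\delta|,J\sqrt{|\Delta|})\big)\leq J$. Then $$\max\!\left(\frac{|\delta|}{8},\frac{\sqrt{|\Delta|}-2}{\sqrt{3}}\right)<\mathcal{S}(\Gamma)<14J\max\!\left(|\delta|,J\sqrt{|\Delta|}\right).$$
   Context: Hyperbolic 3-space is modeled as $\mathbb{H}=\{(\zeta,t):\zeta\in\mathbb{C},t>0\}$; for $P\in\mathbb{H}$ write $\zeta(P)$, $t(P)$ for its coordinates. $\Gamma$ acts on $\mathbb{H}$ in the standard way; for $g=\begin{bmatrix}\beta&-\alpha\\-\mu&\lambda\end{bmatrix}$ one has $t(gP)=t(P)/(|\mu\zeta(P)-\lambda|^2+|\mu|^2t(P)^2)$. Given a fundamental parallelogram $F\subset\mathbb{C}$ for the lattice $\mathcal{O}$, the Bianchi polyhedron is $\mathcal{B}=\{P\in\mathbb{H}:\zeta(P)\in\overline{F},\ t(P)\geq t(gP)\ \forall g\in\Gamma\}$. For $\lambda,\mu\in\mathcal{O}$ coprime (i.e. the ideal $(\lambda,\mu)=\mathcal{O}$) with $\mu\neq0$, $S_{\lambda/\mu}\subset\mathbb{H}$ is the open Euclidean hemisphere centered at $(\lambda/\mu,0)$ of radius $1/|\mu|$. Swan's number $\mathcal{S}(\Gamma)$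 is the maximum of $|\mu|$ over all $\mu$ such that $S_{\lambda/\mu}\cap\mathcal{B}$ contains an open subset of $S_{\lambda/\mu}$ for some $\lambda$ coprime to $\mu$ (this does not depend on the choice of $F$). For a nonzero ideal $\mathfrak{a}\subseteq\mathcal{O}$, $\mathcal{j}(\mathfrak{a})$ is the minimal real number such that for every $\alpha\in\mathcal{O}$ (subject, when $2\mid\mathfrak{a}$, to the requirement that the ideal $(2,\alpha)$ is not a prime ideal lying above a split prime $2$), every closed interval of length $\mathcal{j}(\mathfrak{a})$ contains some $j\in\mathbb{Z}$ with $(\mathfrak{a},\alpha+j)=\mathcal{O}$. For $x>0$, $\mathcal{J}(x)$ is the maximum of $\mathcal{j}(\mathfrak{a})$ over ideals $\mathfrak{a}\subseteq\mathcal{O}$ that have no principal prime ideal divisors and satisfy $\sqrt{\|\mathfrak{a}\|}<x$, where $\|\cdot\|$ is the ideal norm. *)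

theory Defs
  imports
    "HOL-Analysis.Analysis"
    "HOL-Algebra.Algebra"
    "HOL-Algebra.Algebraic_Closure_Type"
begin

section \<open>Imaginary quadratic fields and their rings of integers\<close>

text \<open>
  Absolute values of field elements refer to a complex embedding, so the field is taken to be a
  subfield of the complex numbers. The two embeddings differ by complex conjugation.
\<close>

definition imaginary_quadratic_field :: "complex set \<Rightarrow> bool" where
  "imaginary_quadratic_field K \<longleftrightarrow>
     subfield K ring_of_type_algebra \<and>
     ring.dimension (ring_of_type_algebra :: complex ring) 2 \<rat> K \<and>
     \<not> K \<subseteq> \<real>"

definition integers_of :: "complex set \<Rightarrow> complex ring" where
  "integers_of K = ring_of_type_algebra\<lparr>carrier := {x \<in> K. algebraic_int x}\<rparr>"

definition lattice_basis :: "complex set \<Rightarrow> complex \<Rightarrow> complex \<Rightarrow> bool" where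
  "lattice_basis L v w \<longleftrightarrow>
     L = {of_int m * v + of_int n * w | m n. True} \<and>
     (\<forall>m n :: int. of_int m * v + of_int n * w = 0 \<longrightarrow> m = 0 \<and> n = 0)"

text \<open>
  The square of the determinant of the conjugates of an integral basis; the embeddings of an
  imaginary quadratic field are the identity and complex conjugation.
\<close>

definition discriminant :: "complex set \<Rightarrow> int" where
  "discriminant K = (THE D. \<exists>v w. lattice_basis (carrier (integers_of K)) v w \<and>
     of_int D = (v * cnj w - w * cnj v)\<^sup>2)"

section \<open>The action on hyperbolic space\<close>

definition SL2 :: "complex ring \<Rightarrow> (complex ^ 2 ^ 2) monoid" where
  "SL2 R = \<lparr>carrier = {A. (\<forall>i j. A $ i $ j \<in> carrier R) \<and> det A = 1},
            mult = (**), one = mat 1\<rparr>"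

definition PSL2 :: "complex ring \<Rightarrow> (complex ^ 2 ^ 2) set monoid" where
  "PSL2 R = SL2 R Mod {mat 1, - mat 1}"

definition hyperbolic_space :: "(complex \<times> real) set" where
  "hyperbolic_space = {P. snd P > 0}"

text \<open>
  In quaternion notation this is \<open>P \<mapsto> (a P + b) (c P + d)\<^sup>-\<^sup>1\<close> with \<open>P = \<zeta> + t j\<close>.
\<close>

definition SL2_act :: "complex ^ 2 ^ 2 \<Rightarrow> complex \<times> real \<Rightarrow> complex \<times> real" where
  "SL2_act A P =
     (let a = A $ 1 $ 1; b = A $ 1 $ 2; c = A $ 2 $ 1; d = A $ 2 $ 2;
          z = fst P; t = snd P;
          N = (cmod (c * z + d))\<^sup>2 + (cmod c)\<^sup>2 * t\<^sup>2
      in (((a * z + b) * cnj (c * z + d) + a * cnj c * of_real (t\<^sup>2)) / of_real N, t / N))"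

lemma SL2_act_uminus: "SL2_act (- A) P = SL2_act A P"
proof -
  have "cmod ((- A) $ 2 $ 1 * z + (- A) $ 2 $ 2) = cmod (A $ 2 $ 1 * z + A $ 2 $ 2)" for z
    using norm_minus_cancel[of "A $ 2 $ 1 * z + A $ 2 $ 2"] by (simp add: algebra_simps)
  then show ?thesis
    unfolding SL2_act_def Let_def by (simp add: algebra_simps)
qed

text \<open>
  An element of the projective group is a coset \<open>{A, -A}\<close>, and both matrices act in the same way
  by the preceding lemma.
\<close>

definition PSL2_act :: "(complex ^ 2 ^ 2) set \<Rightarrow> complex \<times> real \<Rightarrow> complex \<times> real" where
  "PSL2_act g P = the_elem ((\<lambda>A. SL2_act A P) ` g)"

section \<open>Swan's number\<close>

definition fundamental_parallelogram :: "complex set \<Rightarrow> complex set \<Rightarrow> bool" where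
  "fundamental_parallelogram L F \<longleftrightarrow>
     (\<exists>p v w. lattice_basis L v w \<and>
        F = {p + of_real x * v + of_real y * w | x y. 0 \<le> x \<and> x < 1 \<and> 0 \<le> y \<and> y < 1})"

definition bianchi_polyhedron :: "complex set \<Rightarrow> complex set \<Rightarrow> (complex \<times> real) set" where
  "bianchi_polyhedron K F =
     {P \<in> hyperbolic_space. fst P \<in> closure F \<and>
        (\<forall>g \<in> carrier (PSL2 (integers_of K)). snd P \<ge> snd (PSL2_act g P))}"

text \<open>The product metric on \<^typ>\<open>complex \<times> real\<close> is the Euclidean one.\<close>

definition hemisphere :: "complex \<Rightarrow> complex \<Rightarrow> (complex \<times> real) set" where
  "hemisphere l m = sphere (l / m, 0) (1 / cmod m) \<inter> hyperbolic_space"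

definition swan_number :: "complex set \<Rightarrow> complex set \<Rightarrow> real" where
  "swan_number K F = Max {cmod m | m. m \<in> carrier (integers_of K) \<and> m \<noteq> 0 \<and>
     (\<exists>l \<in> carrier (integers_of K).
        Idl\<^bsub>integers_of K\<^esub> {l, m} = carrier (integers_of K) \<and>
        (\<exists>U. openin (top_of_set (hemisphere l m)) U \<and> U \<noteq> {} \<and>
             U \<subseteq> hemisphere l m \<inter> bianchi_polyhedron K F))}"

section \<open>Gaps between units in residue rings\<close>

definition ideal_dvd :: "complex ring \<Rightarrow> complex set \<Rightarrow> complex set \<Rightarrow> bool" where
  "ideal_dvd R I A \<longleftrightarrow> (\<exists>B. ideal B R \<and> A = I \<cdot>\<^bsub>R\<^esub> B)"

definition ideal_norm :: "complex ring \<Rightarrow> complex set \<Rightarrow> nat" where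
  "ideal_norm R A = card (carrier (R Quot A))"

definition split_prime :: "complex ring \<Rightarrow> nat \<Rightarrow> bool" where
  "split_prime R p \<longleftrightarrow>
     Factorial_Ring.prime p \<and>
     (\<exists>P Q. primeideal P R \<and> primeideal Q R \<and> P \<noteq> Q \<and>
        Idl\<^bsub>R\<^esub> {of_nat p} = P \<cdot>\<^bsub>R\<^esub> Q)"

text \<open>A prime ideal \<open>(2, \<alpha>)\<close> contains 2, hence lies above 2.\<close>

definition max_gap :: "complex ring \<Rightarrow> complex set \<Rightarrow> real" where
  "max_gap R A = (LEAST x. x \<ge> 0 \<and>
     (\<forall>\<alpha> \<in> carrier R.
        (ideal_dvd R (Idl\<^bsub>R\<^esub> {2}) A \<longrightarrow> \<not> (primeideal (Idl\<^bsub>R\<^esub> {2, \<alpha>}) R \<and> split_prime R 2)) \<longrightarrow>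
        (\<forall>c. \<exists>j :: int. of_int j \<in> {c..c + x} \<and>
           Idl\<^bsub>R\<^esub> (A \<union> {\<alpha> + of_int j}) = carrier R)))"

definition max_gap_below :: "complex ring \<Rightarrow> real \<Rightarrow> real" where
  "max_gap_below R x = Max {max_gap R A | A.
     ideal A R \<and> A \<noteq> {0} \<and>
     (\<forall>P. primeideal P R \<and> principalideal P R \<longrightarrow> \<not> ideal_dvd R P A) \<and>
     sqrt (real (ideal_norm R A)) < x}"

end

theory Submission imports Defs "HOL-Number_Theory.Cong"
begin

text \<open>
  Write \<open>D = \<surd>\<bar>\<Delta>\<bar>\<close>. Whenever a coprime pair \<open>(a, b)\<close> satisfies \<open>|bz - a|\<^sup>2 + |b|\<^sup>2t\<^sup>2 < 1\<close>, some
  hemisphere that contributes to the floor of the polyhedron passes above \<open>(z, t)\<close>. Lower bounds for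
  Swan's number therefore follow from points which no hemisphere of large radius can cover: near
  \<open>exp (i\<pi>/3)\<close> this gives \<open>(D - 2) / \<surd>3\<close>, and the cusps belonging to a ramified prime \<open>p\<close> give
  \<open>D\<^sup>2 / 8p\<close>. One of these exceeds \<open>|\<delta>| / 8\<close>, because \<open>\<Delta> / \<delta>\<close> either is divisible by such a \<open>p\<close> or is
  not real, in which case \<open>|\<delta>| \<le> 2D\<close>.

  For the upper bound, let \<open>(z, t)\<close> be a point of the floor on a hemisphere of radius \<open>1 / |\<mu>|\<close>, so that the
  form \<open>q(a, b) = |a - bz|\<^sup>2 + |b|\<^sup>2t\<^sup>2\<close> is at least \<open>1\<close> on coprime pairs and \<open>t \<le> 1 / |\<mu>|\<close>. Let \<open>v\<close> be a shortest
  nonzero vector of \<open>\<O>\<^sup>2\<close> for \<open>q\<close>. Reducing the lattice orthogonal to \<open>v\<close> yields a second short vector \<open>w\<close>, and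
  the gap condition, applied to an intersection of nonprincipal maximal ideals containing the determinant
  of \<open>v\<close> and \<open>w\<close>, corrects \<open>w\<close> by a small multiple of \<open>v\<close> into a multiple of a coprime pair. If \<open>|\<mu>|\<close> were
  large, this pair would be too short.
\<close>

section \<open>Rings of integers of imaginary quadratic fields\<close>

text \<open>When the class group is not trivial, a short vector need not be proportional to a
  coprime pair. A vector is therefore accepted as soon as every maximal ideal containing both
  entries is principal: the generators can then be divided out one after the other.

  The gap condition only moves w by rational integer multiples of v and needs an ideal of controlled
  norm. So w is sought only among the vectors whose determinant with v is a rational integer n: an
  ideal containing n has norm at most n^2, which is why the square root of the norm is compared with
  a bound for determinants. The price of this restriction is that v and w may share a nonprincipal
  maximal ideal. Since their determinant is rational, such an ideal lies over a ramified prime p.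
  Now D^2 / p is the absolute value of \<Delta> / p, a proper divisor of the discriminant, hence at
  most |\<delta>|. In this way |\<delta>| enters the upper bound.\<close>

locale imag_quad =
  fixes \<omega> :: complex and T N :: int
  assumes Im_omega: "0 < Im \<omega>"
    and omega_square: "\<omega>\<^sup>2 = of_int T * \<omega> - of_int N"
    and maximal: "\<And>a b m t n. m \<noteq> 0 \<Longrightarrow>
      ((of_int a + of_int b * \<omega>) / of_int m)\<^sup>2 =
        of_int t * ((of_int a + of_int b * \<omega>) / of_int m) - of_int n \<Longrightarrow> m dvd a \<and> m dvd b"
begin

text \<open>The assumption \<open>maximal\<close> expresses in integer coordinates that this order
  is integrally closed in its field. Every argument that distinguishes the full ring of integers
  from a smaller order goes through it.\<close>

definition \<O> :: "complex set" where
  "\<O> = {of_int a + of_int b * \<omega> | a b. True}"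

definition D :: real where "D = 2 * Im \<omega>"

lemma D_pos: "0 < D"
  using Im_omega by (simp add: D_def)

lemma O_I [intro, simp]: "of_int a + of_int b * \<omega> \<in> \<O>"
  by (auto simp: \<O>_def)

lemma O_E:
  assumes "x \<in> \<O>" obtains a b where "x = of_int a + of_int b * \<omega>"
  using assms by (auto simp: \<O>_def)

lemma O_int [simp, intro]: "of_int a \<in> \<O>"
  using O_I[of a 0] by simp

lemma O_nat [simp, intro]: "of_nat a \<in> \<O>"
  using O_int[of "int a"] by simp

lemma O_0 [simp, intro]: "0 \<in> \<O>" and O_1 [simp, intro]: "1 \<in> \<O>"
  and O_numeral [simp, intro]: "numeral k \<in> \<O>"
  using O_int[of 0] O_int[of 1] O_int[of "numeral k"] by simp_all

lemma O_omega [simp, intro]: "\<omega> \<in> \<O>"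
  using O_I[of 0 1] by simp

lemma O_add [simp, intro]: assumes "x \<in> \<O>" "y \<in> \<O>" shows "x + y \<in> \<O>"
proof -
  obtain a b where "x = of_int a + of_int b * \<omega>" using assms(1) by (rule O_E)
  moreover obtain c d where "y = of_int c + of_int d * \<omega>" using assms(2) by (rule O_E)
  ultimately have "x + y = of_int (a + c) + of_int (b + d) * \<omega>"
    by (simp add: algebra_simps)
  then show ?thesis by (metis O_I)
qed

lemma O_uminus [simp, intro]: assumes "x \<in> \<O>" shows "- x \<in> \<O>"
proof -
  obtain a b where "x = of_int a + of_int b * \<omega>" using assms by (rule O_E)
  then have "- x = of_int (- a) + of_int (- b) * \<omega>" by simp
  then show ?thesis by (metis O_I)
qed

lemma O_diff [simp, intro]: "x \<in> \<O> \<Longrightarrow> y \<in> \<O> \<Longrightarrow> x - y \<in> \<O>"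
  using O_add[of x "- y"] by simp

lemma O_mult [simp, intro]: assumes "x \<in> \<O>" "y \<in> \<O>" shows "x * y \<in> \<O>"
proof -
  obtain a b where "x = of_int a + of_int b * \<omega>" using assms(1) by (rule O_E)
  moreover obtain c d where "y = of_int c + of_int d * \<omega>" using assms(2) by (rule O_E)
  ultimately have "x * y = of_int (a * c) + of_int (a * d + b * c) * \<omega> + of_int (b * d) * \<omega>\<^sup>2"
    by (simp add: algebra_simps power2_eq_square)
  also have "\<dots> = of_int (a * c - b * d * N) + of_int (a * d + b * c + b * d * T) * \<omega>"
    unfolding omega_square by (simp add: algebra_simps)
  finally show ?thesis by (metis O_I)
qed

lemma O_power [simp, intro]: "x \<in> \<O> \<Longrightarrow> x ^ n \<in> \<O>"
  by (induction n) auto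

lemma Re_omega: "2 * Re \<omega> = of_int T" and norm_omega: "(cmod \<omega>)\<^sup>2 = of_int N"
proof -
  have im: "2 * Re \<omega> * Im \<omega> = of_int T * Im \<omega>"
    using arg_cong[OF omega_square, of Im] by (simp add: power2_eq_square)
  then show T: "2 * Re \<omega> = of_int T" using Im_omega by simp
  have "Re \<omega> * Re \<omega> - Im \<omega> * Im \<omega> = of_int T * Re \<omega> - of_int N"
    using arg_cong[OF omega_square, of Re] by (simp add: power2_eq_square)
  then show "(cmod \<omega>)\<^sup>2 = of_int N"
    unfolding T[symmetric] cmod_power2 by (simp add: power2_eq_square algebra_simps)
qed

lemma D_square: "D\<^sup>2 = of_int (4 * N - T\<^sup>2)"
proof -
  have "D\<^sup>2 = 4 * (cmod \<omega>)\<^sup>2 - (2 * Re \<omega>)\<^sup>2"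
    by (simp add: D_def cmod_power2 power_mult_distrib algebra_simps)
  then show ?thesis by (simp add: norm_omega Re_omega)
qed

lemma cnj_omega: "cnj \<omega> = of_int T - \<omega>"
  by (rule complex_eqI) (use Re_omega in auto)

lemma O_cnj [simp, intro]: assumes "x \<in> \<O>" shows "cnj x \<in> \<O>"
proof -
  obtain a b where "x = of_int a + of_int b * \<omega>" using assms by (rule O_E)
  then have "cnj x = of_int a + of_int b * (of_int T - \<omega>)" by (simp add: cnj_omega)
  then show ?thesis by simp
qed

lemma Im_O: assumes "x \<in> \<O>" obtains b :: int where "Im x = of_int b * (D / 2)"
proof -
  obtain a b where "x = of_int a + of_int b * \<omega>" using assms by (rule O_E)
  then have "Im x = of_int b * (D / 2)" by (simp add: D_def)
  then show ?thesis using that by blast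
qed

lemma O_real: assumes "x \<in> \<O>" "Im x = 0" obtains a where "x = of_int a"
  using assms Im_omega by (auto elim!: O_E)

lemma Re_O: assumes "x \<in> \<O>" obtains a :: int where "2 * Re x = of_int a"
proof -
  have "x + cnj x \<in> \<O>" "Im (x + cnj x) = 0" using assms by auto
  then obtain a where a: "x + cnj x = of_int a" by (metis O_real)
  have "2 * Re x = of_int a" using arg_cong[OF a, of Re] by simp
  then show ?thesis using that by blast
qed

lemma norm_O: assumes "x \<in> \<O>" obtains n :: int where "(cmod x)\<^sup>2 = of_int n" "x * cnj x = of_int n"
proof -
  have "x * cnj x \<in> \<O>" "Im (x * cnj x) = 0" using assms by auto
  then obtain a where a: "x * cnj x = of_int a" by (metis O_real)
  have "(cmod x)\<^sup>2 = of_int a" using arg_cong[OF a, of Re] unfolding cmod_power2 by (simp add: power2_eq_square)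
  then show ?thesis using that a by blast
qed

lemma O_norm_ge_1: assumes "x \<in> \<O>" "x \<noteq> 0" shows "1 \<le> cmod x"
proof -
  obtain n :: int where n: "(cmod x)\<^sup>2 = of_int n" using norm_O[OF assms(1)] by blast
  have "0 < (cmod x)\<^sup>2" using assms by simp
  then have "1 \<le> (cmod x)\<^sup>2" using n by simp
  then show ?thesis by (simp add: power2_nonneg_ge_1_iff)
qed

lemma O_norm_less_1: "x \<in> \<O> \<Longrightarrow> cmod x < 1 \<Longrightarrow> x = 0"
  using O_norm_ge_1 by force

lemma O_nonreal: assumes "x \<in> \<O>" "Im x \<noteq> 0" shows "D / 2 \<le> \<bar>Im x\<bar>" "D / 2 \<le> cmod x"
proof -
  obtain b :: int where b: "Im x = of_int b * (D / 2)" using Im_O assms(1) by blast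
  then have "b \<noteq> 0" using assms(2) by auto
  then have "1 \<le> \<bar>real_of_int b\<bar>" by linarith
  then have "1 * (D / 2) \<le> \<bar>real_of_int b\<bar> * (D / 2)" using D_pos by (intro mult_right_mono) auto
  then show "D / 2 \<le> \<bar>Im x\<bar>" unfolding b using D_pos by (simp add: abs_mult)
  then show "D / 2 \<le> cmod x" using abs_Im_le_cmod order_trans by blast
qed

lemma finite_O: "finite {x \<in> \<O>. cmod x \<le> r}"
proof -
  define B where "B = \<lceil>r / Im \<omega>\<rceil>"
  define A where "A = \<lceil>r + \<bar>r / Im \<omega> + 1\<bar> * cmod \<omega>\<rceil>"
  have "{x \<in> \<O>. cmod x \<le> r} \<subseteq> (\<lambda>(a, b). of_int a + of_int b * \<omega>) ` ({-A..A} \<times> {-B..B})"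
  proof
    fix x assume "x \<in> {x \<in> \<O>. cmod x \<le> r}"
    then obtain a b where x: "x = of_int a + of_int b * \<omega>" and r: "cmod x \<le> r"
      by (auto elim!: O_E)
    have "\<bar>of_int b * Im \<omega>\<bar> \<le> r" using r abs_Im_le_cmod[of x] x by simp
    then have b: "\<bar>real_of_int b\<bar> \<le> r / Im \<omega>"
      using Im_omega by (simp add: abs_mult field_simps)
    have "cmod (of_int a) \<le> cmod x + cmod (of_int b * \<omega>)"
      using norm_triangle_ineq4[of x "of_int b * \<omega>"] x by simp
    also have "\<dots> \<le> r + \<bar>real_of_int b\<bar> * cmod \<omega>" using r by (simp add: norm_mult)
    also have "\<dots> \<le> r + \<bar>r / Im \<omega> + 1\<bar> * cmod \<omega>"
      using b by (intro add_left_mono mult_right_mono) auto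
    finally have "\<bar>real_of_int a\<bar> \<le> r + \<bar>r / Im \<omega> + 1\<bar> * cmod \<omega>" by simp
    then have "\<bar>a\<bar> \<le> A" unfolding A_def by linarith
    moreover have "\<bar>b\<bar> \<le> B" unfolding B_def using b by linarith
    ultimately show "x \<in> (\<lambda>(a, b). of_int a + of_int b * \<omega>) ` ({-A..A} \<times> {-B..B})"
      unfolding x by (intro image_eqI[of _ _ "(a, b)"]) (auto simp: abs_le_iff)
  qed
  then show ?thesis by (rule finite_subset) auto
qed

text \<open>Bezout coefficients stand for the condition that l and m generate the unit ideal
  (\<open>Idl_pair_eq_carrier\<close>), because they complete the pair to a matrix of determinant
  1.\<close>

definition cop :: "complex \<Rightarrow> complex \<Rightarrow> bool" where
  "cop l m \<longleftrightarrow> (\<exists>r\<in>\<O>. \<exists>s\<in>\<O>. r * l + s * m = 1)"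

lemma copI: "r \<in> \<O> \<Longrightarrow> s \<in> \<O> \<Longrightarrow> r * l + s * m = 1 \<Longrightarrow> cop l m"
  by (auto simp: cop_def)

lemma cop_shift: assumes "cop l m" "s \<in> \<O>" shows "cop (l + s * m) m"
proof -
  obtain r q where rq: "r \<in> \<O>" "q \<in> \<O>" "r * l + q * m = 1" using assms by (auto simp: cop_def)
  have "r * (l + s * m) + (q - r * s) * m = 1" using rq(3) by (simp add: algebra_simps)
  then show ?thesis using rq assms by (intro copI[of r "q - r * s"]) auto
qed

end

text \<open>Lagrange's identity: the product of two Hermitian norms is the squared determinant plus
  the squared inner product. Both bounds use it to split a vector along and orthogonally to a given
  one.\<close>

lemma complex_lagrange:
  "((cmod a)\<^sup>2 + (cmod b)\<^sup>2) * ((cmod c)\<^sup>2 + (cmod d)\<^sup>2) =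
    (cmod (a * d - b * c))\<^sup>2 + (cmod (c * cnj a + d * cnj b))\<^sup>2"
  unfolding cmod_power2 by (simp add: power2_eq_square algebra_simps)

section \<open>From the field K to an integral basis 1, \<omega>\<close>

abbreviation complex_ring :: "complex ring" where "complex_ring \<equiv> ring_of_type_algebra"

lemma complex_ring_simps [simp]:
  "carrier complex_ring = UNIV" "x \<otimes>\<^bsub>complex_ring\<^esub> y = x * y" "x \<oplus>\<^bsub>complex_ring\<^esub> y = x + y"
  "\<one>\<^bsub>complex_ring\<^esub> = 1" "\<zero>\<^bsub>complex_ring\<^esub> = 0"
  by (simp_all add: ring_of_type_algebra_def)

lemma complex_ring_field: "field complex_ring" by (rule field_from_type_algebra)

lemma complex_ring_minus: "\<ominus>\<^bsub>complex_ring\<^esub> x = - x"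
proof -
  interpret field complex_ring by (rule complex_ring_field)
  have "x + \<ominus>\<^bsub>complex_ring\<^esub> x = 0" using r_neg[of x] by simp
  then show ?thesis by (simp add: eq_neg_iff_add_eq_0 add.commute)
qed

lemma imaginary_quadratic_field_closed:
  assumes "imaginary_quadratic_field K"
  shows "0 \<in> K" "1 \<in> K" "x \<in> K \<Longrightarrow> y \<in> K \<Longrightarrow> x + y \<in> K" "x \<in> K \<Longrightarrow> y \<in> K \<Longrightarrow> x * y \<in> K"
    "x \<in> K \<Longrightarrow> - x \<in> K" "x \<in> K \<Longrightarrow> inverse x \<in> K" "of_int n \<in> K"
    "x \<in> K \<Longrightarrow> y \<in> K \<Longrightarrow> x / y \<in> K"
proof -
  interpret field complex_ring by (rule complex_ring_field)
  have K: "subfield K complex_ring" using assms by (simp add: imaginary_quadratic_field_def)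
  note sub = subringE[OF subfieldE(1)[OF K]]
  show 0: "0 \<in> K" and 1: "1 \<in> K" using sub(2,3) by simp_all
  show add: "x \<in> K \<Longrightarrow> y \<in> K \<Longrightarrow> x + y \<in> K" for x y using sub(7)[of x y] by simp
  show mult: "x \<in> K \<Longrightarrow> y \<in> K \<Longrightarrow> x * y \<in> K" for x y using sub(6)[of x y] by simp
  show um: "x \<in> K \<Longrightarrow> - x \<in> K" for x using sub(5)[of x] by (simp add: complex_ring_minus)
  show inv: "x \<in> K \<Longrightarrow> inverse x \<in> K" for x
  proof (cases "x = 0")
    case False
    assume "x \<in> K"
    then have "x \<in> K - {\<zero>\<^bsub>complex_ring\<^esub>}" using False by simp
    from subfield_m_inv(1,2)[OF K this] have "inv\<^bsub>complex_ring\<^esub> x \<in> K" "x * inv\<^bsub>complex_ring\<^esub> x = 1"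
      by auto
    then show ?thesis by (metis inverse_unique)
  qed (use 0 in simp)
  have nat: "of_nat k \<in> K" for k by (induction k) (use 0 1 add in auto)
  show "of_int n \<in> K"
    by (cases n rule: int_cases2) (use nat um in \<open>auto simp del: of_nat_Suc\<close>)
  show "x \<in> K \<Longrightarrow> y \<in> K \<Longrightarrow> x / y \<in> K" for x y
    using mult inv by (simp add: divide_inverse)
qed

text \<open>The elements 1, x and x^2 lie in the rational span of u and w, so the 2 by 2 minors a,
  b, c of their coordinates give a linear relation. If the minor a of 1 and x vanished, x would be
  rational. Clearing denominators and the gcd makes the relation primitive.\<close>

lemma imaginary_quadratic_field_quadratic:
  assumes "imaginary_quadratic_field K" "x \<in> K" "x \<notin> \<real>"
  obtains A B C :: int where "A \<noteq> 0" "gcd A (gcd B C) = 1"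
    "of_int A * x\<^sup>2 = of_int B * x - of_int C"
proof -
  interpret field complex_ring by (rule complex_ring_field)
  have dim: "dimension (Suc (Suc 0)) \<rat> K"
    using assms(1) by (simp add: imaginary_quadratic_field_def numeral_2_eq_2)
  obtain u E where u: "dimension (Suc 0) \<rat> E" "K = line_extension \<rat> u E"
    using dim by (cases rule: dimension.cases) auto
  obtain w E' where w: "dimension 0 \<rat> E'" "E = line_extension \<rat> w E'"
    using u(1) by (cases rule: dimension.cases) auto
  have E': "E' = {0}" using w(1) by (cases rule: dimension.cases) auto
  have coord: "\<exists>p\<in>\<rat>. \<exists>q\<in>\<rat>. z = p * u + q * w" if z: "z \<in> K" for z
  proof -
    obtain k y where k: "k \<in> \<rat>" "y \<in> E" "z = k * u + y"
      using z line_extension_mem_iff[of z \<rat> u E] u(2) by auto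
    then obtain k' where "k' \<in> \<rat>" "y = k' * w"
      using line_extension_mem_iff[of y \<rat> w E'] w(2) E' by auto
    then show ?thesis using k by blast
  qed
  note cl = imaginary_quadratic_field_closed[OF assms(1)]
  obtain p1 p2 where p: "p1 \<in> \<rat>" "p2 \<in> \<rat>" "1 = p1 * u + p2 * w" using coord[OF cl(2)] by blast
  obtain q1 q2 where q: "q1 \<in> \<rat>" "q2 \<in> \<rat>" "x = q1 * u + q2 * w" using coord[OF assms(2)] by blast
  obtain r1 r2 where r: "r1 \<in> \<rat>" "r2 \<in> \<rat>" "x\<^sup>2 = r1 * u + r2 * w"
    using coord[OF cl(4)[OF assms(2) assms(2)]] by (auto simp: power2_eq_square)
  define a b c where "a = p1 * q2 - p2 * q1" and "b = p1 * r2 - p2 * r1" and "c = q1 * r2 - q2 * r1"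
  have abc: "a \<in> \<rat>" "b \<in> \<rat>" "c \<in> \<rat>" using p q r by (auto simp: a_def b_def c_def)
  have eq: "a * x\<^sup>2 = b * x - c"
  proof -
    have "a * x\<^sup>2 - b * x + c * 1 = 0"
      unfolding r(3) by (subst q(3), subst p(3)) (simp add: a_def b_def c_def algebra_simps)
    then show ?thesis by (simp add: algebra_simps)
  qed
  have rat_real: "z \<in> \<real>" if "z \<in> \<rat>" for z :: complex using that by (metis Rats_cases' Reals_divide Reals_of_int)
  have "a \<noteq> 0"
  proof
    assume "a = 0"
    then have *: "p1 * q2 = p2 * q1" by (simp add: a_def)
    have "p1 * x = q1" "p2 * x = q2"
    proof -
      have "p1 * x = q1 * (p1 * u) + (p1 * q2) * w" by (subst q(3)) (simp add: algebra_simps)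
      also have "\<dots> = q1 * (p1 * u + p2 * w)" unfolding * by (simp add: algebra_simps)
      finally show "p1 * x = q1" unfolding p(3)[symmetric] by simp
      have "p2 * x = (p2 * q1) * u + q2 * (p2 * w)" by (subst q(3)) (simp add: algebra_simps)
      also have "\<dots> = q2 * (p1 * u + p2 * w)" unfolding *[symmetric] by (simp add: algebra_simps)
      finally show "p2 * x = q2" unfolding p(3)[symmetric] by simp
    qed
    moreover have "p1 \<noteq> 0 \<or> p2 \<noteq> 0" using p(3) by auto
    ultimately have "x = q1 / p1 \<or> x = q2 / p2" by (auto simp: field_simps)
    then have "x \<in> \<rat>" using p q by auto
    then show False using assms(3) rat_real by auto
  qed
  obtain a1 a2 where a: "a = of_int a1 / of_int a2" "a2 > 0" using abc(1) by (meson Rats_cases')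
  obtain b1 b2 where b: "b = of_int b1 / of_int b2" "b2 > 0" using abc(2) by (meson Rats_cases')
  obtain c1 c2 where c: "c = of_int c1 / of_int c2" "c2 > 0" using abc(3) by (meson Rats_cases')
  define A0 B0 C0 where "A0 = a1 * b2 * c2" and "B0 = b1 * a2 * c2" and "C0 = c1 * a2 * b2"
  have "of_int A0 * x\<^sup>2 = of_int (a2 * b2 * c2) * (a * x\<^sup>2)"
    using a by (simp add: A0_def)
  also have "\<dots> = of_int (a2 * b2 * c2) * (b * x - c)" by (simp only: eq)
  also have "\<dots> = of_int B0 * x - of_int C0"
    using a b c by (simp add: B0_def C0_def field_simps)
  finally have eq0: "of_int A0 * x\<^sup>2 = of_int B0 * x - of_int C0" .
  have A0: "A0 \<noteq> 0" using \<open>a \<noteq> 0\<close> a b c by (auto simp: A0_def)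
  define g where "g = gcd A0 (gcd B0 C0)"
  have g: "g \<noteq> 0" using A0 by (simp add: g_def)
  obtain A B C where ABC: "A0 = g * A" "B0 = g * B" "C0 = g * C"
    by (metis dvdE g_def gcd_dvd1 gcd_dvd2 dvd_trans)
  have "0 \<le> g" by (simp add: g_def)
  then have gm: "gcd (g * a) (g * b) = g * gcd a b" for a b
    using gcd_mult_distrib_int[of g a b] by simp
  have "g = gcd (g * A) (gcd (g * B) (g * C))" unfolding ABC[symmetric] by (rule g_def)
  then have "g * 1 = g * gcd A (gcd B C)" by (simp only: gm mult_1_right)
  then have gcd: "gcd A (gcd B C) = 1" using g by (metis mult_cancel_left)
  have "of_int g * (of_int A * x\<^sup>2) = of_int g * (of_int B * x - of_int C)"
    using eq0 by (simp add: ABC algebra_simps)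
  then have "of_int A * x\<^sup>2 = of_int B * x - of_int C" using g by simp
  moreover have "A \<noteq> 0" using A0 ABC by auto
  ultimately show ?thesis using that[of A B C] gcd by blast
qed

lemma map_poly_of_int_add:
  "map_poly of_int (p + q) = map_poly of_int p + (map_poly of_int q :: complex poly)"
  by (rule poly_eqI) (simp add: coeff_map_poly)

lemma map_poly_of_int_mult:
  "map_poly of_int (p * q) = map_poly of_int p * (map_poly of_int q :: complex poly)"
  by (rule poly_eqI) (simp add: coeff_map_poly coeff_mult)

text \<open>Gauss's lemma: the primitive quadratic divides the monic polynomial over the integers.\<close>

lemma algebraic_int_quadratic_monic:
  fixes x :: complex
  assumes "algebraic_int x" "x \<notin> \<real>" "A \<noteq> 0" "gcd A (gcd B C) = 1"
    "of_int A * x\<^sup>2 = of_int B * x - of_int C"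
  shows "A dvd 1"
proof -
  obtain p :: "int poly" where p: "poly (map_poly of_int p) x = 0" "poly.coeff p (Polynomial.degree p) = 1"
    using assms(1) by (auto simp: algebraic_int_altdef_ipoly)
  define g where "g = [:C, - B, A:]"
  have g0: "g \<noteq> 0" and dg: "Polynomial.degree g = 2" using assms(3) by (simp_all add: g_def)
  have lg: "poly.coeff g (Polynomial.degree g) = A" unfolding dg by (simp add: g_def numeral_2_eq_2)
  obtain s r where sr: "pseudo_divmod p g = (s, r)" by fastforce
  define k where "k = Suc (Polynomial.degree p) - Polynomial.degree g"
  have eq: "Polynomial.smult (A ^ k) p = g * s + r" and r: "r = 0 \<or> Polynomial.degree r < 2"
    using pseudo_divmod[OF g0 sr, unfolded lg] by (simp_all only: k_def dg)
  let ?e = "\<lambda>q :: int poly. poly (map_poly of_int q) x"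
  have "?e g = 0" using assms(5) by (simp add: g_def map_poly_pCons power2_eq_square algebra_simps)
  moreover have "?e (Polynomial.smult (A ^ k) p) = 0"
  proof -
    have "Polynomial.smult (A ^ k) p = [:A ^ k:] * p" by simp
    then show ?thesis using p(1) by (simp only: map_poly_of_int_mult poly_mult mult_zero_right)
  qed
  ultimately have "?e r = 0"
    unfolding eq by (simp add: map_poly_of_int_add map_poly_of_int_mult)
  moreover have rc: "r = [:poly.coeff r 0, poly.coeff r 1:]"
  proof (rule poly_eqI)
    fix n show "poly.coeff r n = poly.coeff [:poly.coeff r 0, poly.coeff r 1:] n"
    proof (cases "n < 2")
      case True then show ?thesis by (cases n) auto
    next
      case False
      then have "poly.coeff r n = 0" using r by (auto intro: coeff_eq_0)
      then show ?thesis using False by (auto simp: coeff_pCons split: nat.splits)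
    qed
  qed
  ultimately have e: "of_int (poly.coeff r 0) + x * of_int (poly.coeff r 1) = 0"
    by (subst (asm) rc) (simp add: map_poly_pCons)
  have "Im x \<noteq> 0" using assms(2) complex_is_Real_iff by blast
  then have "poly.coeff r 1 = 0" using arg_cong[OF e, of Im] by simp
  then have "poly.coeff r 0 = 0" using e by simp
  then have "r = 0" using \<open>poly.coeff r 1 = 0\<close> rc by simp
  then have eq: "Polynomial.smult (A ^ k) p = g * s" using eq by simp
  have "Polynomial.content g dvd 1"
  proof -
    have "Polynomial.content g dvd poly.coeff g i" for i by simp
    from this[of 0] this[of 1] this[of 2] have "Polynomial.content g dvd gcd A (gcd B C)"
      by (simp add: g_def numeral_2_eq_2)
    then show ?thesis using assms(4) by simp
  qed
  then have "Polynomial.content g = 1" by (metis normalize_content is_unit_normalize)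
  moreover have "Polynomial.content p = 1"
    using content_dvd_coeff[of p "Polynomial.degree p"] p(2) by (metis normalize_content is_unit_normalize)
  \<comment> \<open>Contents multiply, so the leading coefficient of s is a multiple of A^k. The
    leading coefficient of g * s is A^k as well, and cancelling leaves 1 = A * u.\<close>
  ultimately have "\<bar>A ^ k\<bar> = Polynomial.content s"
    using arg_cong[OF eq, of Polynomial.content] by (simp add: content_mult)
  then have "A ^ k dvd poly.coeff s (Polynomial.degree s)"
    by (metis abs_dvd_iff content_dvd_coeff)
  then obtain u where u: "poly.coeff s (Polynomial.degree s) = A ^ k * u" by (rule dvdE)
  have "A ^ k = A * poly.coeff s (Polynomial.degree s)"
  proof -
    have "poly.coeff (Polynomial.smult (A ^ k) p) (Polynomial.degree (Polynomial.smult (A ^ k) p)) = A ^ k"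
      using assms(3) p(2) by simp
    then show ?thesis unfolding eq by (simp only: lead_coeff_mult lg)
  qed
  then have "A ^ k * 1 = A ^ k * (A * u)" using u by simp
  then have "1 = A * u" using assms(3) by (metis mult_cancel_left power_not_zero)
  then show ?thesis by (rule dvdI)
qed

lemma algebraic_int_monic_quadratic:
  fixes x :: complex
  assumes "x\<^sup>2 = of_int t * x - of_int n"
  shows "algebraic_int x"
proof -
  have "poly (map_poly of_int [:n, - t, 1:]) x = 0"
    using assms by (simp add: map_poly_pCons power2_eq_square algebra_simps)
  moreover have "poly.coeff [:n, - t, 1:] (Polynomial.degree [:n, - t, 1:]) = 1" by simp
  ultimately show ?thesis unfolding algebraic_int_altdef_ipoly by blast
qed

text \<open>Two bases differ by an integer matrix with integer inverse. Its determinant is 1 or -1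
  and enters the discriminant squared, so the \<open>THE\<close> is well defined.\<close>

lemma discriminant_eqI:
  assumes basis: "lattice_basis (carrier (integers_of K)) v w"
    and D: "of_int D = (v * cnj w - w * cnj v)\<^sup>2"
  shows "discriminant K = D"
  unfolding discriminant_def
proof (rule the_equality)
  show "\<exists>v w. lattice_basis (carrier (integers_of K)) v w \<and> of_int D = (v * cnj w - w * cnj v)\<^sup>2"
    using assms by blast
next
  fix D' assume "\<exists>v w. lattice_basis (carrier (integers_of K)) v w \<and> of_int D' = (v * cnj w - w * cnj v)\<^sup>2"
  then obtain v' w' where basis': "lattice_basis (carrier (integers_of K)) v' w'"
    and D': "of_int D' = (v' * cnj w' - w' * cnj v')\<^sup>2" by blast
  have mem: "v' \<in> carrier (integers_of K)" "w' \<in> carrier (integers_of K)"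
    if "lattice_basis (carrier (integers_of K)) v' w'" for v' w'
  proof -
    have L: "carrier (integers_of K) = {of_int m * v' + of_int n * w' | m n. True}"
      using that by (simp add: lattice_basis_def)
    have "v' = of_int 1 * v' + of_int 0 * w'" "w' = of_int 0 * v' + of_int 1 * w'" by simp_all
    then show "v' \<in> carrier (integers_of K)" "w' \<in> carrier (integers_of K)"
      unfolding L by blast+
  qed
  have rep: "\<exists>m n. z = of_int m * v' + of_int n * w'"
    if "lattice_basis (carrier (integers_of K)) v' w'" "z \<in> carrier (integers_of K)" for v' w' z
    using that by (auto simp: lattice_basis_def)
  obtain a b where v: "v = of_int a * v' + of_int b * w'" using rep[OF basis' mem(1)[OF basis]] by blast
  obtain c d where w: "w = of_int c * v' + of_int d * w'" using rep[OF basis' mem(2)[OF basis]] by blast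
  obtain p q where v': "v' = of_int p * v + of_int q * w" using rep[OF basis mem(1)[OF basis']] by blast
  obtain r s where w': "w' = of_int r * v + of_int s * w" using rep[OF basis mem(2)[OF basis']] by blast
  have "of_int (a * p + b * r - 1) * v + of_int (a * q + b * s) * w = 0"
    using v unfolding v' w' by (simp add: algebra_simps)
  then have 1: "a * p + b * r - 1 = 0" "a * q + b * s = 0"
    using basis unfolding lattice_basis_def by blast+
  have "of_int (c * p + d * r) * v + of_int (c * q + d * s - 1) * w = 0"
    using w unfolding v' w' by (simp add: algebra_simps)
  then have 2: "c * p + d * r = 0" "c * q + d * s - 1 = 0"
    using basis unfolding lattice_basis_def by blast+
  have det: "(a * d - b * c) * (p * s - q * r) = 1"
  proof -
    have "(a * d - b * c) * (p * s - q * r) =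
        (a * p + b * r) * (c * q + d * s) - (a * q + b * s) * (c * p + d * r)"
      by (simp add: algebra_simps)
    also have "\<dots> = 1 * 1 - 0 * 0" using 1 2 by (simp only: right_minus_eq)
    finally show ?thesis by simp
  qed
  then have "\<bar>p * s - q * r\<bar> = 1"
    by (metis abs_mult abs_one zmult_eq_1_iff abs_minus_cancel)
  then have sq: "(p * s - q * r)\<^sup>2 = 1" by (simp add: power2_eq_1_iff abs_if split: if_splits)
  have "v' * cnj w' - w' * cnj v' = of_int (p * s - q * r) * (v * cnj w - w * cnj v)"
    unfolding v' w' by (simp add: algebra_simps)
  then have "of_int D' = (of_int ((p * s - q * r)\<^sup>2) :: complex) * of_int D"
    using D D' by (simp add: power_mult_distrib)
  then show "D' = D" by (simp only: sq of_int_1 mult_1 of_int_eq_iff)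
qed

lemma integers_of_carrier: "carrier (integers_of K) = {x \<in> K. algebraic_int x}"
  by (simp add: integers_of_def)

text \<open>The lattice basis will come from the fundamental parallelogram. If g divides both
  coordinates of 1, then 1 / g is a rational algebraic integer, so g is a unit. Hence 1 is a
  primitive lattice vector and Bezout completes it to a basis 1, \<open>\<omega>0\<close>.\<close>

lemma imaginary_quadratic_field_imag_quad:
  assumes K: "imaginary_quadratic_field K"
    and basis: "lattice_basis (carrier (integers_of K)) v w"
  obtains \<omega> T N where "imag_quad \<omega> T N" "carrier (integers_of K) = imag_quad.\<O> \<omega>"
    "discriminant K = T\<^sup>2 - 4 * N"
proof -
  note cl = imaginary_quadratic_field_closed[OF K]
  let ?O = "carrier (integers_of K)"
  have L: "?O = {of_int m * v + of_int n * w | m n. True}"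
    and indep: "\<And>m n. of_int m * v + of_int n * w = 0 \<Longrightarrow> m = 0 \<and> n = 0"
    using basis by (auto simp: lattice_basis_def)
  have int_mem: "of_int m \<in> ?O" for m
    using cl(7)[of m] by (simp add: integers_of_carrier)
  then have "1 \<in> ?O" by (metis of_int_1)
  then obtain a b where ab: "1 = of_int a * v + of_int b * w" unfolding L by blast
  have "gcd a b = 1"
  proof -
    define g where "g = gcd a b"
    have g0: "g \<noteq> 0" using ab by (auto simp: g_def)
    obtain a' b' where "a = g * a'" "b = g * b'" by (metis g_def gcd_dvd1 gcd_dvd2 dvdE)
    then have "1 = of_int g * (of_int a' * v + of_int b' * w)" using ab by (simp add: algebra_simps)
    then have "1 / of_int g = of_int a' * v + of_int b' * w" using g0 by (simp add: field_simps)
    then have "1 / of_int g \<in> ?O" unfolding L by blast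
    then have "algebraic_int (1 / of_int g :: complex)" by (simp add: integers_of_carrier)
    moreover have "1 / of_int g \<in> (\<rat> :: complex set)" by simp
    ultimately obtain h where "1 / of_int g = (of_int h :: complex)"
      using rational_algebraic_int_is_int by (metis Ints_cases)
    then have "of_int (h * g) = (1 :: complex)" using g0 by (simp add: field_simps)
    then have "h * g = 1" by (metis of_int_eq_1_iff)
    then have "g dvd 1" by (metis dvd_triv_right)
    then show ?thesis by (simp add: g_def)
  qed
  then obtain r s where rs: "r * a + s * b = 1" by (metis bezout_int)
  define \<omega>0 where "\<omega>0 = of_int (- s) * v + of_int r * w"
  have span0: "?O = {of_int m + of_int n * \<omega>0 | m n. True}"
  proof
    show "?O \<subseteq> {of_int m + of_int n * \<omega>0 | m n. True}"
    proof
      fix z assume "z \<in> ?O"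
      then obtain m n where z: "z = of_int m * v + of_int n * w" unfolding L by blast
      have c: "of_int r * of_int a + of_int s * of_int b = (1::complex)"
        using arg_cong[OF rs, of of_int] by simp
      have "v = of_int r * (of_int a * v + of_int b * w) - of_int b * \<omega>0"
      proof -
        have "of_int r * (of_int a * v + of_int b * w) - of_int b * \<omega>0 =
            (of_int r * of_int a + of_int s * of_int b) * v"
          by (simp add: \<omega>0_def algebra_simps)
        then show ?thesis using c by simp
      qed
      moreover have "w = of_int s * (of_int a * v + of_int b * w) + of_int a * \<omega>0"
      proof -
        have "of_int s * (of_int a * v + of_int b * w) + of_int a * \<omega>0 =
            (of_int r * of_int a + of_int s * of_int b) * w"
          by (simp add: \<omega>0_def algebra_simps)
        then show ?thesis using c by simp
      qed
      ultimately have "v = of_int r - of_int b * \<omega>0" "w = of_int s + of_int a * \<omega>0"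
        unfolding ab[symmetric] by simp_all
      then have "z = of_int m * (of_int r - of_int b * \<omega>0) + of_int n * (of_int s + of_int a * \<omega>0)"
        using z by (simp only:)
      then have "z = of_int (m * r + n * s) + of_int (n * a - m * b) * \<omega>0"
        by (simp add: algebra_simps)
      then show "z \<in> {of_int m + of_int n * \<omega>0 | m n. True}" by blast
    qed
    show "{of_int m + of_int n * \<omega>0 | m n. True} \<subseteq> ?O"
    proof
      fix z assume "z \<in> {of_int m + of_int n * \<omega>0 | m n. True}"
      then obtain m n where z: "z = of_int m * 1 + of_int n * \<omega>0" by auto
      have "z = of_int (m * a - n * s) * v + of_int (m * b + n * r) * w"
        unfolding z ab \<omega>0_def by (simp add: algebra_simps)
      then show "z \<in> ?O" unfolding L by blast
    qed
  qed
  obtain x where x: "x \<in> K" "x \<notin> \<real>" using K by (auto simp: imaginary_quadratic_field_def)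
  obtain A B C where ABC: "A \<noteq> 0" "of_int A * x\<^sup>2 = of_int B * x - of_int C"
    using imaginary_quadratic_field_quadratic[OF K x] by metis
  have "(of_int A * x)\<^sup>2 = of_int A * (of_int A * x\<^sup>2)" by (simp add: power2_eq_square)
  also have "\<dots> = of_int B * (of_int A * x) - of_int (A * C)"
    unfolding ABC(2) by (simp add: algebra_simps)
  finally have "algebraic_int (of_int A * x)" by (rule algebraic_int_monic_quadratic)
  then have "of_int A * x \<in> ?O" using x cl by (simp add: integers_of_carrier)
  then obtain m n where mn: "of_int A * x = of_int m + of_int n * \<omega>0" unfolding span0 by blast
  have "Im x \<noteq> 0" using x(2) complex_is_Real_iff by blast
  then have "Im \<omega>0 \<noteq> 0" using arg_cong[OF mn, of Im] ABC(1) by auto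
  define \<omega> where "\<omega> = (if Im \<omega>0 > 0 then \<omega>0 else - \<omega>0)"
  have Im: "Im \<omega> > 0" using \<open>Im \<omega>0 \<noteq> 0\<close> by (auto simp: \<omega>_def)
  have span: "?O = {of_int m + of_int n * \<omega> | m n. True}"
  proof (cases "Im \<omega>0 > 0")
    case False
    have "{of_int m + of_int n * \<omega>0 | m n. True} = {of_int m + of_int n * (- \<omega>0) | m n. True}"
    proof (intro subset_antisym subsetI)
      fix z assume "z \<in> {of_int m + of_int n * \<omega>0 | m n. True}"
      then obtain m n where "z = of_int m + of_int n * \<omega>0" by blast
      then have "z = of_int m + of_int (- n) * (- \<omega>0)" by simp
      then show "z \<in> {of_int m + of_int n * (- \<omega>0) | m n. True}" by blast
    next
      fix z assume "z \<in> {of_int m + of_int n * (- \<omega>0) | m n. True}"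
      then obtain m n where "z = of_int m + of_int n * (- \<omega>0)" by blast
      then have "z = of_int m + of_int (- n) * \<omega>0" by simp
      then show "z \<in> {of_int m + of_int n * \<omega>0 | m n. True}" by blast
    qed
    then show ?thesis using False span0 by (simp add: \<omega>_def)
  qed (simp add: \<omega>_def span0)
  have \<omega>O: "\<omega> \<in> ?O" unfolding span by (metis (mono_tags, lifting) CollectI add_0 mult_1 of_int_0 of_int_1)
  have \<omega>nr: "\<omega> \<notin> \<real>" using Im complex_is_Real_iff by force
  have \<omega>K: "\<omega> \<in> K" "algebraic_int \<omega>" using \<omega>O by (auto simp: integers_of_carrier)
  obtain A' T' N' where q: "A' \<noteq> 0" "gcd A' (gcd T' N') = 1" "of_int A' * \<omega>\<^sup>2 = of_int T' * \<omega> - of_int N'"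
    using imaginary_quadratic_field_quadratic[OF K \<omega>K(1) \<omega>nr] by metis
  have "A' dvd 1" by (rule algebraic_int_quadratic_monic[OF \<omega>K(2) \<omega>nr q])
  then have A'2: "of_int A' * of_int A' = (1::complex)"
    by (metis abs_mult_self_eq mult_1 of_int_1 of_int_mult zdvd1_eq)
  define T N where "T = A' * T'" and "N = A' * N'"
  have sq: "\<omega>\<^sup>2 = of_int T * \<omega> - of_int N"
  proof -
    have "\<omega>\<^sup>2 = of_int A' * (of_int A' * \<omega>\<^sup>2)" using A'2 by (simp add: mult.assoc[symmetric])
    also have "\<dots> = of_int T * \<omega> - of_int N"
      unfolding q(3) by (simp add: T_def N_def algebra_simps)
    finally show ?thesis .
  qed
  have iq: "imag_quad \<omega> T N"
  proof
    show "0 < Im \<omega>" "\<omega>\<^sup>2 = of_int T * \<omega> - of_int N" by fact+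
    fix a b m t n :: int
    assume m: "m \<noteq> 0" and eq: "((of_int a + of_int b * \<omega>) / of_int m)\<^sup>2 =
        of_int t * ((of_int a + of_int b * \<omega>) / of_int m) - of_int n"
    have "(of_int a + of_int b * \<omega>) / of_int m \<in> ?O"
      using algebraic_int_monic_quadratic[OF eq] cl \<omega>K by (simp add: integers_of_carrier)
    then obtain c d where "(of_int a + of_int b * \<omega>) / of_int m = of_int c + of_int d * \<omega>"
      unfolding span by blast
    then have e: "of_int a + of_int b * \<omega> = of_int (m * c) + of_int (m * d) * \<omega>"
      using m by (simp add: field_simps)
    have "real_of_int b = of_int (m * d)" using arg_cong[OF e, of Im] Im by simp
    then have b: "b = m * d" by linarith
    have "of_int a = (of_int (m * c) :: complex)" using e by (simp add: b)
    then have "a = m * c" by (metis of_int_eq_iff)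
    then show "m dvd a \<and> m dvd b" using b by simp
  qed
  then interpret imag_quad \<omega> T N .
  have "?O = \<O>" by (simp add: span \<O>_def)
  moreover have "discriminant K = T\<^sup>2 - 4 * N"
  proof (rule discriminant_eqI)
    show "lattice_basis ?O 1 \<omega>"
      unfolding lattice_basis_def
    proof (intro conjI allI impI)
      show "?O = {of_int m * 1 + of_int n * \<omega> | m n. True}" by (simp add: span)
      fix m n assume e: "of_int m * 1 + of_int n * \<omega> = 0"
      have "real_of_int n * Im \<omega> = 0" using arg_cong[OF e, of Im] by simp
      then show "n = 0" using Im by simp
      then show "m = 0" using e by simp
    qed
    have "(cnj \<omega> - \<omega>)\<^sup>2 = of_real (- (D\<^sup>2))"
      by (rule complex_eqI) (simp_all add: D_def power2_eq_square)
    then show "of_int (T\<^sup>2 - 4 * N) = (1 * cnj \<omega> - \<omega> * cnj 1)\<^sup>2"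
      unfolding D_square by simp
  qed
  ultimately show ?thesis using that iq by blast
qed

section \<open>Hemispheres and the Bianchi polyhedron\<close>

lemma interior_finite_Union_closed_empty:
  assumes "finite I" "\<And>i. i \<in> I \<Longrightarrow> closed (C i)" "\<And>i. i \<in> I \<Longrightarrow> interior (C i) = {}"
  shows "interior (\<Union>i\<in>I. C i) = {}"
  using assms
proof (induction I)
  case (insert i I)
  then have "interior (\<Union>i\<in>I. C i) = {}" by auto
  then have "interior (C i \<union> (\<Union>i\<in>I. C i)) = interior (C i)"
    using insert.prems by (intro interior_closed_Un_empty_interior) auto
  then show ?case using insert.prems by simp
qed simp

context imag_quad
begin

text \<open>The squared height of the hemisphere with centre \<open>l / m\<close> above the point \<open>z\<close>, negative
  outside of its base disc.\<close>

definition dome :: "complex \<Rightarrow> complex \<Rightarrow> complex \<Rightarrow> real" where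
  "dome l m z = 1 / (cmod m)\<^sup>2 - (cmod (z - l / m))\<^sup>2"

lemma dome_iff:
  assumes "m \<noteq> 0"
  shows "\<tau> < dome l m z \<longleftrightarrow> (cmod (m * z - l))\<^sup>2 + (cmod m)\<^sup>2 * \<tau> < 1"
    and "\<tau> \<le> dome l m z \<longleftrightarrow> (cmod (m * z - l))\<^sup>2 + (cmod m)\<^sup>2 * \<tau> \<le> 1"
    and "dome l m z \<le> \<tau> \<longleftrightarrow> 1 \<le> (cmod (m * z - l))\<^sup>2 + (cmod m)\<^sup>2 * \<tau>"
proof -
  have "m * z - l = m * (z - l / m)" using assms by (simp add: algebra_simps)
  then have "(cmod (m * z - l))\<^sup>2 = (cmod m)\<^sup>2 * (cmod (z - l / m))\<^sup>2"
    by (simp add: norm_mult power_mult_distrib)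
  moreover have "(cmod m)\<^sup>2 * dome l m z = 1 - (cmod m)\<^sup>2 * (cmod (z - l / m))\<^sup>2"
    using assms by (simp add: dome_def right_diff_distrib)
  ultimately have eq: "(cmod (m * z - l))\<^sup>2 + (cmod m)\<^sup>2 * \<tau> - 1 = (cmod m)\<^sup>2 * (\<tau> - dome l m z)"
    by (simp add: right_diff_distrib)
  have pos: "(cmod m)\<^sup>2 > 0" using assms by simp
  have "\<tau> < dome l m z \<longleftrightarrow> (cmod m)\<^sup>2 * (\<tau> - dome l m z) < 0"
    using pos by (simp add: mult_less_0_iff)
  then show "\<tau> < dome l m z \<longleftrightarrow> (cmod (m * z - l))\<^sup>2 + (cmod m)\<^sup>2 * \<tau> < 1"
    unfolding eq[symmetric] by simp
  then show "dome l m z \<le> \<tau> \<longleftrightarrow> 1 \<le> (cmod (m * z - l))\<^sup>2 + (cmod m)\<^sup>2 * \<tau>" by linarith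
  have "\<tau> \<le> dome l m z \<longleftrightarrow> (cmod m)\<^sup>2 * (\<tau> - dome l m z) \<le> 0"
    using pos by (simp add: mult_le_0_iff)
  then show "\<tau> \<le> dome l m z \<longleftrightarrow> (cmod (m * z - l))\<^sup>2 + (cmod m)\<^sup>2 * \<tau> \<le> 1"
    unfolding eq[symmetric] by simp
qed

lemma continuous_dome: "continuous_on UNIV (dome l m)"
  unfolding dome_def by (intro continuous_intros)

text \<open>No parallelogram occurs here: a translation by a lattice element moves the open set over
  any given one, see \<open>essential_in_swan_set\<close>.\<close>

definition essential :: "complex \<Rightarrow> complex \<Rightarrow> bool" where
  "essential l m \<longleftrightarrow> l \<in> \<O> \<and> m \<in> \<O> \<and> m \<noteq> 0 \<and> cop l m \<and>
     (\<exists>V. open V \<and> V \<noteq> {} \<and> (\<forall>z\<in>V. 0 < dome l m z \<and>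
        (\<forall>a\<in>\<O>. \<forall>b\<in>\<O>. b \<noteq> 0 \<longrightarrow> cop a b \<longrightarrow> dome a b z \<le> dome l m z)))"

text \<open>Near a point below the floor only finitely many hemispheres matter, and the regions where each
  of them is the highest are closed, so that one of these regions has interior.\<close>

lemma exists_essential:
  assumes a0: "a0 \<in> \<O>" "b0 \<in> \<O>" "b0 \<noteq> 0" "cop a0 b0" and \<tau>: "0 < \<tau>" "\<tau> < dome a0 b0 z0"
  shows "\<exists>l m. essential l m \<and> \<tau> < dome l m z0"
proof -
  have op: "open {z. \<tau> < dome a0 b0 z}"
    by (intro open_Collect_less continuous_dome continuous_on_const)
  then obtain r0 where r0: "0 < r0" "ball z0 r0 \<subseteq> {z. \<tau> < dome a0 b0 z}"
    using \<tau> by (metis (mono_tags) mem_Collect_eq open_contains_ball)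
  \<comment> \<open>The hemispheres that reach the squared height \<tau> somewhere over the ball.
    The bound on |b| by 1 / sqrt \<tau> leaves finitely many.\<close>
  define P where "P = {(a, b). a \<in> \<O> \<and> b \<in> \<O> \<and> b \<noteq> 0 \<and> cop a b \<and> (\<exists>z\<in>ball z0 r0. \<tau> \<le> dome a b z)}"
  have "P \<subseteq> {x \<in> \<O>. cmod x \<le> 1 / sqrt \<tau> * (cmod z0 + r0) + 1} \<times> {x \<in> \<O>. cmod x \<le> 1 / sqrt \<tau>}"
  proof
    fix p assume "p \<in> P"
    then obtain a b z where p: "p = (a, b)" "a \<in> \<O>" "b \<in> \<O>" "b \<noteq> 0" "z \<in> ball z0 r0" "\<tau> \<le> dome a b z"
      by (auto simp: P_def)
    have 1: "(cmod (b * z - a))\<^sup>2 + (cmod b)\<^sup>2 * \<tau> \<le> 1"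
      using p(6) dome_iff(2)[OF p(4)] by blast
    moreover have "0 \<le> (cmod (b * z - a))\<^sup>2" "0 \<le> (cmod b)\<^sup>2 * \<tau>" using \<tau> by simp_all
    ultimately have 2: "(cmod b)\<^sup>2 * \<tau> \<le> 1" "(cmod (b * z - a))\<^sup>2 \<le> 1\<^sup>2"
      unfolding power_one by linarith+
    have "(cmod b * sqrt \<tau>)\<^sup>2 \<le> 1\<^sup>2" using 2 \<tau> by (simp add: power_mult_distrib)
    then have "cmod b * sqrt \<tau> \<le> 1" by (rule power2_le_imp_le) simp
    then have b: "cmod b \<le> 1 / sqrt \<tau>" using \<tau> by (simp add: field_simps)
    have "cmod (b * z - a) \<le> 1" using 2(2) by (rule power2_le_imp_le) simp
    then have "cmod a \<le> cmod b * cmod z + 1"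
      using norm_triangle_ineq2[of a "b * z"] by (simp add: norm_mult norm_minus_commute)
    also have "cmod z \<le> cmod z0 + r0"
      using p(5) norm_triangle_ineq2[of z z0] by (simp add: dist_norm norm_minus_commute)
    then have "cmod b * cmod z \<le> 1 / sqrt \<tau> * (cmod z0 + r0)"
      using b \<tau> by (intro mult_mono) auto
    finally show "p \<in> {x \<in> \<O>. cmod x \<le> 1 / sqrt \<tau> * (cmod z0 + r0) + 1} \<times> {x \<in> \<O>. cmod x \<le> 1 / sqrt \<tau>}"
      using p b by simp
  qed
  then have finP: "finite P" by (rule finite_subset) (intro finite_cartesian_product finite_O)
  define h where "h = (\<lambda>(a, b). dome a b)"
  have conth: "continuous_on UNIV (h p)" for p by (cases p) (simp add: h_def continuous_dome)
  \<comment> \<open>The hemisphere found must exceed \<tau> over \<open>z0\<close> itself and not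
    only nearby. On the smaller neighbourhood \<open>W\<close> those failing this lie below the
    hemisphere of \<open>a0\<close>, \<open>b0\<close>, so none of them is highest there.\<close>
  define Bad where "Bad = {p \<in> P. h p z0 \<le> \<tau>}"
  define W where "W = ball z0 r0 \<inter> (\<Inter>p\<in>Bad. {z. h p z < dome a0 b0 z})"
  have "open W" unfolding W_def Bad_def using finP
    by (intro open_Int open_INT open_ball ballI open_Collect_less conth continuous_dome) auto
  moreover have "z0 \<in> W" using r0 \<tau> by (auto simp: W_def Bad_def)
  ultimately obtain r where r: "0 < r" "cball z0 r \<subseteq> W" by (metis open_contains_cball)
  define C where "C p = cball z0 r \<inter> (\<Inter>q\<in>P. {z. h q z \<le> h p z})" for p
  have closedC: "closed (C p)" for p
    unfolding C_def by (intro closed_Int closed_INT closed_cball ballI closed_Collect_le conth)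
  have p0: "(a0, b0) \<in> P" using a0 r0 \<tau> by (auto simp: P_def intro!: bexI[of _ z0])
  have cover: "cball z0 r \<subseteq> (\<Union>p\<in>P - Bad. C p)"
  proof
    fix z assume z: "z \<in> cball z0 r"
    obtain p where p: "p \<in> P" "\<And>q. q \<in> P \<Longrightarrow> h q z \<le> h p z"
    proof -
      have fin: "finite ((\<lambda>p. h p z) ` P)" "(\<lambda>p. h p z) ` P \<noteq> {}" using finP p0 by auto
      from Max_in[OF this] obtain p where p: "p \<in> P" "Max ((\<lambda>p. h p z) ` P) = h p z" by auto
      then have "h q z \<le> h p z" if "q \<in> P" for q using Max_ge[OF fin(1), of "h q z"] that by auto
      then show ?thesis using p(1) that by blast
    qed
    have "p \<notin> Bad"
    proof
      assume "p \<in> Bad"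
      then have "h p z < dome a0 b0 z" using z r by (auto simp: W_def)
      then show False using p(2)[OF p0] by (simp add: h_def)
    qed
    moreover have "z \<in> C p" unfolding C_def using z p(2) by blast
    ultimately show "z \<in> (\<Union>p\<in>P - Bad. C p)" using p(1) by blast
  qed
  have "\<exists>p\<in>P - Bad. interior (C p) \<noteq> {}"
  proof (rule ccontr)
    assume "\<not> ?thesis"
    then have "interior (\<Union>p\<in>P - Bad. C p) = {}"
      using finP closedC by (intro interior_finite_Union_closed_empty) auto
    then have "interior (cball z0 r) = {}" using interior_mono[OF cover] by auto
    then show False using r by simp
  qed
  then obtain l m where p: "(l, m) \<in> P" "(l, m) \<notin> Bad" "interior (C (l, m)) \<noteq> {}" by auto
  have "\<tau> < dome l m z0" using p by (auto simp: Bad_def h_def)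
  moreover have "essential l m"
    unfolding essential_def
  proof (intro conjI exI[of _ "interior (C (l, m))"] ballI impI)
    show "l \<in> \<O>" "m \<in> \<O>" "m \<noteq> 0" "cop l m" using p by (auto simp: P_def)
    show "open (interior (C (l, m)))" "interior (C (l, m)) \<noteq> {}" using p by auto
    fix z assume "z \<in> interior (C (l, m))"
    then have z: "z \<in> C (l, m)" using interior_subset by blast
    then have le: "h q z \<le> dome l m z" if "q \<in> P" for q using z that unfolding C_def by (auto simp: h_def)
    have zW: "z \<in> ball z0 r0" using z r by (auto simp: C_def W_def)
    then have lt: "\<tau> < dome l m z" using le[OF p0] r0 by (auto simp: h_def)
    then show "0 < dome l m z" using \<tau> by simp
    fix a b assume ab: "a \<in> \<O>" "b \<in> \<O>" "b \<noteq> 0" "cop a b"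
    show "dome a b z \<le> dome l m z"
    proof (cases "\<tau> \<le> dome a b z")
      case True
      then have "(a, b) \<in> P" using ab zW by (auto simp: P_def)
      then show ?thesis using le by (force simp: h_def)
    qed (use lt in simp)
  qed
  ultimately show ?thesis by blast
qed

lemma essential_shift:
  assumes "essential l m" "s \<in> \<O>"
  shows "l + s * m \<in> \<O>" "cop (l + s * m) m" "dome (l + s * m) m (z + s) = dome l m z"
proof -
  show "l + s * m \<in> \<O>" "cop (l + s * m) m"
    using assms by (auto simp: essential_def intro!: cop_shift)
  have "m \<noteq> 0" using assms by (auto simp: essential_def)
  then have "z + s - (l + s * m) / m = z - l / m" by (simp add: add_divide_distrib)
  then show "dome (l + s * m) m (z + s) = dome l m z" by (simp only: dome_def)
qed

end

section \<open>Coprime pairs, the Bianchi polyhedron and Swan's number\<close>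

locale imag_quad_field = imag_quad \<omega> T N for \<omega> T N +
  fixes K :: "complex set"
  assumes carrier_integers: "carrier (integers_of K) = \<O>"
begin

abbreviation R :: "complex ring" where "R \<equiv> integers_of K"

lemma R_simps [simp]:
  "carrier R = \<O>" "x \<otimes>\<^bsub>R\<^esub> y = x * y" "x \<oplus>\<^bsub>R\<^esub> y = x + y" "\<one>\<^bsub>R\<^esub> = 1" "\<zero>\<^bsub>R\<^esub> = 0"
  using carrier_integers by (simp_all add: integers_of_def ring_of_type_algebra_def)

lemma cring_R: "cring R"
proof (rule cringI)
  show "abelian_group R"
    by (rule abelian_groupI) (auto simp: algebra_simps intro!: bexI[of _ "- x" for x])
  show "comm_monoid R"
    by (rule comm_monoidI) (auto simp: algebra_simps)
qed (auto simp: algebra_simps)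

sublocale R: cring R by (rule cring_R)

lemma ideal_iff:
  "ideal A R \<longleftrightarrow> A \<subseteq> \<O> \<and> 0 \<in> A \<and> (\<forall>x\<in>A. \<forall>y\<in>A. x + y \<in> A) \<and> (\<forall>x\<in>A. \<forall>r\<in>\<O>. r * x \<in> A)"
proof
  assume "ideal A R"
  then interpret ideal A R .
  show "A \<subseteq> \<O> \<and> 0 \<in> A \<and> (\<forall>x\<in>A. \<forall>y\<in>A. x + y \<in> A) \<and> (\<forall>x\<in>A. \<forall>r\<in>\<O>. r * x \<in> A)"
    using a_subset zero_closed a_closed I_l_closed by auto
next
  assume A: "A \<subseteq> \<O> \<and> 0 \<in> A \<and> (\<forall>x\<in>A. \<forall>y\<in>A. x + y \<in> A) \<and> (\<forall>x\<in>A. \<forall>r\<in>\<O>. r * x \<in> A)"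
  have minus: "\<ominus>\<^bsub>R\<^esub> x = - x" if "x \<in> \<O>" for x
    using R.minus_equality[of "- x" x] that by simp
  have um: "- x \<in> A" if "x \<in> A" for x
    using A that by (metis O_1 O_uminus mult_minus1)
  show "ideal A R"
  proof (rule idealI)
    show "ring R" by (rule R.ring_axioms)
    show "subgroup A (add_monoid R)"
    proof (rule group.subgroupI)
      show "group (add_monoid R)" by (rule R.a_group)
      fix x assume x: "x \<in> A"
      then have "inv\<^bsub>add_monoid R\<^esub> x = - x" using minus A by (auto simp: a_inv_def)
      then show "inv\<^bsub>add_monoid R\<^esub> x \<in> A" using um x by simp
    qed (use A in auto)
    fix x r assume "x \<in> A" "r \<in> carrier R"
    then show "r \<otimes>\<^bsub>R\<^esub> x \<in> A" "x \<otimes>\<^bsub>R\<^esub> r \<in> A" using A by (auto simp: mult.commute)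
  qed
qed

lemma Idl_pair:
  assumes "l \<in> \<O>" "m \<in> \<O>"
  shows "Idl\<^bsub>R\<^esub> {l, m} = {r * l + s * m | r s. r \<in> \<O> \<and> s \<in> \<O>}" (is "_ = ?I")
proof
  have "ideal ?I R"
    unfolding ideal_iff
  proof (intro conjI ballI)
    show "?I \<subseteq> \<O>" using assms by auto
    show "0 \<in> ?I" by (auto intro!: exI[of _ 0])
    fix x assume "x \<in> ?I"
    then obtain r s where x: "x = r * l + s * m" "r \<in> \<O>" "s \<in> \<O>" by blast
    { fix y assume "y \<in> ?I"
      then obtain r' s' where y: "y = r' * l + s' * m" "r' \<in> \<O>" "s' \<in> \<O>" by blast
      have "x + y = (r + r') * l + (s + s') * m" unfolding x y by (simp add: algebra_simps)
      then show "x + y \<in> ?I" using x y O_add by blast }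
    fix q assume q: "q \<in> \<O>"
    have "q * x = (q * r) * l + (q * s) * m" unfolding x by (simp add: algebra_simps)
    then show "q * x \<in> ?I" using x q O_mult by blast
  qed
  moreover have "l = 1 * l + 0 * m" "m = 0 * l + 1 * m" by simp_all
  then have "l \<in> ?I" "m \<in> ?I" using O_0 O_1 by blast+
  ultimately show "Idl\<^bsub>R\<^esub> {l, m} \<subseteq> ?I" by (intro R.genideal_minimal) auto
  have I: "ideal (Idl\<^bsub>R\<^esub> {l, m}) R" using assms by (intro R.genideal_ideal) auto
  have mem: "l \<in> Idl\<^bsub>R\<^esub> {l, m}" "m \<in> Idl\<^bsub>R\<^esub> {l, m}"
    using R.genideal_self[of "{l, m}"] assms by auto
  show "?I \<subseteq> Idl\<^bsub>R\<^esub> {l, m}" using I mem unfolding ideal_iff by blast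
qed

lemma Idl_pair_eq_carrier:
  assumes "l \<in> \<O>" "m \<in> \<O>"
  shows "Idl\<^bsub>R\<^esub> {l, m} = carrier R \<longleftrightarrow> cop l m"
proof
  assume "Idl\<^bsub>R\<^esub> {l, m} = carrier R"
  then have "1 \<in> Idl\<^bsub>R\<^esub> {l, m}" by simp
  then obtain r s where "1 = r * l + s * m" "r \<in> \<O>" "s \<in> \<O>" unfolding Idl_pair[OF assms] by blast
  then show "cop l m" by (intro copI[of r s]) auto
next
  assume "cop l m"
  then have "1 \<in> Idl\<^bsub>R\<^esub> {l, m}" unfolding Idl_pair[OF assms] cop_def by force
  moreover have "ideal (Idl\<^bsub>R\<^esub> {l, m}) R" using assms by (intro R.genideal_ideal) auto
  ultimately show "Idl\<^bsub>R\<^esub> {l, m} = carrier R" using ideal.one_imp_carrier by fastforce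
qed

lemma SL2_matrix:
  assumes "a \<in> \<O>" "b \<in> \<O>" "c \<in> \<O>" "d \<in> \<O>" "a * d - b * c = 1"
  shows "vector [vector [a, b], vector [c, d]] \<in> carrier (SL2 R)"
  using assms by (auto simp: SL2_def det_2 forall_2 vector_2)

lemma carrier_PSL2: "carrier (PSL2 R) = {{A, - A} | A. A \<in> carrier (SL2 R)}"
proof -
  have "{mat 1, - mat 1} #>\<^bsub>SL2 R\<^esub> A = {A, - A}" for A
  proof -
    have "(- mat 1) ** A = - A" by (simp add: matrix_matrix_mult_def vec_eq_iff mat_def if_distrib[of "\<lambda>x. x * _"] sum_negf cong: if_cong)
    then show ?thesis by (auto simp: r_coset_def SL2_def)
  qed
  then show ?thesis by (auto simp: PSL2_def FactGroup_def RCOSETS_def)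
qed

lemma PSL2_act_pair: "PSL2_act {A, - A} P = SL2_act A P"
  by (simp add: PSL2_act_def SL2_act_uminus)

lemma snd_SL2_act: "snd (SL2_act A P) = snd P / ((cmod (A $ 2 $ 1 * fst P + A $ 2 $ 2))\<^sup>2 + (cmod (A $ 2 $ 1))\<^sup>2 * (snd P)\<^sup>2)"
  by (simp add: SL2_act_def Let_def)

text \<open>Only the lower row of a matrix enters the height of the image point, and lower rows of
  determinant 1 matrices are exactly the coprime pairs. For the row (b, -a) the denominator of the
  height is the expression on the right.\<close>

lemma bianchi_polyhedron_iff:
  "P \<in> bianchi_polyhedron K F \<longleftrightarrow> 0 < snd P \<and> fst P \<in> closure F \<and>
     (\<forall>a\<in>\<O>. \<forall>b\<in>\<O>. cop a b \<longrightarrow> 1 \<le> (cmod (b * fst P - a))\<^sup>2 + (cmod b)\<^sup>2 * (snd P)\<^sup>2)"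
proof -
  have key: "(\<forall>g\<in>carrier (PSL2 R). snd P \<ge> snd (PSL2_act g P)) \<longleftrightarrow>
     (\<forall>a\<in>\<O>. \<forall>b\<in>\<O>. cop a b \<longrightarrow> 1 \<le> (cmod (b * fst P - a))\<^sup>2 + (cmod b)\<^sup>2 * (snd P)\<^sup>2)"
    if pos: "0 < snd P"
  proof -
    define H where "H a b = (cmod (b * fst P - a))\<^sup>2 + (cmod b)\<^sup>2 * (snd P)\<^sup>2" for a b
    have le: "snd P / h \<le> snd P \<longleftrightarrow> 1 \<le> h" if "0 \<le> h" "h \<noteq> 0" for h
      using that pos by (simp add: field_simps)
    have Hnz: "H a b \<noteq> 0" if "cop a b" for a b
    proof
      assume "H a b = 0"
      then have "(cmod (b * fst P - a))\<^sup>2 = 0 \<and> (cmod b)\<^sup>2 * (snd P)\<^sup>2 = 0"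
        unfolding H_def by (subst (asm) add_nonneg_eq_0_iff) auto
      then have "b = 0" "a = 0" using pos by auto
      then show False using that by (simp add: cop_def)
    qed
    have Hpos: "0 \<le> H a b" for a b by (simp add: H_def)
    have "(\<forall>g\<in>carrier (PSL2 R). snd P \<ge> snd (PSL2_act g P)) \<longleftrightarrow>
        (\<forall>A\<in>carrier (SL2 R). snd P / H (- (A $ 2 $ 2)) (A $ 2 $ 1) \<le> snd P)"
    proof -
      have "(\<forall>g\<in>{{A, - A} | A. A \<in> carrier (SL2 R)}. Q g) \<longleftrightarrow> (\<forall>A\<in>carrier (SL2 R). Q {A, - A})" for Q
        by blast
      then show ?thesis unfolding carrier_PSL2 by (simp add: PSL2_act_pair snd_SL2_act H_def)
    qed
    also have "\<dots> \<longleftrightarrow> (\<forall>a\<in>\<O>. \<forall>b\<in>\<O>. cop a b \<longrightarrow> 1 \<le> H a b)"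
    proof (intro iffI ballI impI)
      fix a b assume *: "\<forall>A\<in>carrier (SL2 R). snd P / H (- (A $ 2 $ 2)) (A $ 2 $ 1) \<le> snd P"
        and ab: "a \<in> \<O>" "b \<in> \<O>" "cop a b"
      obtain r s where rs: "r \<in> \<O>" "s \<in> \<O>" "r * a + s * b = 1" using ab by (auto simp: cop_def)
      have "(- r) * (- a) - (- s) * b = 1" using rs by simp
      then have "vector [vector [- r, - s], vector [b, - a]] \<in> carrier (SL2 R)"
        using rs ab by (intro SL2_matrix) auto
      from bspec[OF * this] have "snd P / H a b \<le> snd P" by (simp add: vector_2)
      then show "1 \<le> H a b" using le Hpos Hnz ab by blast
    next
      fix A assume *: "\<forall>a\<in>\<O>. \<forall>b\<in>\<O>. cop a b \<longrightarrow> 1 \<le> H a b" and A: "A \<in> carrier (SL2 R)"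
      have mem: "A $ i $ j \<in> \<O>" for i j using A by (simp add: SL2_def)
      have "(- (A $ 1 $ 1)) * (- (A $ 2 $ 2)) + (- (A $ 1 $ 2)) * A $ 2 $ 1 = 1"
        using A by (simp add: SL2_def det_2)
      then have "cop (- (A $ 2 $ 2)) (A $ 2 $ 1)" using mem
        by (intro copI[of "- (A $ 1 $ 1)" "- (A $ 1 $ 2)"]) auto
      then show "snd P / H (- (A $ 2 $ 2)) (A $ 2 $ 1) \<le> snd P"
        using * mem Hnz Hpos le by auto
    qed
    finally show ?thesis by (simp add: H_def)
  qed
  show ?thesis
    by (cases "0 < snd P") (simp_all add: bianchi_polyhedron_def hyperbolic_space_def key)
qed

definition swan_set :: "complex set \<Rightarrow> real set" where
  "swan_set F = {cmod m | m. m \<in> carrier (integers_of K) \<and> m \<noteq> 0 \<and>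
     (\<exists>l \<in> carrier (integers_of K).
        Idl\<^bsub>integers_of K\<^esub> {l, m} = carrier (integers_of K) \<and>
        (\<exists>U. openin (top_of_set (hemisphere l m)) U \<and> U \<noteq> {} \<and>
             U \<subseteq> hemisphere l m \<inter> bianchi_polyhedron K F))}"

lemma swan_number_eq: "swan_number K F = Max (swan_set F)"
  by (simp add: swan_number_def swan_set_def)

lemma hemisphere_iff:
  assumes "m \<noteq> 0"
  shows "P \<in> hemisphere l m \<longleftrightarrow> 0 < snd P \<and> (snd P)\<^sup>2 = dome l m (fst P)"
proof -
  have "dist (l / m, 0) P = 1 / cmod m \<longleftrightarrow> (dist (l / m, 0) P)\<^sup>2 = (1 / cmod m)\<^sup>2"
    using power2_eq_iff_nonneg[of "dist (l / m, 0) P" "1 / cmod m"] by auto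
  also have "(dist (l / m, 0) P)\<^sup>2 = (cmod (fst P - l / m))\<^sup>2 + (snd P)\<^sup>2"
    by (simp add: dist_prod_def dist_norm norm_minus_commute)
  finally show ?thesis
    by (auto simp: hemisphere_def hyperbolic_space_def dome_def power_divide)
qed

text \<open>For the upper bound a single point of the open piece of the hemisphere is
  enough.\<close>

lemma swan_set_point:
  assumes "x \<in> swan_set F"
  obtains l m z t where "x = cmod m" "l \<in> \<O>" "m \<in> \<O>" "m \<noteq> 0" "cop l m" "0 < t"
    "(cmod (m * z - l))\<^sup>2 + (cmod m)\<^sup>2 * t\<^sup>2 = 1"
    "\<And>a b. a \<in> \<O> \<Longrightarrow> b \<in> \<O> \<Longrightarrow> cop a b \<Longrightarrow> 1 \<le> (cmod (b * z - a))\<^sup>2 + (cmod b)\<^sup>2 * t\<^sup>2"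
proof -
  obtain l m U where x: "x = cmod m" "m \<in> \<O>" "m \<noteq> 0" "l \<in> \<O>"
    "Idl\<^bsub>R\<^esub> {l, m} = carrier R" "U \<noteq> {}" "U \<subseteq> hemisphere l m \<inter> bianchi_polyhedron K F"
    using assms unfolding swan_set_def by auto
  then have c: "cop l m" using Idl_pair_eq_carrier by blast
  obtain z t where "(z, t) \<in> U" using x by auto
  then have h: "(z, t) \<in> hemisphere l m" and b: "(z, t) \<in> bianchi_polyhedron K F" using x by auto
  have t: "0 < t" "t\<^sup>2 = dome l m z" using h x hemisphere_iff by auto
  then have "(cmod (m * z - l))\<^sup>2 + (cmod m)\<^sup>2 * t\<^sup>2 = 1"
    using dome_iff(2)[OF x(3), of "t\<^sup>2" l z] dome_iff(3)[OF x(3), of l z "t\<^sup>2"] by simp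
  moreover have "1 \<le> (cmod (b * z - a))\<^sup>2 + (cmod b)\<^sup>2 * t\<^sup>2" if "a \<in> \<O>" "b \<in> \<O>" "cop a b" for a b
    using b that by (simp add: bianchi_polyhedron_iff)
  ultimately show ?thesis using that x c t by blast
qed

text \<open>The open set on which the hemisphere is highest is translated by a lattice element until
  it meets the interior \<open>Q\<close> of the parallelogram. Translation changes l to l + s m and
  keeps m, hence keeps the radius.\<close>

lemma essential_in_swan_set:
  assumes "essential l m" "fundamental_parallelogram \<O> F"
  shows "cmod m \<in> swan_set F"
proof -
  obtain p v w where basis: "lattice_basis \<O> v w"
    and F: "F = {p + of_real x * v + of_real y * w | x y. 0 \<le> x \<and> x < 1 \<and> 0 \<le> y \<and> y < 1}"
    using assms(2) by (auto simp: fundamental_parallelogram_def)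
  have L: "\<O> = {of_int m * v + of_int n * w | m n. True}"
    using basis by (simp add: lattice_basis_def)
  obtain a b where ab: "1 = of_int a * v + of_int b * w" using L O_1 by blast
  obtain c d where cd: "\<omega> = of_int c * v + of_int d * w" using L O_omega by blast
  define \<Delta> where "\<Delta> = Im (v * cnj w)"
  have "Im (1 * cnj \<omega>) = of_int (a * d - b * c) * \<Delta>"
    unfolding ab cd \<Delta>_def by (simp add: algebra_simps)
  then have \<Delta>: "\<Delta> \<noteq> 0" using Im_omega by auto
  define cx where "cx z = Im ((z - p) * cnj w) / \<Delta>" for z
  define cy where "cy z = - Im ((z - p) * cnj v) / \<Delta>" for z
  have XY: "z = p + of_real (cx z) * v + of_real (cy z) * w" for z
  proof -
    have "of_real \<Delta> * (z - p) = of_real (\<Delta> * cx z) * v + of_real (\<Delta> * cy z) * w"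
    proof -
      have e: "\<Delta> * cx z = Im ((z - p) * cnj w)" "\<Delta> * cy z = - Im ((z - p) * cnj v)"
        using \<Delta> by (simp_all add: cx_def cy_def)
      show ?thesis unfolding e
        by (intro complex_eqI) (simp_all add: \<Delta>_def algebra_simps)
    qed
    then have "of_real \<Delta> * (z - p) = of_real \<Delta> * (of_real (cx z) * v + of_real (cy z) * w)"
      by (simp add: algebra_simps)
    then have "z - p = of_real (cx z) * v + of_real (cy z) * w"
      using \<Delta> by (metis mult_cancel_left of_real_eq_0_iff)
    then show ?thesis by (simp add: algebra_simps)
  qed
  have Xadd: "cx (z + (of_real x * v + of_real y * w)) = cx z + x" and
       Yadd: "cy (z + (of_real x * v + of_real y * w)) = cy z + y" for z x y
    using \<Delta> by (simp_all add: cx_def cy_def \<Delta>_def field_simps)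
  define Q where "Q = {z. 0 < cx z} \<inter> {z. cx z < 1} \<inter> ({z. 0 < cy z} \<inter> {z. cy z < 1})"
  have "open Q" unfolding Q_def cx_def cy_def using \<Delta>
    by (intro open_Int open_Collect_less continuous_intros) auto
  have QF: "Q \<subseteq> F"
  proof
    fix z assume "z \<in> Q"
    then show "z \<in> F" unfolding F mem_Collect_eq using XY[of z]
      by (intro exI[of _ "cx z"] exI[of _ "cy z"]) (auto simp: Q_def)
  qed
  obtain V where V: "open V" "V \<noteq> {}" and Vd: "\<And>z. z \<in> V \<Longrightarrow> 0 < dome l m z"
    "\<And>z a b. z \<in> V \<Longrightarrow> a \<in> \<O> \<Longrightarrow> b \<in> \<O> \<Longrightarrow> b \<noteq> 0 \<Longrightarrow> cop a b \<Longrightarrow> dome a b z \<le> dome l m z"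
    and lm: "l \<in> \<O>" "m \<in> \<O>" "m \<noteq> 0" "cop l m"
    using assms(1) unfolding essential_def by blast
  obtain z0 where z0: "z0 \<in> V" using V by auto
  define s where "s = of_int (- \<lfloor>cx z0\<rfloor>) * v + of_int (- \<lfloor>cy z0\<rfloor>) * w"
  have s: "s \<in> \<O>" unfolding s_def L by blast
  define z1 where "z1 = z0 + s"
  have "z1 = z0 + (of_real (- \<lfloor>cx z0\<rfloor>) * v + of_real (- \<lfloor>cy z0\<rfloor>) * w)" by (simp add: z1_def s_def)
  then have z1: "0 \<le> cx z1" "cx z1 < 1" "0 \<le> cy z1" "cy z1 < 1"
    unfolding Xadd Yadd by (simp_all only: Xadd Yadd) linarith+
  define V1 where "V1 = (+) s ` V"
  have "open V1" unfolding V1_def using V by (intro open_translation)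
  moreover have "z1 \<in> V1" using z0 by (auto simp: V1_def z1_def)
  ultimately obtain r where r: "0 < r" "ball z1 r \<subseteq> V1" by (meson openE)
  \<comment> \<open>The translated point may lie on the lower edges of the parallelogram. A push by
    e in both coordinates moves it inside: \<open>e1\<close> and \<open>e2\<close> keep the
    coordinates below 1, \<open>e3\<close> keeps the point in the ball.\<close>
  define e1 e2 e3 where "e1 = (1 - cx z1) / 2" and "e2 = (1 - cy z1) / 2"
    and "e3 = r / (2 * (cmod v + cmod w + 1))"
  define e where "e = min e1 (min e2 e3)"
  have den: "0 < 2 * (cmod v + cmod w + 1)" by (smt (verit) norm_ge_zero)
  then have "0 < e1" "0 < e2" "0 < e3" using z1 r unfolding e1_def e2_def e3_def by simp_all
  then have "0 < e" "e \<le> e1" "e \<le> e2" "e \<le> e3" by (auto simp: e_def)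
  then have e: "0 < e" "e \<le> (1 - cx z1) / 2" "e \<le> (1 - cy z1) / 2" "e \<le> r / (2 * (cmod v + cmod w + 1))"
    unfolding e1_def e2_def e3_def by simp_all
  define z2 where "z2 = z1 + (of_real e * v + of_real e * w)"
  have "cmod (of_real e * v + of_real e * w) \<le> e * (cmod v + cmod w)"
    using e norm_triangle_ineq[of "of_real e * v" "of_real e * w"] by (simp add: norm_mult algebra_simps)
  also have "\<dots> \<le> e * (cmod v + cmod w + 1)" using e by simp
  also have "\<dots> < r" using e(4) den r by (simp add: field_simps)
  finally have "dist z2 z1 < r" by (simp add: z2_def dist_norm)
  then have "z2 \<in> V1" using r by (auto simp: dist_commute)
  moreover have "z2 \<in> Q" using e z1 by (auto simp: Q_def z2_def Xadd Yadd)
  ultimately have V2: "V1 \<inter> Q \<noteq> {}" "open (V1 \<inter> Q)" using \<open>open V1\<close> \<open>open Q\<close> by auto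
  define l' where "l' = l + s * m"
  have l': "l' \<in> \<O>" "cop l' m" using essential_shift[OF assms(1) s] by (auto simp: l'_def)
  have dome1: "0 < dome l' m z" if "z \<in> V1" for z
  proof -
    obtain y where "y \<in> V" "z = y + s" using \<open>z \<in> V1\<close> by (auto simp: V1_def)
    then show ?thesis using Vd essential_shift(3)[OF assms(1) s] by (simp add: l'_def)
  qed
  have dome2: "dome a b z \<le> dome l' m z" if "z \<in> V1" "a \<in> \<O>" "b \<in> \<O>" "b \<noteq> 0" "cop a b" for z a b
  proof -
    obtain y where y: "y \<in> V" "z = y + s" using \<open>z \<in> V1\<close> by (auto simp: V1_def)
    have "dome (a - s * b) b y \<le> dome l m y"
      using Vd(2)[OF y(1), of "a - s * b" b] that s cop_shift[of a b "- s"] by simp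
    moreover have "y - (a - s * b) / b = z - a / b" using y that by (simp add: diff_divide_distrib)
    then have "dome (a - s * b) b y = dome a b z" by (simp add: dome_def)
    ultimately show ?thesis using essential_shift(3)[OF assms(1) s] y by (simp add: l'_def)
  qed
  define U where "U = hemisphere l' m \<inter> fst -` (V1 \<inter> Q)"
  have "openin (top_of_set (hemisphere l' m)) U"
    unfolding U_def using V2(2) by (intro openin_open_Int open_vimage_fst)
  moreover have "U \<noteq> {}"
  proof -
    obtain z where z: "z \<in> V1 \<inter> Q" using V2 by blast
    then have "(z, sqrt (dome l' m z)) \<in> hemisphere l' m" using dome1[of z] by (simp add: hemisphere_iff lm)
    then show ?thesis using z by (auto simp: U_def)
  qed
  moreover have "U \<subseteq> hemisphere l' m \<inter> bianchi_polyhedron K F"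
  proof
    fix P assume P: "P \<in> U"
    then have h: "P \<in> hemisphere l' m" and z: "fst P \<in> V1" "fst P \<in> Q" by (auto simp: U_def)
    have t: "0 < snd P" "(snd P)\<^sup>2 = dome l' m (fst P)" using h by (simp_all add: hemisphere_iff lm)
    have "1 \<le> (cmod (b * fst P - a))\<^sup>2 + (cmod b)\<^sup>2 * (snd P)\<^sup>2" if "a \<in> \<O>" "b \<in> \<O>" "cop a b" for a b
    proof (cases "b = 0")
      case True
      then have "a \<noteq> 0" using that by (auto simp: cop_def)
      then show ?thesis using True O_norm_ge_1[OF that(1)] by simp
    next
      case False
      then show ?thesis using dome_iff(3)[OF False, of a "fst P" "(snd P)\<^sup>2"] dome2[OF z(1)] that t by simp
    qed
    moreover have "fst P \<in> closure F" using z QF closure_subset by blast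
    ultimately show "P \<in> hemisphere l' m \<inter> bianchi_polyhedron K F"
      using h t by (simp add: bianchi_polyhedron_iff)
  qed
  moreover have "Idl\<^bsub>R\<^esub> {l', m} = carrier R" using Idl_pair_eq_carrier l' lm by blast
  ultimately show ?thesis unfolding swan_set_def mem_Collect_eq using lm l'
    by (intro exI[of _ m] conjI bexI[of _ l'] exI[of _ U]) auto
qed

end

section \<open>Lower bounds\<close>

lemma ex_min_image:
  fixes f :: "'a \<Rightarrow> real"
  assumes "finite S" "S \<noteq> {}"
  shows "\<exists>x\<in>S. \<forall>y\<in>S. f x \<le> f y"
proof -
  have fin: "finite (f ` S)" "f ` S \<noteq> {}" using assms by auto
  from Min_in[OF this] obtain x where "x \<in> S" "Min (f ` S) = f x" by auto
  then show ?thesis using Min_le[OF fin(1)] by force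
qed

context imag_quad
begin

lemma O_sum: "finite I \<Longrightarrow> (\<And>i. i \<in> I \<Longrightarrow> f i \<in> \<O>) \<Longrightarrow> sum f I \<in> \<O>"
  by (induction I rule: finite_induct) auto

text \<open>The geometric series for 1 / (1 + 2 \<alpha>), cut off at k, gives the Bezout
  coefficients. The fractions with these numerators and denominators are dense, which avoids
  reducing arbitrary fractions in a ring without gcds.\<close>

lemma cop_odd_power2:
  assumes "\<alpha> \<in> \<O>" shows "cop (2 * \<alpha> + 1) (2 ^ k)"
proof (rule copI)
  let ?x = "- (2 * \<alpha>)"
  show "(\<Sum>i<k. ?x ^ i) \<in> \<O>" "(- \<alpha>) ^ k \<in> \<O>" using assms by (auto intro!: O_sum)
  have "(1 - ?x) * (\<Sum>i<k. ?x ^ i) = 1 - ?x ^ k" by (rule one_diff_power_eq[symmetric])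
  moreover have "?x = (- \<alpha>) * 2" by simp
  then have "?x ^ k = (- \<alpha>) ^ k * 2 ^ k" by (simp only: power_mult_distrib)
  ultimately show "(\<Sum>i<k. ?x ^ i) * (2 * \<alpha> + 1) + (- \<alpha>) ^ k * 2 ^ k = 1"
    by (simp add: algebra_simps)
qed

lemma O_approx: obtains \<alpha> where "\<alpha> \<in> \<O>" "cmod (z - \<alpha>) \<le> 1 + cmod \<omega>"
proof -
  define y where "y = Im z / Im \<omega>"
  define x where "x = Re z - y * Re \<omega>"
  have z: "z = of_real x + of_real y * \<omega>"
    using Im_omega by (intro complex_eqI) (simp_all add: x_def y_def)
  define \<alpha> where "\<alpha> = of_int \<lfloor>x\<rfloor> + of_int \<lfloor>y\<rfloor> * \<omega>"
  have "z - \<alpha> = of_real (x - \<lfloor>x\<rfloor>) + of_real (y - \<lfloor>y\<rfloor>) * \<omega>"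
    unfolding z \<alpha>_def by (simp add: algebra_simps)
  then have "cmod (z - \<alpha>) \<le> \<bar>x - \<lfloor>x\<rfloor>\<bar> + \<bar>y - \<lfloor>y\<rfloor>\<bar> * cmod \<omega>"
    by (metis norm_mult norm_of_real norm_triangle_ineq)
  also have "\<dots> \<le> 1 + 1 * cmod \<omega>"
    by (intro add_mono mult_right_mono) (simp_all, linarith+)
  finally show ?thesis using that[of \<alpha>] by (simp add: \<alpha>_def)
qed

lemma fractions_dense:
  assumes "open U" "z \<in> U"
  obtains a b where "a \<in> \<O>" "b \<in> \<O>" "b \<noteq> 0" "cop a b" "a / b \<in> U"
proof -
  obtain e where e: "0 < e" "ball z e \<subseteq> U" using assms by (meson openE)
  define C where "C = 2 * (1 + cmod \<omega>)"
  have C: "0 < C" unfolding C_def by (smt (verit) norm_ge_zero)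
  obtain k where k: "C / e < 2 ^ k" using real_arch_pow[of 2 "C / e"] by auto
  obtain \<alpha> where \<alpha>: "\<alpha> \<in> \<O>" "cmod ((2 ^ k * z - 1) / 2 - \<alpha>) \<le> 1 + cmod \<omega>" using O_approx .
  have "z - (2 * \<alpha> + 1) / 2 ^ k = ((2 ^ k * z - 1) / 2 - \<alpha>) * (2 / 2 ^ k)"
    by (simp add: field_simps)
  then have "cmod (z - (2 * \<alpha> + 1) / 2 ^ k) = cmod ((2 ^ k * z - 1) / 2 - \<alpha>) * cmod (2 / 2 ^ k)"
    by (simp only: norm_mult)
  also have "cmod (2 / 2 ^ k) = 2 / 2 ^ k" by (simp add: norm_divide norm_power)
  also have "cmod ((2 ^ k * z - 1) / 2 - \<alpha>) * (2 / 2 ^ k) \<le> (1 + cmod \<omega>) * (2 / 2 ^ k)" using \<alpha> by (intro mult_right_mono) auto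
  also have "\<dots> = C / 2 ^ k" by (simp add: C_def)
  also have "\<dots> < e" using k e C by (simp add: field_simps)
  finally have "(2 * \<alpha> + 1) / 2 ^ k \<in> U" using e by (auto simp: dist_norm)
  then show ?thesis using that[of "2 * \<alpha> + 1" "2 ^ k"] \<alpha> cop_odd_power2 by auto
qed

text \<open>A point of the plane may lie in no base disc at all. A coprime fraction close to it is
  the centre of its own disc, so an essential hemisphere has positive height there.\<close>

lemma essential_near:
  assumes "open U" "z \<in> U"
  obtains \<zeta> l m where "\<zeta> \<in> U" "essential l m" "cmod (m * \<zeta> - l) < 1"
proof -
  obtain a b where ab: "a \<in> \<O>" "b \<in> \<O>" "b \<noteq> 0" "cop a b" "a / b \<in> U"
    using fractions_dense[OF assms] .
  define \<tau> where "\<tau> = dome a b (a / b) / 2"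
  have "0 < dome a b (a / b)" using ab by (simp add: dome_def)
  then have "0 < \<tau>" "\<tau> < dome a b (a / b)" by (simp_all add: \<tau>_def)
  then obtain l m where lm: "essential l m" "\<tau> < dome l m (a / b)"
    using exists_essential[OF ab(1-4)] by blast
  then have m: "m \<noteq> 0" by (simp add: essential_def)
  have "(cmod (m * (a / b) - l))\<^sup>2 + (cmod m)\<^sup>2 * \<tau> < 1" using dome_iff(1)[OF m] lm by blast
  moreover have "0 \<le> (cmod m)\<^sup>2 * \<tau>" using \<open>0 < \<tau>\<close> by simp
  ultimately have "(cmod (m * (a / b) - l))\<^sup>2 < 1\<^sup>2" unfolding power_one by linarith
  then have "cmod (m * (a / b) - l) < 1" by (rule power2_less_imp_less) simp
  then show ?thesis using that ab lm by blast
qed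

section \<open>The point exp(i pi / 3) and the bound (D - 2) / sqrt 3\<close>

lemma essential_norm_ge_1: "essential l m \<Longrightarrow> 1 \<le> cmod m"
  by (auto simp: essential_def intro: O_norm_ge_1)

text \<open>As 2 \<omega> - T = i D, an integral value k of 4 D puts i = (8 \<omega> - 4 T) / k into
  the field. Being integral it lies in the ring, so k divides 8. This settles the equality case of
  the next lemma.\<close>

lemma D_rational:
  assumes "4 * D = of_int k" shows "D \<le> 2"
proof -
  have k0: "k \<noteq> 0" using assms D_pos by auto
  have e: "2 * \<omega> - of_int T = \<i> * of_real D"
    by (rule complex_eqI) (simp_all add: D_def Re_omega)
  have "(of_int (- 4 * T) + of_int 8 * \<omega>) / of_int k = 4 * (2 * \<omega> - of_int T) / of_int k"
    by simp
  also have "\<dots> = \<i> * (4 * of_real D / of_int k)"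
    unfolding e by simp
  also have "4 * of_real D = (of_int k :: complex)" using assms by (metis of_real_mult of_real_numeral of_real_of_int_eq)
  finally have i: "(of_int (- 4 * T) + of_int 8 * \<omega>) / of_int k = \<i>" using k0 by simp
  have "k dvd - 4 * T \<and> k dvd 8"
    by (rule maximal[OF k0, of _ _ 0 1]) (simp only: i, simp)
  then have "k \<le> 8" by (auto dest: zdvd_imp_le)
  then show ?thesis using assms by simp
qed

text \<open>Imaginary parts in the ring are multiples of D / 2, so the imaginary part of m z0 - l is
  Re m * sqrt 3 / 2 - e D / 4 with e = 2 c - b. For |e| at least 2 this forces |Re m| to reach (D -
  2) / sqrt 3, so m is a rational integer and equality holds, which \<open>D_rational\<close>
  excludes. For |e| = 1 the integer b is odd, and m is nonreal and too long. For e = 0 either m is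
  again too long or l and m are rational integers, and the form i^2 - i k + k^2 takes a value at
  most 1 only at the trivial pairs.\<close>

lemma sixth_root_analysis:
  assumes "l \<in> \<O>" "m \<in> \<O>" "m \<noteq> 0" and le: "cmod (m * Complex (1 / 2) (sqrt 3 / 2) - l) \<le> 1"
    and mB: "cmod m \<le> (D - 2) / sqrt 3"
  shows "(m = 1 \<or> m = -1) \<and> (l = 0 \<or> l = m)"
proof -
  obtain b :: int where b: "Im m = of_int b * (D / 2)" using Im_O assms(2) by blast
  obtain c :: int where c: "Im l = of_int c * (D / 2)" using Im_O assms(1) by blast
  define x where "x = Re m"
  define s where "s = sqrt (3 :: real)"
  have s: "s\<^sup>2 = 3" "0 < s" by (simp_all add: s_def)
  have "0 < cmod m" using assms by simp
  then have D2: "2 < D" using mB by (smt (verit) divide_nonpos_nonneg real_sqrt_ge_zero)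
  have B: "(cmod m)\<^sup>2 \<le> (D - 2)\<^sup>2 / 3"
    using power_mono[OF mB, of 2] by (simp add: power_divide)
  have nm: "(cmod m)\<^sup>2 = x\<^sup>2 + (of_int b)\<^sup>2 * D\<^sup>2 / 4"
    unfolding cmod_power2 b by (simp add: x_def power_mult_distrib power_divide)
  define e where "e = 2 * c - b"
  have "\<bar>Im (m * Complex (1 / 2) (sqrt 3 / 2) - l)\<bar> \<le> 1" using le abs_Im_le_cmod order_trans by blast
  then have im: "\<bar>x * s / 2 - of_int e * D / 4\<bar> \<le> 1"
  proof -
    have "Im (m * Complex (1 / 2) (sqrt 3 / 2) - l) = x * s / 2 - of_int e * D / 4"
      by (simp add: b c x_def s_def e_def field_simps)
    then show "\<bar>Im (m * Complex (1 / 2) (sqrt 3 / 2) - l)\<bar> \<le> 1 \<Longrightarrow> ?thesis" by simp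
  qed
  have ab: "\<bar>of_int e * D / 4\<bar> \<le> 1 + \<bar>x * s / 2\<bar>" using im by linarith
  then have eD: "\<bar>of_int e\<bar> * D \<le> 4 + 2 * s * \<bar>x\<bar>" using s D_pos by (simp add: abs_mult)
  consider "\<bar>e\<bar> \<ge> 2" | "\<bar>e\<bar> = 1" | "e = 0" by linarith
  then show ?thesis
  proof cases
    case 1
    then have "2 * D \<le> \<bar>of_int e\<bar> * D" using D_pos by (intro mult_right_mono) linarith+
    then have "D - 2 \<le> s * \<bar>x\<bar>" using eD by linarith
    then have "(D - 2)\<^sup>2 \<le> (s * \<bar>x\<bar>)\<^sup>2" using D2 by (intro power_mono) auto
    then have x3: "(D - 2)\<^sup>2 \<le> 3 * x\<^sup>2" using s by (simp add: power_mult_distrib)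
    then have "(of_int b)\<^sup>2 * D\<^sup>2 / 4 \<le> 0" using B nm by simp
    then have b0: "b = 0" using D_pos by (auto simp: mult_le_0_iff)
    then have x3': "3 * x\<^sup>2 = (D - 2)\<^sup>2" using x3 B nm by simp
    have "Im m = 0" using b b0 by simp
    then obtain k where k: "m = of_int k" using O_real assms(2) by blast
    have "4 * D = D\<^sup>2 + 4 - 3 * x\<^sup>2" unfolding x3' by (simp add: power2_eq_square algebra_simps)
    also have "\<dots> = of_int (4 * N - T\<^sup>2 + 4 - 3 * k\<^sup>2)" unfolding D_square by (simp add: x_def k)
    finally have "D \<le> 2" by (rule D_rational)
    then show ?thesis using D2 by simp
  next
    case 2
    then have "b \<noteq> 0" by (auto simp: e_def) presburger
    then have "1 \<le> \<bar>b\<bar>" by linarith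
    then have "1 \<le> b\<^sup>2" by (metis abs_le_square_iff abs_one one_power2)
    then have "1 * D\<^sup>2 \<le> (of_int b)\<^sup>2 * D\<^sup>2"
      by (intro mult_right_mono) (metis of_int_1 of_int_le_iff of_int_power, simp)
    then have m1: "x\<^sup>2 + D\<^sup>2 / 4 \<le> (D - 2)\<^sup>2 / 3" using B nm by simp
    show ?thesis
    proof (cases "4 \<le> D")
      case True
      have "\<bar>real_of_int e\<bar> = 1" using 2 by (metis of_int_1 of_int_abs)
      then have "D - 4 \<le> 2 * s * \<bar>x\<bar>" using eD by simp
      then have "(D - 4)\<^sup>2 \<le> (2 * s * \<bar>x\<bar>)\<^sup>2" using True by (intro power_mono) auto
      then have "(D - 4)\<^sup>2 \<le> 12 * x\<^sup>2" using s by (simp add: power_mult_distrib)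
      then have "12 * D\<^sup>2 / 4 + (D - 4)\<^sup>2 \<le> 4 * (D - 2)\<^sup>2" using m1 by simp
      then have "D \<le> 0" by (simp add: power2_eq_square algebra_simps)
      then show ?thesis using D_pos by simp
    next
      case False
      have "0 \<le> x\<^sup>2" by simp
      then have "3 * D\<^sup>2 \<le> 4 * (D - 2)\<^sup>2" using m1 by linarith
      then have "16 * (D - 1) \<le> D * D" by (simp add: power2_eq_square algebra_simps)
      also have "D * D \<le> 4 * D" using False D_pos by (intro mult_right_mono) auto
      finally show ?thesis using D2 by simp
    qed
  next
    case 3
    show ?thesis
    proof (cases "b = 0")
      case True
      then have "c = 0" using 3 by (simp add: e_def)
      then have "Im m = 0" "Im l = 0" using b c True by simp_all
      then obtain i k where ik: "m = of_int i" "l = of_int k" using O_real assms by metis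
      have "(cmod (m * Complex (1 / 2) (sqrt 3 / 2) - l))\<^sup>2 \<le> 1\<^sup>2" using le by (intro power_mono) auto
      then have "(i / 2 - k)\<^sup>2 + (of_int i * s / 2)\<^sup>2 \<le> 1"
        unfolding cmod_power2 by (simp add: ik s_def)
      moreover have "(of_int i * s / 2)\<^sup>2 = 3 * (of_int i)\<^sup>2 / 4"
        using s by (simp add: power_mult_distrib power_divide)
      ultimately have "(i / 2 - k)\<^sup>2 + 3 * (of_int i)\<^sup>2 / 4 \<le> 1" by linarith
      then have "(2 * of_int k - of_int i)\<^sup>2 + 3 * (of_int i)\<^sup>2 \<le> (4 :: real)"
        by (simp add: power2_eq_square algebra_simps)
      then have "of_int ((2 * k - i)\<^sup>2 + 3 * i\<^sup>2) \<le> (of_int 4 :: real)" by simp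
      then have le4: "(2 * k - i)\<^sup>2 + 3 * i\<^sup>2 \<le> 4" by (simp only: of_int_le_iff)
      have "i \<noteq> 0" using ik assms by auto
      have "i\<^sup>2 \<le> 1" using le4 zero_le_power2[of "2 * k - i"] by linarith
      then have i: "i = 1 \<or> i = -1" using \<open>i \<noteq> 0\<close> by (metis abs_le_square_iff abs_one one_power2 zabs_less_one_iff linorder_not_less abs_if antisym minus_minus)
      then have "(2 * k - i)\<^sup>2 \<le> 1" using le4 by auto
      then have "\<bar>2 * k - i\<bar> \<le> 1" by (metis abs_le_square_iff abs_one one_power2)
      then have "k = 0 \<or> k = i" using i by auto
      then show ?thesis using i ik by auto
    next
      case False
      then have "2 \<le> \<bar>b\<bar>" using 3 by (auto simp: e_def)
      then have "2\<^sup>2 \<le> b\<^sup>2" by (metis abs_le_square_iff abs_numeral)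
      then have "4 * D\<^sup>2 \<le> (of_int b)\<^sup>2 * D\<^sup>2"
        by (intro mult_right_mono) (simp_all, metis of_int_le_iff of_int_numeral of_int_power)
      then have "x\<^sup>2 + D\<^sup>2 \<le> (D - 2)\<^sup>2 / 3" using B nm by simp
      moreover have "0 \<le> x\<^sup>2" by simp
      moreover have "(D - 2)\<^sup>2 \<le> D\<^sup>2" using D2 by (intro power_mono) auto
      ultimately have "D\<^sup>2 \<le> 0" by linarith
      then show ?thesis using D_pos by simp
    qed
  qed
qed

text \<open>The unit circles about 0 and 1 meet in \<open>z0\<close>, and no other closed base disc
  of radius at least 1 / B contains it. A point slightly above \<open>z0\<close> therefore has a
  neighbourhood avoiding all discs of such radii, and an essential hemisphere near it must be
  smaller.\<close>

lemma essential_lower_bound_sqrt: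
  "\<exists>l m. essential l m \<and> (D - 2) / sqrt 3 < cmod m"
proof (rule ccontr)
  define B where "B = (D - 2) / sqrt 3"
  define z0 where "z0 = Complex (1 / 2) (sqrt 3 / 2)"
  assume "\<not> ?thesis"
  then have ess: "essential l m \<Longrightarrow> cmod m \<le> B" for l m by (force simp: B_def)
  define S where "S = {(l, m). l \<in> \<O> \<and> m \<in> \<O> \<and> cmod m \<le> B \<and> cmod l \<le> 3 * B + 1 \<and> 1 < cmod (m * z0 - l)}"
  have "S \<subseteq> {x \<in> \<O>. cmod x \<le> 3 * B + 1} \<times> {x \<in> \<O>. cmod x \<le> B}" by (auto simp: S_def)
  then have "finite S" by (rule finite_subset) (intro finite_cartesian_product finite_O)
  define U where "U = ball z0 1 \<inter> {z. 1 < cmod z} \<inter> {z. 1 < cmod (z - 1)} \<inter>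
    (\<Inter>p\<in>S. {z. 1 < cmod (snd p * z - fst p)})"
  define U' where "U' = ball z0 1 \<inter> (\<Inter>p\<in>S. {z. 1 < cmod (snd p * z - fst p)})"
  have "open U'" unfolding U'_def using \<open>finite S\<close>
    by (intro open_Int open_INT open_ball ballI open_Collect_less continuous_intros) auto
  have "z0 \<in> U'" by (auto simp: U'_def S_def)
  then obtain r where r: "0 < r" "ball z0 r \<subseteq> U'" using \<open>open U'\<close> by (meson openE)
  \<comment> \<open>Moving upwards increases the distance from both 0 and 1, while the radius r
    keeps the point away from the finitely many discs in \<open>S\<close>.\<close>
  define z1 where "z1 = z0 + \<i> * of_real (r / 2)"
  have "z1 \<in> U'" using r by (auto simp: z1_def dist_norm norm_mult)
  moreover have "1 < cmod z1" "1 < cmod (z1 - 1)"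
  proof -
    have "1 < (1 / 2)\<^sup>2 + (sqrt 3 / 2 + r / 2)\<^sup>2"
      using r by (simp add: power2_eq_square algebra_simps add_pos_pos)
    then have "1\<^sup>2 < (cmod z1)\<^sup>2" "1\<^sup>2 < (cmod (z1 - 1))\<^sup>2"
      unfolding cmod_power2 by (simp_all add: z1_def z0_def power2_eq_square)
    then show "1 < cmod z1" "1 < cmod (z1 - 1)"
      using power2_less_imp_less by (metis norm_ge_zero)+
  qed
  ultimately have "z1 \<in> U" by (auto simp: U_def U'_def)
  moreover have "open U" unfolding U_def using \<open>finite S\<close>
    by (intro open_Int open_INT open_ball ballI open_Collect_less continuous_intros) auto
  ultimately obtain \<zeta> l m where \<zeta>: "\<zeta> \<in> U" "essential l m" "cmod (m * \<zeta> - l) < 1"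
    using essential_near by metis
  have lm: "l \<in> \<O>" "m \<in> \<O>" "m \<noteq> 0" using \<zeta> by (auto simp: essential_def)
  have "cmod z0 = 1" by (simp add: z0_def cmod_def power_divide)
  have "cmod \<zeta> \<le> 2" using \<zeta>(1) \<open>cmod z0 = 1\<close> norm_triangle_ineq2[of \<zeta> z0]
    by (auto simp: U_def dist_norm norm_minus_commute)
  have mB: "cmod m \<le> B" using ess \<zeta> by blast
  have "cmod l \<le> cmod m * cmod \<zeta> + 1"
    using norm_triangle_ineq2[of l "m * \<zeta>"] \<zeta>(3) by (simp add: norm_mult norm_minus_commute)
  also have "\<dots> \<le> B * 2 + 1"
    using mB \<open>cmod \<zeta> \<le> 2\<close> by (intro add_right_mono mult_mono) (auto intro: order_trans[OF norm_ge_zero])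
  also have "\<dots> \<le> 3 * B + 1" using mB norm_ge_zero[of m] by linarith
  finally have "cmod l \<le> 3 * B + 1" .
  moreover have "(l, m) \<notin> S" using \<zeta> by (auto simp: U_def)
  ultimately have "cmod (m * z0 - l) \<le> 1" using lm mB by (auto simp: S_def)
  then have "(m = 1 \<or> m = -1) \<and> (l = 0 \<or> l = m)"
    using sixth_root_analysis lm mB by (simp add: z0_def B_def)
  moreover have "1 < cmod \<zeta>" "1 < cmod (\<zeta> - 1)" using \<zeta>(1) by (auto simp: U_def)
  moreover have "cmod (- \<zeta> + 1) = cmod (\<zeta> - 1)" by (simp add: norm_minus_commute)
  ultimately show False using \<zeta>(3) by auto
qed

text \<open>
  For a ramified prime \<open>P = \<int>p + \<int>\<pi>\<close> the pairs in \<open>P\<^sup>2\<close> generating \<open>P\<close> form a copy of the set of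
  cusps. At \<open>\<i>\<close> the shortest of them have exactly one non-real entry, of imaginary part
  \<open>\<plusminus>D / 2\<close>. Perturbing \<open>\<i>\<close> upwards and descending from a shortest pair whose first entry is the
  non-real one leads to an adjacent pair whose second entry is the non-real one, and their determinant is
  large.
\<close>

lemma essential_lower_bound_ramified:
  assumes p: "2 \<le> p" and \<pi>: "\<pi> \<in> \<O>" "Im \<pi> = D / 2" "2 * Re \<pi> = of_int (p * j)"
    "(cmod \<pi>)\<^sup>2 = of_int (p * M)" "\<not> p dvd M" "Factorial_Ring.prime p"
    and small: "(Re \<pi>)\<^sup>2 + (of_int p)\<^sup>2 < D\<^sup>2 / 8"
  shows "\<exists>l m. essential l m \<and> D\<^sup>2 / (8 * of_int p) < cmod m"
proof -
  have p0: "(of_int p :: complex) \<noteq> 0" "0 < real_of_int p" using p by auto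
  \<comment> \<open>The ramified prime ideal above p. The relation \<open>\<pi>sq\<close> makes
    products of two of its elements divisible by p.\<close>
  define PP where "PP = {of_int x * of_int p + of_int y * \<pi> | x y. True}"
  have \<pi>sq: "\<pi> * \<pi> = of_int p * (of_int j * \<pi> - of_int M)"
  proof -
    have "\<pi> * \<pi> = 2 * of_real (Re \<pi>) * \<pi> - of_real ((cmod \<pi>)\<^sup>2)"
      by (intro complex_eqI) (simp_all add: cmod_power2, simp_all add: power2_eq_square algebra_simps)
    also have "2 * of_real (Re \<pi>) = (of_int (p * j) :: complex)"
      using \<pi>(3) by (metis of_real_mult of_real_numeral of_real_of_int_eq)
    finally show ?thesis unfolding \<pi>(4) by (simp add: algebra_simps)
  qed
  obtain s where s: "\<omega> = \<pi> + of_int s"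
  proof -
    have "\<omega> - \<pi> \<in> \<O>" "Im (\<omega> - \<pi>) = 0" using \<pi> by (auto simp: D_def)
    then obtain s where "\<omega> - \<pi> = of_int s" using O_real by blast
    then show ?thesis using that[of s] by (simp add: algebra_simps)
  qed
  have O_\<pi>: "\<exists>a b. x = of_int a + of_int b * \<pi>" if x: "x \<in> \<O>" for x
  proof -
    obtain a b where "x = of_int a + of_int b * \<omega>" using x by (rule O_E)
    then have "x = of_int (a + b * s) + of_int b * \<pi>" unfolding s by (simp add: algebra_simps)
    then show ?thesis by blast
  qed
  have PP_O: "x \<in> \<O>" if "x \<in> PP" for x using that \<pi> by (auto simp: PP_def)
  have PP_I: "of_int x * of_int p + of_int y * \<pi> \<in> PP" for x y by (auto simp: PP_def)
  have PP_add: "x + y \<in> PP" if x: "x \<in> PP" and y: "y \<in> PP" for x y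
  proof -
    obtain a b where "x = of_int a * of_int p + of_int b * \<pi>" using x by (auto simp: PP_def)
    moreover obtain c d where "y = of_int c * of_int p + of_int d * \<pi>" using y by (auto simp: PP_def)
    ultimately have "x + y = of_int (a + c) * of_int p + of_int (b + d) * \<pi>"
      by (simp add: algebra_simps)
    then show ?thesis using PP_I by metis
  qed
  have PP_mult: "r * x \<in> PP" if r: "r \<in> \<O>" and x: "x \<in> PP" for r x
  proof -
    obtain c d where x: "x = of_int c * of_int p + of_int d * \<pi>" using x by (auto simp: PP_def)
    obtain a b where r: "r = of_int a + of_int b * \<pi>" using O_\<pi> r by blast
    have "r * x = of_int a * of_int c * of_int p + of_int a * of_int d * \<pi> + of_int b * of_int c * of_int p * \<pi>
        + of_int b * of_int d * (\<pi> * \<pi>)"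
      unfolding x r by (simp add: algebra_simps)
    also have "\<dots> = of_int (a * c - b * d * M) * of_int p + of_int (a * d + b * c * p + b * d * p * j) * \<pi>"
      unfolding \<pi>sq by (simp add: algebra_simps)
    finally show ?thesis using PP_I by metis
  qed
  have PP_minus: "- x \<in> PP" if "x \<in> PP" for x using PP_mult[of "-1" x] that by simp
  have PP_prod: "x * y / of_int p \<in> \<O>" if x: "x \<in> PP" and y: "y \<in> PP" for x y
  proof -
    obtain a b where x: "x = of_int a * of_int p + of_int b * \<pi>" using x by (auto simp: PP_def)
    obtain c d where y: "y = of_int c * of_int p + of_int d * \<pi>" using y by (auto simp: PP_def)
    have "x * y = of_int a * of_int c * of_int p * of_int p + of_int (a * d + b * c) * of_int p * \<pi>
        + of_int b * of_int d * (\<pi> * \<pi>)"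
      unfolding x y by (simp add: algebra_simps)
    also have "\<dots> = of_int p * (of_int (a * c * p - b * d * M) + of_int (a * d + b * c + b * d * j) * \<pi>)"
      unfolding \<pi>sq by (simp add: algebra_simps)
    finally have "x * y / of_int p = of_int (a * c * p - b * d * M) + of_int (a * d + b * c + b * d * j) * \<pi>"
      using p0 by simp
    then show ?thesis using \<pi> by simp
  qed
  have PP_real: "\<exists>a. x = of_int p * of_int a" if x: "x \<in> PP" "Im x = 0" for x
  proof -
    obtain a b where "x = of_int a * of_int p + of_int b * \<pi>" using x by (auto simp: PP_def)
    then show ?thesis using x(2) \<pi>(2) D_pos by (auto simp: mult.commute)
  qed
  have PP_1: "1 \<notin> PP"
  proof
    assume "1 \<in> PP"
    then obtain a where "1 = (of_int p * of_int a :: complex)" using PP_real[of 1] by auto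
    then have "p * a = 1" by (metis of_int_eq_1_iff of_int_mult)
    then have "p dvd 1" by (metis dvd_triv_left)
    then show False using p zdvd_imp_le[of p 1] by simp
  qed
  have "\<pi> \<in> PP" "of_int p \<in> PP" using PP_I[of 0 1] PP_I[of 1 0] by simp_all
  \<comment> \<open>Such a pair is a row of a matrix over \<open>PP\<close> of determinant p. By
    Cramer's rule and \<open>PP_prod\<close>, every pair in \<open>PP\<close> is a combination of
    the two rows with coefficients in the ring.\<close>
  define TT where "TT = {(y1, y2). y1 \<in> PP \<and> y2 \<in> PP \<and> (\<exists>z1\<in>PP. \<exists>z2\<in>PP. y1 * z2 - y2 * z1 = of_int p)}"
  have TT_nonreal: "Im y1 \<noteq> 0 \<or> Im y2 \<noteq> 0" if y: "(y1, y2) \<in> TT" for y1 y2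
  proof (rule ccontr)
    assume "\<not> ?thesis"
    then have r: "Im y1 = 0" "Im y2 = 0" by auto
    have "y1 \<in> PP" "y2 \<in> PP" using y by (auto simp: TT_def)
    then obtain a b where ab: "y1 = of_int p * of_int a" "y2 = of_int p * of_int b"
      using PP_real[OF _ r(1)] PP_real[OF _ r(2)] by blast
    obtain z1 z2 where z: "z1 \<in> PP" "z2 \<in> PP" "y1 * z2 - y2 * z1 = of_int p" using y by (auto simp: TT_def)
    then have "of_int p * (of_int a * z2 + of_int (- b) * z1) = of_int p * 1"
      unfolding ab by (simp add: algebra_simps)
    then have "of_int a * z2 + of_int (- b) * z1 = 1" using p0 by (metis mult_cancel_left)
    moreover have "of_int a * z2 + of_int (- b) * z1 \<in> PP" using z by (intro PP_add PP_mult) auto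
    ultimately show False using PP_1 by simp
  qed
  have TT_rot: "(- y2, y1) \<in> TT" if y: "(y1, y2) \<in> TT" for y1 y2
  proof -
    obtain z1 z2 where z: "z1 \<in> PP" "z2 \<in> PP" "y1 * z2 - y2 * z1 = of_int p" using y by (auto simp: TT_def)
    then have "- y2 * z1 - y1 * (- z2) = of_int p" by (simp add: algebra_simps)
    then show ?thesis using z y PP_minus unfolding TT_def by blast
  qed
  have coprimepM: "Rings.coprime p M" using \<pi>(5,6) by (simp add: prime_imp_coprime)
  have wTT: "(\<pi>, of_int p) \<in> TT"
  proof -
    obtain r k where rk: "r * p + k * M = 1" using coprimepM by (metis bezout_int coprime_iff_gcd_eq_1)
    have "\<pi> * cnj \<pi> = of_int p * of_int M"
      using complex_norm_square[of \<pi>] \<pi>(4) by (metis of_int_mult of_real_of_int_eq)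
    then have "\<pi> * (of_int k * cnj \<pi>) - of_int p * (- (of_int r * of_int p)) = of_int p * of_int (r * p + k * M)"
      by (simp add: algebra_simps)
    then have det: "\<pi> * (of_int k * cnj \<pi>) - of_int p * (- (of_int r * of_int p)) = of_int p" by (simp add: rk)
    have "cnj \<pi> = of_int j * of_int p + of_int (-1) * \<pi>"
      by (rule complex_eqI) (use \<pi>(3) in \<open>simp_all add: mult.commute\<close>)
    then have "cnj \<pi> \<in> PP" using PP_I by metis
    then have "of_int k * cnj \<pi> \<in> PP" "- (of_int r * of_int p) \<in> PP"
      using \<open>of_int p \<in> PP\<close> by (auto intro!: PP_mult PP_minus)
    then show ?thesis using det \<open>\<pi> \<in> PP\<close> \<open>of_int p \<in> PP\<close> unfolding TT_def by blast
  qed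
  define R0 where "R0 = (Re \<pi>)\<^sup>2 + (of_int p)\<^sup>2"
  \<comment> \<open>The relative slack in \<open>small\<close>. The weight k = 1 + e on the first
    entry breaks the symmetry between the two entries, yet is so close to 1 that \<open>B0\<close>,
    which will bound the squared real parts, stays below D^2 / 8.\<close>
  define e where "e = (D\<^sup>2 / 8 - R0) / D\<^sup>2"
  define k where "k = 1 + e"
  have R0: "0 \<le> R0" by (simp add: R0_def)
  have D2: "0 < D\<^sup>2" using D_pos by simp
  have e: "0 < e" "e \<le> 1 / 8" using small R0 D2 by (simp_all add: e_def R0_def[symmetric] field_simps)
  have k: "1 < k" "k \<le> 9 / 8" using e by (simp_all add: k_def)
  define B0 where "B0 = k * R0 + (k - 1) * (D\<^sup>2 / 4)"
  have R8: "R0 < D\<^sup>2 / 8" using small by (simp add: R0_def)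
  have B0: "B0 < D\<^sup>2 / 8"
  proof -
    have "e * R0 \<le> e * (D\<^sup>2 / 8)" using e R8 by (intro mult_left_mono) auto
    moreover have "e * D\<^sup>2 = D\<^sup>2 / 8 - R0" using D2 by (simp add: e_def)
    moreover have "0 < e * D\<^sup>2" using e D2 by simp
    ultimately show ?thesis by (simp add: B0_def k_def algebra_simps)
  qed
  have kR0: "k * R0 \<le> B0" using k D2 by (simp add: B0_def)
  have kR9: "k * R0 \<le> 9 * D\<^sup>2 / 64"
  proof -
    have "k * R0 \<le> (9 / 8) * (D\<^sup>2 / 8)" using k R8 R0 by (intro mult_mono) auto
    then show ?thesis by simp
  qed
  define q where "q = (\<lambda>(y1, y2). k * (cmod y1)\<^sup>2 + (cmod y2)\<^sup>2)"
  define YY where "YY = {(y1, y2). (y1, y2) \<in> TT \<and> Im y2 = 0 \<and> \<bar>Im y1\<bar> = D / 2}"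
  define w where "w = (\<pi>, of_int p :: complex)"
  have qw: "q w \<le> k * R0 + k * D\<^sup>2 / 4"
  proof -
    have "q w = k * ((Re \<pi>)\<^sup>2 + D\<^sup>2 / 4) + (of_int p)\<^sup>2"
      unfolding q_def w_def by (simp add: cmod_power2 \<pi>(2) power_divide)
    also have "\<dots> \<le> k * ((Re \<pi>)\<^sup>2 + D\<^sup>2 / 4) + k * (of_int p)\<^sup>2"
      using k mult_right_mono[of 1 k "(of_int p)\<^sup>2"] by simp
    finally show ?thesis by (simp add: R0_def algebra_simps)
  qed
  have wYY: "w \<in> YY" using wTT \<pi>(2) D_pos by (simp add: YY_def w_def)
  define YQ where "YQ = {y \<in> YY. q y \<le> q w}"
  have "YQ \<subseteq> {x \<in> \<O>. cmod x \<le> sqrt (q w)} \<times> {x \<in> \<O>. cmod x \<le> sqrt (q w)}"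
  proof
    fix y assume y: "y \<in> YQ"
    obtain y1 y2 where yy: "y = (y1, y2)" by (cases y)
    have "k * (cmod y1)\<^sup>2 + (cmod y2)\<^sup>2 \<le> q w" using y by (simp add: yy YQ_def q_def)
    moreover have "(cmod y1)\<^sup>2 \<le> k * (cmod y1)\<^sup>2" using k mult_right_mono[of 1 k "(cmod y1)\<^sup>2"] by simp
    ultimately have "(cmod y1)\<^sup>2 \<le> q w" "(cmod y2)\<^sup>2 \<le> q w"
      using zero_le_power2[of "cmod y1"] zero_le_power2[of "cmod y2"] by linarith+
    then show "y \<in> {x \<in> \<O>. cmod x \<le> sqrt (q w)} \<times> {x \<in> \<O>. cmod x \<le> sqrt (q w)}"
      using y PP_O by (auto simp: yy YQ_def YY_def TT_def real_le_rsqrt)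
  qed
  then have "finite YQ" by (rule finite_subset) (intro finite_cartesian_product finite_O)
  moreover have "YQ \<noteq> {}" using wYY unfolding YQ_def by blast
  ultimately obtain y where y: "y \<in> YQ" "\<And>y'. y' \<in> YQ \<Longrightarrow> q y \<le> q y'" using ex_min_image[of YQ q] by blast
  obtain y1 y2 where yy: "y = (y1, y2)" by (cases y)
  define G where "G = q y"
  have Geq: "G = k * (cmod y1)\<^sup>2 + (cmod y2)\<^sup>2" by (simp add: G_def q_def yy)
  have yT: "(y1, y2) \<in> TT" and y2r: "Im y2 = 0" and y1i: "\<bar>Im y1\<bar> = D / 2" and Gw: "G \<le> q w"
    using y(1) by (auto simp: YQ_def YY_def yy G_def)
  have y1i2: "(Im y1)\<^sup>2 = D\<^sup>2 / 4" using y1i by (metis power2_abs power_divide four_x_squared power2_eq_square mult_2 numeral_Bit0)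
  have Gexp: "G = k * (Re y1)\<^sup>2 + k * D\<^sup>2 / 4 + (Re y2)\<^sup>2"
    unfolding Geq cmod_power2 y1i2 y2r by (simp add: algebra_simps)
  have u: "k * (Re y1)\<^sup>2 + (Re y2)\<^sup>2 \<le> k * R0" using Gexp Gw qw by linarith
  have u1: "(Re y1)\<^sup>2 \<le> k * (Re y1)\<^sup>2" using k mult_right_mono[of 1 k "(Re y1)\<^sup>2"] by simp
  have G0: "0 < G"
  proof -
    have "0 < k * D\<^sup>2" using k D2 by simp
    moreover have "0 \<le> k * (Re y1)\<^sup>2" "0 \<le> (Re y2)\<^sup>2" using k by simp_all
    ultimately show ?thesis unfolding Gexp by linarith
  qed
  obtain z1 z2 where z: "z1 \<in> PP" "z2 \<in> PP" "y1 * z2 - y2 * z1 = of_int p" using yT by (auto simp: TT_def)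
  have y12: "y1 \<in> PP" "y2 \<in> PP" using yT by (auto simp: TT_def)
  \<comment> \<open>The inner product of z with y. In the basis y, z the form q is G times the
    denominator of the height at (\<zeta>, sqrt \<tau>), by Lagrange's identity. Hence a hemisphere
    passes above this point exactly when its pair l y + m z is shorter than y.\<close>
  define h where "h = of_real k * z1 * cnj y1 + z2 * cnj y2"
  define \<zeta> where "\<zeta> = - (h / of_real G)"
  define \<tau> where "\<tau> = k * (of_int p)\<^sup>2 / G\<^sup>2"
  have \<tau>: "0 < \<tau>" using k p0 G0 by (simp add: \<tau>_def)
  have qform: "q (l * y1 + m * z1, l * y2 + m * z2) = G * ((cmod (m * \<zeta> - l))\<^sup>2 + (cmod m)\<^sup>2 * \<tau>)" for l m
  proof -
    define c1 c2 where "c1 = l * y1 + m * z1" and "c2 = l * y2 + m * z2"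
    define r where "r = complex_of_real (sqrt k)"
    have rr: "r * r = of_real k" "cnj r = r" "(cmod r)\<^sup>2 = k"
      using k by (simp_all add: r_def flip: of_real_mult)
    have "G * q (c1, c2) = ((cmod (r * y1))\<^sup>2 + (cmod y2)\<^sup>2) * ((cmod (r * c1))\<^sup>2 + (cmod c2)\<^sup>2)"
      unfolding Geq q_def by (simp add: norm_mult power_mult_distrib rr)
    also have "\<dots> = (cmod (r * y1 * c2 - y2 * (r * c1)))\<^sup>2 + (cmod (r * c1 * cnj (r * y1) + c2 * cnj y2))\<^sup>2"
      by (rule complex_lagrange)
    also have "r * y1 * c2 - y2 * (r * c1) = r * m * (y1 * z2 - y2 * z1)"
      by (simp add: c1_def c2_def algebra_simps)
    also have "(cmod (r * m * (y1 * z2 - y2 * z1)))\<^sup>2 = k * (of_int p)\<^sup>2 * (cmod m)\<^sup>2"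
      unfolding z(3) by (simp add: norm_mult power_mult_distrib rr)
    also have "r * c1 * cnj (r * y1) + c2 * cnj y2 = (r * r) * c1 * cnj y1 + c2 * cnj y2"
      by (simp add: rr(2) algebra_simps)
    also have "\<dots> = l * (of_real k * (y1 * cnj y1) + y2 * cnj y2) + m * h"
      by (simp add: rr(1) c1_def c2_def h_def algebra_simps)
    also have "of_real k * (y1 * cnj y1) + y2 * cnj y2 = of_real G"
      unfolding Geq of_real_add of_real_mult complex_norm_square by (rule refl)
    also have "l * of_real G + m * h = - (of_real G * (m * \<zeta> - l))"
      using G0 by (simp add: \<zeta>_def algebra_simps)
    also have "(cmod (- (of_real G * (m * \<zeta> - l))))\<^sup>2 = G\<^sup>2 * (cmod (m * \<zeta> - l))\<^sup>2"
      by (simp add: norm_mult power_mult_distrib)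
    also have "k * (of_int p)\<^sup>2 * (cmod m)\<^sup>2 + G\<^sup>2 * (cmod (m * \<zeta> - l))\<^sup>2 =
        G * (G * ((cmod (m * \<zeta> - l))\<^sup>2 + (cmod m)\<^sup>2 * \<tau>))"
      using G0 by (simp add: \<tau>_def power2_eq_square field_simps)
    finally show ?thesis using G0 by (simp add: c1_def c2_def)
  qed
  \<comment> \<open>The coordinates of the rotated pair (-y2, y1) in the basis y, z, by Cramer's
    rule.\<close>
  define a0 b0 where "a0 = (- y2 * z2 - y1 * z1) / of_int p" and "b0 = (y1 * y1 + y2 * y2) / of_int p"
  have ab0: "a0 \<in> \<O>" "b0 \<in> \<O>"
  proof -
    have "a0 = - (y2 * z2 / of_int p) - y1 * z1 / of_int p" "b0 = y1 * y1 / of_int p + y2 * y2 / of_int p"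
      by (simp_all add: a0_def b0_def diff_divide_distrib add_divide_distrib)
    then show "a0 \<in> \<O>" "b0 \<in> \<O>" using PP_prod y12 z by (auto simp del: times_divide_eq_left)
  qed
  have rep: "a0 * y1 + b0 * z1 = - y2" "a0 * y2 + b0 * z2 = y1"
  proof -
    have "a0 * y1 + b0 * z1 = - y2 * (y1 * z2 - y2 * z1) / of_int p"
      by (simp add: a0_def b0_def algebra_simps add_divide_distrib diff_divide_distrib)
    then show "a0 * y1 + b0 * z1 = - y2" using p0 by (simp add: z(3))
    have "a0 * y2 + b0 * z2 = y1 * (y1 * z2 - y2 * z1) / of_int p"
      by (simp add: a0_def b0_def algebra_simps add_divide_distrib diff_divide_distrib)
    then show "a0 * y2 + b0 * z2 = y1" using p0 by (simp add: z(3))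
  qed
  have cop0: "cop a0 b0"
  proof (rule copI)
    show "(y1 * z1 + y2 * z2) / of_int p \<in> \<O>" "(z2 * z2 + z1 * z1) / of_int p \<in> \<O>"
      using PP_prod y12 z by (auto simp: add_divide_distrib simp del: times_divide_eq_left)
    have "((y1 * z1 + y2 * z2) * (- y2 * z2 - y1 * z1) + (z2 * z2 + z1 * z1) * (y1 * y1 + y2 * y2)) =
        (y1 * z2 - y2 * z1) * (y1 * z2 - y2 * z1)" by (simp add: algebra_simps)
    then have eq: "((y1 * z1 + y2 * z2) * (- y2 * z2 - y1 * z1) + (z2 * z2 + z1 * z1) * (y1 * y1 + y2 * y2)) =
        of_int p * of_int p" by (simp only: z(3))
    have "(y1 * z1 + y2 * z2) / of_int p * a0 + (z2 * z2 + z1 * z1) / of_int p * b0 =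
      ((y1 * z1 + y2 * z2) * (- y2 * z2 - y1 * z1) + (z2 * z2 + z1 * z1) * (y1 * y1 + y2 * y2)) / (of_int p * of_int p)"
    proof -
      have "x / P * (y / P) + u / P * (v / P) = (x * y + u * v) / (P * P)" for x y u v P :: complex
        by (simp add: add_divide_distrib)
      then show ?thesis unfolding a0_def b0_def .
    qed
    then show "(y1 * z1 + y2 * z2) / of_int p * a0 + (z2 * z2 + z1 * z1) / of_int p * b0 = 1"
      unfolding eq using p0 by simp
  qed
  \<comment> \<open>The rotation moves the larger weight k from the nonreal entry to the real one,
    which is shorter because its square is below D^2 / 4.\<close>
  have "q (- y2, y1) < G"
  proof -
    have "(Re y2)\<^sup>2 < D\<^sup>2 / 4"
    proof -
      have "0 \<le> k * (Re y1)\<^sup>2" using k by simp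
      then have "(Re y2)\<^sup>2 \<le> 9 * D\<^sup>2 / 64" using u kR9 by linarith
      then show ?thesis using D2 by linarith
    qed
    then have "(k - 1) * (Re y2)\<^sup>2 < (k - 1) * ((Re y1)\<^sup>2 + D\<^sup>2 / 4)"
      using k zero_le_power2[of "Re y1"] by (intro mult_strict_left_mono) linarith+
    moreover have "q (- y2, y1) = k * (Re y2)\<^sup>2 + (Re y1)\<^sup>2 + D\<^sup>2 / 4"
      unfolding q_def by (simp add: cmod_power2 y1i2 y2r)
    ultimately show ?thesis unfolding Gexp by (simp add: algebra_simps diff_divide_distrib)
  qed
  then have "G * ((cmod (b0 * \<zeta> - a0))\<^sup>2 + (cmod b0)\<^sup>2 * \<tau>) < G * 1"
    using qform[of a0 b0] by (simp add: rep)
  then have lt1: "(cmod (b0 * \<zeta> - a0))\<^sup>2 + (cmod b0)\<^sup>2 * \<tau> < 1" using G0 by (simp only: mult_less_cancel_left_pos)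
  have "b0 \<noteq> 0"
  proof
    assume b0: "b0 = 0"
    then have "(cmod a0)\<^sup>2 < 1\<^sup>2" using lt1 by simp
    then have "cmod a0 < 1" by (rule power2_less_imp_less) simp
    then have "a0 = 0" using O_norm_less_1 ab0 by blast
    then show False using cop0 b0 by (simp add: cop_def)
  qed
  then have "\<tau> < dome a0 b0 \<zeta>" using dome_iff(1) lt1 by blast
  then obtain l m where lm: "essential l m" "\<tau> < dome l m \<zeta>"
    using exists_essential[OF ab0 \<open>b0 \<noteq> 0\<close> cop0 \<tau>] by blast
  then have lmO: "l \<in> \<O>" "m \<in> \<O>" "m \<noteq> 0" "cop l m" by (auto simp: essential_def)
  define c1 c2 where "c1 = l * y1 + m * z1" and "c2 = l * y2 + m * z2"
  have "(cmod (m * \<zeta> - l))\<^sup>2 + (cmod m)\<^sup>2 * \<tau> < 1" using dome_iff(1) lm lmO by blast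
  then have qc: "q (c1, c2) < G"
    using qform[of l m] G0 by (simp add: c1_def c2_def)
  have cPP: "c1 \<in> PP" "c2 \<in> PP" unfolding c1_def c2_def using lmO y12 z by (auto intro!: PP_add PP_mult)
  have cTT: "(c1, c2) \<in> TT"
  proof -
    obtain r s where rs: "r \<in> \<O>" "s \<in> \<O>" "r * l + s * m = 1" using lmO by (auto simp: cop_def)
    have "c1 * (r * z2 + (- s) * y2) - c2 * (r * z1 + (- s) * y1) = (r * l + s * m) * (y1 * z2 - y2 * z1)"
      by (simp add: c1_def c2_def algebra_simps)
    then have "c1 * (r * z2 + (- s) * y2) - c2 * (r * z1 + (- s) * y1) = of_int p" by (simp add: rs z)
    moreover have "r * z2 + (- s) * y2 \<in> PP" "r * z1 + (- s) * y1 \<in> PP"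
      using PP_add[OF PP_mult[OF rs(1) z(2)] PP_mult[OF O_uminus[OF rs(2)] y12(2)]]
        PP_add[OF PP_mult[OF rs(1) z(1)] PP_mult[OF O_uminus[OF rs(2)] y12(1)]] .
    ultimately show ?thesis unfolding TT_def using cPP by blast
  qed
  obtain b1 :: int where b1: "Im c1 = of_int b1 * (D / 2)" using Im_O PP_O cPP(1) by blast
  obtain b2 :: int where b2: "Im c2 = of_int b2 * (D / 2)" using Im_O PP_O cPP(2) by blast
  have qcexp: "q (c1, c2) = k * (Re c1)\<^sup>2 + (Re c2)\<^sup>2 + (k * (of_int b1)\<^sup>2 + (of_int b2)\<^sup>2) * D\<^sup>2 / 4"
    unfolding q_def by (simp add: cmod_power2 b1 b2 power_mult_distrib power_divide algebra_simps)
  have nn: "0 \<le> k * (Re c1)\<^sup>2" "0 \<le> (Re c2)\<^sup>2" using k by simp_all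
  have "(k * (of_int b1)\<^sup>2 + (of_int b2)\<^sup>2) * D\<^sup>2 / 4 < 9 * D\<^sup>2 / 64 + k * D\<^sup>2 / 4"
    using qc qcexp nn Gw qw kR9 by linarith
  then have "(k * (of_int b1)\<^sup>2 + (of_int b2)\<^sup>2) * D\<^sup>2 < (k + 9 / 16) * D\<^sup>2" by (simp add: algebra_simps)
  then have bb: "k * (of_int b1)\<^sup>2 + (of_int b2)\<^sup>2 < k + 9 / 16" using D2 by simp
  \<comment> \<open>If the first entry were nonreal, \<open>bb\<close> would leave b1 = 1 or -1 and
    b2 = 0, so that the new pair is an element of \<open>YQ\<close> shorter than the shortest
    one.\<close>
  have b1z: "b1 = 0"
  proof (rule ccontr)
    assume "b1 \<noteq> 0"
    then have b1ge: "1 \<le> b1\<^sup>2" by (metis int_one_le_iff_zero_less zero_less_power2)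
    then have "(1::real) \<le> (of_int b1)\<^sup>2" by (metis of_int_1 of_int_le_iff of_int_power)
    then have "k * 1 \<le> k * (of_int b1)\<^sup>2" using k by (intro mult_left_mono) auto
    then have "(of_int b2)\<^sup>2 < (9 / 16 :: real)" using bb by linarith
    then have "of_int (b2\<^sup>2) < (of_int 1 :: real)" by simp
    then have "b2\<^sup>2 < 1" by (simp only: of_int_less_iff)
    then have b2z: "b2 = 0" by (simp add: power2_eq_square) (smt (verit) mult_le_0_iff zero_less_mult_iff zmult_eq_1_iff pos_zmult_eq_1_iff mult_pos_pos mult_neg_neg)
    have "k * (of_int b1)\<^sup>2 < k + 9 / 16" using bb b2z by simp
    also have "\<dots> < k * 2" using k by linarith
    finally have "k * (of_int b1)\<^sup>2 < k * 2" .
    then have "(of_int b1)\<^sup>2 < (2::real)" by (rule mult_left_less_imp_less) (use k in simp)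
    then have "of_int (b1\<^sup>2) < (of_int 2 :: real)" by simp
    then have "b1\<^sup>2 < 2" by (simp only: of_int_less_iff)
    then have "b1\<^sup>2 = 1" using b1ge by linarith
    then have "\<bar>b1\<bar> = 1" by (metis abs_1 power2_eq_1_iff abs_minus_cancel)
    then have "\<bar>of_int b1 :: real\<bar> = 1" by (metis of_int_1 of_int_abs)
    then have "\<bar>Im c1\<bar> = D / 2" unfolding b1 abs_mult using D_pos by simp
    moreover have "Im c2 = 0" using b2 b2z by simp
    ultimately have "(c1, c2) \<in> YQ" using cTT qc Gw by (simp add: YQ_def YY_def)
    then show False using y(2)[of "(c1, c2)"] qc by (simp add: G_def)
  qed
  have b2one: "(of_int b2)\<^sup>2 = (1 :: real)"
  proof -
    have "of_int (b2\<^sup>2) < (of_int 2 :: real)" using bb k b1z by simp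
    then have "b2\<^sup>2 < 2" by (simp only: of_int_less_iff)
    moreover have "b2 \<noteq> 0" using TT_nonreal[OF cTT] b1 b2 b1z by auto
    then have "1 \<le> b2\<^sup>2" by (metis int_one_le_iff_zero_less zero_less_power2)
    ultimately have "b2\<^sup>2 = 1" by linarith
    then show ?thesis by (metis of_int_1 of_int_power)
  qed
  have "k * (Re c1)\<^sup>2 + (Re c2)\<^sup>2 < k * R0 + k * D\<^sup>2 / 4 - D\<^sup>2 / 4"
    using qc qcexp b1z b2one Gw qw by simp
  moreover have "(Re c1)\<^sup>2 \<le> k * (Re c1)\<^sup>2" using k mult_right_mono[of 1 k "(Re c1)\<^sup>2"] by simp
  ultimately have a: "(Re c1)\<^sup>2 + (Re c2)\<^sup>2 < B0"
    by (simp add: B0_def algebra_simps diff_divide_distrib)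
  have uu: "(Re y1)\<^sup>2 + (Re y2)\<^sup>2 \<le> B0" using u u1 kR0 by linarith
  have c1r: "Im c1 = 0" using b1 b1z by simp
  have det: "y1 * c2 - y2 * c1 = m * of_int p"
  proof -
    have "y1 * c2 - y2 * c1 = m * (y1 * z2 - y2 * z1)" by (simp add: c1_def c2_def algebra_simps)
    then show ?thesis by (simp add: z)
  qed
  have t3: "\<bar>Im y1 * Im c2\<bar> = D\<^sup>2 / 4"
  proof -
    have "\<bar>of_int b2 :: real\<bar> = 1" using b2one by (metis abs_1 power2_eq_1_iff abs_minus_cancel)
    then have "\<bar>Im c2\<bar> = D / 2" unfolding b2 abs_mult using D_pos by simp
    then show ?thesis unfolding abs_mult y1i by (simp add: power2_eq_square)
  qed
  \<comment> \<open>The two nonreal entries contribute D^2 / 4 in absolute value to the determinant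
    m p. The products of real parts sum to less than \<open>B0\<close>, by the inequality of
    arithmetic and geometric means.\<close>
  have re: "Re (m * of_int p) = Re y1 * Re c2 - Re y2 * Re c1 - Im y1 * Im c2"
    unfolding det[symmetric] by (simp add: y2r c1r)
  have t12: "\<bar>Re y1 * Re c2\<bar> \<le> ((Re y1)\<^sup>2 + (Re c2)\<^sup>2) / 2" "\<bar>Re y2 * Re c1\<bar> \<le> ((Re y2)\<^sup>2 + (Re c1)\<^sup>2) / 2"
  proof -
    have am: "\<bar>x * y\<bar> \<le> (x\<^sup>2 + y\<^sup>2) / 2" for x y :: real
      using zero_le_power2[of "\<bar>x\<bar> - \<bar>y\<bar>"] by (simp add: power2_diff abs_mult)
    show "\<bar>Re y1 * Re c2\<bar> \<le> ((Re y1)\<^sup>2 + (Re c2)\<^sup>2) / 2" by (rule am)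
    show "\<bar>Re y2 * Re c1\<bar> \<le> ((Re y2)\<^sup>2 + (Re c1)\<^sup>2) / 2" by (rule am)
  qed
  define t1 t2 where "t1 = Re y1 * Re c2" and "t2 = Re y2 * Re c1"
  have "\<bar>t1\<bar> + \<bar>t2\<bar> \<le> (((Re y1)\<^sup>2 + (Re y2)\<^sup>2) + ((Re c1)\<^sup>2 + (Re c2)\<^sup>2)) / 2"
    using t12 unfolding t1_def t2_def by argo
  also have "\<dots> < B0" using a uu by argo
  finally have "\<bar>t1\<bar> + \<bar>t2\<bar> < D\<^sup>2 / 8" using B0 by simp
  moreover have "\<bar>Im y1 * Im c2\<bar> \<le> \<bar>Re (m * of_int p)\<bar> + \<bar>t1\<bar> + \<bar>t2\<bar>"
    unfolding re t1_def[symmetric] t2_def[symmetric] by linarith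
  ultimately have "D\<^sup>2 / 8 < \<bar>Re (m * of_int p)\<bar>" unfolding t3 by linarith
  also have "\<dots> \<le> cmod (m * of_int p)" by (rule abs_Re_le_cmod)
  also have "\<dots> = cmod m * of_int p" using p by (simp add: norm_mult)
  finally have "D\<^sup>2 / (8 * of_int p) < cmod m" using p0 by (simp add: field_simps)
  then show ?thesis using lm by blast
qed

section \<open>Ramified primes and proper divisors of the discriminant\<close>

lemma omega_shift_square:
  assumes "T = 2 * T'"
  shows "(\<omega> - of_int T')\<^sup>2 = - of_int (N - T'\<^sup>2)"
proof -
  have "(\<omega> - of_int T')\<^sup>2 = \<omega>\<^sup>2 - of_int T * \<omega> + of_int (T'\<^sup>2)"
    unfolding assms by (simp add: power2_eq_square algebra_simps)
  then show ?thesis unfolding omega_square by simp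
qed

text \<open>Otherwise (2 \<omega> - T) / p would have an integral square, and \<open>maximal\<close>
  would give p dvd 2.\<close>

lemma square_not_dvd_discriminant:
  assumes "Factorial_Ring.prime p" "p \<noteq> 2" shows "\<not> p\<^sup>2 dvd 4 * N - T\<^sup>2"
proof
  assume "p\<^sup>2 dvd 4 * N - T\<^sup>2"
  then obtain k where k: "4 * N - T\<^sup>2 = p\<^sup>2 * k" by (rule dvdE)
  have p0: "p \<noteq> 0" using assms by auto
  have "(of_int (- T) + of_int 2 * \<omega>)\<^sup>2 = 4 * (\<omega>\<^sup>2 - of_int T * \<omega>) + of_int (T\<^sup>2)"
    by (simp add: power2_eq_square algebra_simps)
  also have "\<dots> = - of_int (4 * N - T\<^sup>2)" unfolding omega_square by simp
  finally have "((of_int (- T) + of_int 2 * \<omega>) / of_int p)\<^sup>2 = - of_int k"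
    unfolding k using p0 by (simp add: power_divide)
  then have "((of_int (- T) + of_int 2 * \<omega>) / of_int p)\<^sup>2 =
      of_int 0 * ((of_int (- T) + of_int 2 * \<omega>) / of_int p) - of_int k" by simp
  from maximal[OF p0 this] have "p dvd 2" by simp
  then show False using assms
    by (metis prime_int_not_dvd two_is_prime_nat dvd_imp_le primes_dvd_imp_eq two_is_prime_nat prime_int_numeral_eq)
qed

text \<open>For odd p a shift of \<omega> has trace 0 or p. As 4 times its norm is the squared trace
  plus 4 N - T^2, the norm is divisible by p exactly once. For p = 2, \<omega> is an integer plus
  sqrt (-q), where \<open>maximal\<close> leaves q = 1 or 2 modulo 4, and 1 + sqrt (-q) or sqrt (-q)
  serves. The choice of j keeps the real part at most p / 2. The residue modulo 16 is recorded for a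
  borderline case of \<open>essential_lower_bound_prime\<close>.\<close>

lemma ramified_generator:
  assumes p: "Factorial_Ring.prime p" "p dvd 4 * N - T\<^sup>2"
  obtains \<pi> j M where "\<pi> \<in> \<O>" "Im \<pi> = D / 2" "2 * Re \<pi> = of_int (p * j)" "(cmod \<pi>)\<^sup>2 = of_int (p * M)"
    "\<not> p dvd M" "j = 0 \<or> j = 1" "p = 2 \<Longrightarrow> j = 1 \<Longrightarrow> (4 * N - T\<^sup>2) mod 16 = 4"
proof -
  have shift: "\<omega> + of_int s \<in> \<O>" "Im (\<omega> + of_int s) = D / 2" "2 * Re (\<omega> + of_int s) = of_int (T + 2 * s)"
    "(cmod (\<omega> + of_int s))\<^sup>2 = of_int (N + s * T + s\<^sup>2)" for s
  proof -
    show "\<omega> + of_int s \<in> \<O>" by simp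
    show "Im (\<omega> + of_int s) = D / 2" by (simp add: D_def)
    show "2 * Re (\<omega> + of_int s) = of_int (T + 2 * s)" using Re_omega by simp
    have "(cmod (\<omega> + of_int s))\<^sup>2 = (cmod \<omega>)\<^sup>2 + of_int s * (2 * Re \<omega>) + (of_int s)\<^sup>2"
      unfolding cmod_power2 by (simp add: power2_eq_square algebra_simps)
    then show "(cmod (\<omega> + of_int s))\<^sup>2 = of_int (N + s * T + s\<^sup>2)" by (simp add: Re_omega norm_omega)
  qed
  have n4: "4 * (N + s * T + s\<^sup>2) = (T + 2 * s)\<^sup>2 + (4 * N - T\<^sup>2)" for s
    by (simp add: power2_eq_square algebra_simps)
  show ?thesis
  proof (cases "p = 2")
    case False
    then have p2: "\<not> p dvd 2" using p(1)
      by (metis prime_int_numeral_eq primes_dvd_imp_eq two_is_prime_nat)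
    then have odd: "odd p" using p(1) False by (metis primes_dvd_imp_eq prime_int_numeral_eq two_is_prime_nat)
    obtain s j where sj: "T + 2 * s = p * j" "j = 0 \<or> j = 1"
    proof (cases "even T")
      case True
      then obtain t where "T = 2 * t" by blast
      then have "T + 2 * (- t) = p * 0" by simp
      then show ?thesis using that by blast
    next
      case False
      then have "even (p - T)" using odd by simp
      then obtain t where "p - T = 2 * t" by blast
      then have "T + 2 * t = p * 1" by simp
      then show ?thesis using that by blast
    qed
    define n where "n = N + s * T + s\<^sup>2"
    have n: "4 * n = (p * j)\<^sup>2 + (4 * N - T\<^sup>2)" unfolding n_def n4 sj(1) ..
    have "p dvd 2 * 2 * n" using p(2) n by (simp add: power2_eq_square)
    then have "p dvd n" using p2 p(1) by (metis prime_dvd_mult_iff)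
    then obtain M where M: "n = p * M" by blast
    have "\<not> p dvd M"
    proof
      assume "p dvd M"
      then have "p\<^sup>2 dvd 4 * n" unfolding M by (auto simp: power2_eq_square)
      moreover have "p\<^sup>2 dvd (p * j)\<^sup>2" by (simp add: power_mult_distrib)
      ultimately have "p\<^sup>2 dvd 4 * N - T\<^sup>2" using n by (metis dvd_add_right_iff)
      then show False using square_not_dvd_discriminant p(1) False by blast
    qed
    then show ?thesis
      using that[of "\<omega> + of_int s" j M] shift(1,2)[of s] shift(3)[of s, unfolded sj(1)]
        shift(4)[of s, folded n_def, unfolded M] sj(2) False by blast
  next
    case True
    then have "even (T\<^sup>2)" using p(2) by (simp add: even_diff)
    then have "even T" by simp
    then obtain T' where T': "T = 2 * T'" by blast
    define q where "q = N - T'\<^sup>2"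
    have Q: "4 * N - T\<^sup>2 = 4 * q" by (simp add: q_def T' power2_eq_square)
    note sq = omega_shift_square[OF T', folded q_def]
    have "q mod 4 \<noteq> 0"
    proof
      assume "q mod 4 = 0"
      then obtain k where k: "q = 4 * k" by (metis mod_0_imp_dvd dvdE)
      have "((of_int (- T') + of_int 1 * \<omega>) / of_int 2)\<^sup>2 = (\<omega> - of_int T')\<^sup>2 / 4"
        by (simp add: power_divide)
      also have "\<dots> = of_int 0 * ((of_int (- T') + of_int 1 * \<omega>) / of_int 2) - of_int k"
        unfolding sq k by simp
      finally have "(2::int) dvd 1" using maximal[of 2] by (metis zero_neq_numeral)
      then show False by simp
    qed
    moreover have "q mod 4 \<noteq> 3"
    proof
      assume "q mod 4 = 3"
      then have "(1 + q) mod 4 = 0" by presburger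
      then obtain k where k: "1 + q = 4 * k" by (metis mod_0_imp_dvd dvdE)
      have "((of_int (1 - T') + of_int 1 * \<omega>) / of_int 2)\<^sup>2 = (1 + 2 * (\<omega> - of_int T') + (\<omega> - of_int T')\<^sup>2) / 4"
        by (simp add: power_divide) (simp add: power2_eq_square algebra_simps)
      also have "\<dots> = (1 + 2 * (\<omega> - of_int T') + (1 - of_int (1 + q))) / 4"
        unfolding sq by simp
      also have "\<dots> = of_int 1 * ((of_int (1 - T') + of_int 1 * \<omega>) / of_int 2) - of_int k"
        unfolding k by simp
      finally have "(2::int) dvd 1" using maximal[of 2] by (metis zero_neq_numeral)
      then show False by simp
    qed
    ultimately have "q mod 4 = 1 \<or> q mod 4 = 2" by presburger
    then consider "q mod 4 = 1" | "q mod 4 = 2" by blast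
    then show ?thesis
    proof cases
      case 1
      then obtain k where k: "q = 4 * k + 1" by (metis mult_div_mod_eq)
      have "N + (1 - T') * T + (1 - T')\<^sup>2 = 2 * (2 * k + 1)"
        using k unfolding q_def T' by (simp add: power2_eq_square algebra_simps)
      moreover have "(4 * N - T\<^sup>2) mod 16 = 4" unfolding Q k by presburger
      ultimately show ?thesis
        using that[of "\<omega> + of_int (1 - T')" 1 "2 * k + 1"] shift[of "1 - T'"] True
        by (simp only: T') simp
    next
      case 2
      then obtain k where k: "q = 4 * k + 2" by (metis mult_div_mod_eq)
      have "N + (- T') * T + (- T')\<^sup>2 = 2 * (2 * k + 1)"
        using k unfolding q_def T' by (simp add: power2_eq_square algebra_simps)
      then show ?thesis
        using that[of "\<omega> + of_int (- T')" 0 "2 * k + 1"] shift[of "- T'"] True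
        by (simp only: T') simp
    qed
  qed
qed

text \<open>If the smallness condition of the previous construction fails, D is at most a constant
  multiple of p, and D^2 / (8 p) is already below 1 or below (D - 2) / sqrt 3.\<close>

lemma essential_lower_bound_prime:
  assumes p: "Factorial_Ring.prime p" "p dvd 4 * N - T\<^sup>2"
  shows "\<exists>l m. essential l m \<and> D\<^sup>2 / (8 * of_int p) < cmod m"
proof -
  obtain \<pi> j M where \<pi>: "\<pi> \<in> \<O>" "Im \<pi> = D / 2" "2 * Re \<pi> = of_int (p * j)" "(cmod \<pi>)\<^sup>2 = of_int (p * M)"
    "\<not> p dvd M" and j: "j = 0 \<or> j = 1" and j2: "p = 2 \<Longrightarrow> j = 1 \<Longrightarrow> (4 * N - T\<^sup>2) mod 16 = 4"
    using ramified_generator[OF p] by metis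
  have p2: "2 \<le> p" using p(1) by (rule prime_ge_2_int)
  show ?thesis
  proof (cases "(Re \<pi>)\<^sup>2 + (of_int p)\<^sup>2 < D\<^sup>2 / 8")
    case True
    then show ?thesis using essential_lower_bound_ramified[OF p2 \<pi> p(1)] by blast
  next
    case False
    have Re: "(Re \<pi>)\<^sup>2 = (of_int p)\<^sup>2 * (of_int j)\<^sup>2 / 4"
    proof -
      have "Re \<pi> = of_int p * of_int j / 2" using \<pi>(3) by simp
      show ?thesis unfolding \<open>Re \<pi> = _\<close> by (simp add: power_mult_distrib power_divide)
    qed
    obtain l m where lm: "essential l m" "(D - 2) / sqrt 3 < cmod m" using essential_lower_bound_sqrt by blast
    have m1: "1 \<le> cmod m" by (rule essential_norm_ge_1[OF lm(1)])
    have s3: "sqrt 3 \<le> 1.7322" by (rule real_le_lsqrt) (simp_all add: power2_eq_square)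
    have D57: "(D - 2) / 1.7322 < cmod m" if "2 \<le> D"
    proof -
      have "(D - 2) / 1.7322 \<le> (D - 2) / sqrt 3" using s3 that by (intro divide_left_mono) auto
      also have "\<dots> < cmod m" by (rule lm(2))
      finally show ?thesis .
    qed
    have "D\<^sup>2 / (8 * of_int p) < cmod m"
    proof (cases "p = 2")
      case True
      have "D\<^sup>2 \<le> 36"
      proof (cases "j = 1")
        case True
        \<comment> \<open>The value 40 would be too large: 40 / 16 = 2.5 slightly exceeds (sqrt 40 -
          2) / sqrt 3. The residue 4 modulo 16 lowers the bound to 36.\<close>
        then have "D\<^sup>2 \<le> 40" using False Re \<open>p = 2\<close> by simp
        then have "of_int (4 * N - T\<^sup>2) \<le> (of_int 40 :: real)" unfolding D_square by simp
        then have "4 * N - T\<^sup>2 \<le> 40" by (simp only: of_int_le_iff)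
        moreover have "(4 * N - T\<^sup>2) mod 16 = 4" using j2 True \<open>p = 2\<close> by blast
        ultimately have "4 * N - T\<^sup>2 \<le> 36" by presburger
        then have "of_int (4 * N - T\<^sup>2) \<le> (of_int 36 :: real)" by (simp only: of_int_le_iff)
        then show ?thesis unfolding D_square by simp
      next
        case False
        then have "(Re \<pi>)\<^sup>2 = 0" using Re j by simp
        then show ?thesis using \<open>\<not> (Re \<pi>)\<^sup>2 + (of_int p)\<^sup>2 < D\<^sup>2 / 8\<close> \<open>p = 2\<close> by simp
      qed
      then have "D\<^sup>2 \<le> 6\<^sup>2" by simp
      then have D6: "D \<le> 6" by (rule power2_le_imp_le) simp
      show ?thesis
      proof (cases "D < 4")
        case True
        then have "D\<^sup>2 < 4\<^sup>2" using D_pos by (intro power_strict_mono) auto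
        then show ?thesis using m1 \<open>p = 2\<close> by simp
      next
        case False
        \<comment> \<open>This replaces the parabola D^2 / 16 by its chord between 4 and 6, so that
          only linear inequalities remain.\<close>
        then have "0 \<le> (D - 4) * (6 - D)" using D6 by simp
        then have "D\<^sup>2 / 16 \<le> 10 / 16 * D - 24 / 16" by (simp add: power2_eq_square algebra_simps)
        then show ?thesis using D57 False D6 \<open>p = 2\<close> by simp
      qed
    next
      case p2': False
      then have p3: "3 \<le> real_of_int p" using p2 by simp
      have "(of_int j)\<^sup>2 \<le> (1 :: real)" using j by auto
      then have "(of_int p)\<^sup>2 * (of_int j)\<^sup>2 \<le> (of_int p)\<^sup>2 * (1 :: real)" by (intro mult_left_mono) auto
      then have D10: "D\<^sup>2 \<le> 10 * (of_int p)\<^sup>2" using False Re by linarith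
      have le24: "D\<^sup>2 / (8 * of_int p) \<le> D\<^sup>2 / 24" using p3 by (intro divide_left_mono) auto
      \<comment> \<open>Up to 4.8 the bound D^2 / 24 is below 1, and up to 6.5 it is below (D - 2) /
        sqrt 3. Beyond, 3.17 > sqrt 10 turns D^2 / (8 p) into a linear function of slope 3.17 / 8,
        smaller than 1 / 1.7322.\<close>
      consider "D < 4.8" | "4.8 \<le> D" "D \<le> 6.5" | "6.5 \<le> D" by linarith
      then show ?thesis
      proof cases
        case 1
        then have "D\<^sup>2 < 4.8\<^sup>2" using D_pos by (intro power_strict_mono) auto
        then have "D\<^sup>2 / 24 < 1" by (simp add: power2_eq_square)
        then show ?thesis using le24 m1 by linarith
      next
        case 2
        then have "D * D \<le> 6.5 * D" using D_pos by (intro mult_right_mono) auto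
        then have "D\<^sup>2 / 24 \<le> 6.5 * D / 24" by (simp add: power2_eq_square)
        also have "\<dots> \<le> (D - 2) / 1.7322" using 2 by simp
        also have "\<dots> < cmod m" using 2 D57 by simp
        finally show ?thesis using le24 by linarith
      next
        case 3
        have "D\<^sup>2 \<le> (317 / 100 * of_int p)\<^sup>2" 
        proof -
          have "(317 / 100 * of_int p)\<^sup>2 = 100489 / 10000 * (of_int p :: real)\<^sup>2"
            by (simp add: power_mult_distrib power2_eq_square)
          then show ?thesis using D10 zero_le_power2[of "real_of_int p"] by linarith
        qed
        then have "D \<le> 317 / 100 * of_int p" by (rule power2_le_imp_le) (use p3 in simp)
        then have "D * D \<le> D * (317 / 100 * of_int p)" using D_pos by (intro mult_left_mono) auto
        then have "D\<^sup>2 / (8 * of_int p) \<le> 317 / 100 * D / 8" using p3 by (simp add: power2_eq_square field_simps)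
        also have "\<dots> \<le> (D - 2) / 1.7322" using 3 by simp
        also have "\<dots> < cmod m" using 3 D57 by simp
        finally show ?thesis .
      qed
    qed
    then show ?thesis using lm by blast
  qed
qed

lemma essential_lower_bound_divisor:
  assumes \<delta>: "\<delta> \<in> \<O>" "e \<in> \<O>" "of_int (T\<^sup>2 - 4 * N) = \<delta> * e"
    and proper: "\<And>c. c \<in> \<O> \<Longrightarrow> \<delta> \<noteq> of_int (T\<^sup>2 - 4 * N) * c"
  shows "\<exists>l m. essential l m \<and> cmod \<delta> / 8 < cmod m"
proof -
  have D2: "cmod \<delta> * cmod e = D\<^sup>2"
  proof -
    have "cmod \<delta> * cmod e = cmod (of_int (T\<^sup>2 - 4 * N))" unfolding \<delta>(3) by (simp add: norm_mult)
    also have "\<dots> = \<bar>of_int (T\<^sup>2 - 4 * N)\<bar>" by (rule norm_of_int)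
    also have "(of_int (T\<^sup>2 - 4 * N) :: real) = - D\<^sup>2" unfolding D_square by simp
    finally show ?thesis by simp
  qed
  then have e0: "e \<noteq> 0" "\<delta> \<noteq> 0" using D_pos by auto
  show ?thesis
  proof (cases "Im e = 0")
    case False
    have "cmod \<delta> * (D / 2) \<le> D\<^sup>2" using O_nonreal(2)[OF \<delta>(2) False] D2 mult_left_mono[of "D / 2" "cmod e" "cmod \<delta>"] by simp
    then have "cmod \<delta> * D \<le> (2 * D) * D" by (simp add: power2_eq_square)
    then have \<delta>D: "cmod \<delta> \<le> 2 * D" using D_pos by simp
    obtain l m where lm: "essential l m" "(D - 2) / sqrt 3 < cmod m" using essential_lower_bound_sqrt by blast
    have m1: "1 \<le> cmod m" by (rule essential_norm_ge_1[OF lm(1)])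
    have "cmod \<delta> / 8 < cmod m"
    proof (cases "D < 4")
      case True
      then show ?thesis using \<delta>D m1 by linarith
    next
      case False
      have "sqrt 3 \<le> 2" by (rule real_le_lsqrt) simp_all
      then have "(D - 2) / 2 \<le> (D - 2) / sqrt 3" using False by (intro divide_left_mono) auto
      have "4 \<le> D" using False by simp
      then have "cmod \<delta> / 8 \<le> (D - 2) / 2" using \<delta>D by (simp add: field_simps)
      also have "\<dots> \<le> (D - 2) / sqrt 3" by fact
      also have "\<dots> < cmod m" by (rule lm(2))
      finally show ?thesis .
    qed
    then show ?thesis using lm by blast
  next
    case True
    then obtain n where n: "e = of_int n" using O_real \<delta>(2) by blast
    have "n \<noteq> 0" using e0 n by simp
    have "of_int n * Im \<delta> = 0" using arg_cong[OF \<delta>(3), of Im] by (auto simp: n)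
    then have "Im \<delta> = 0" using \<open>n \<noteq> 0\<close> by auto
    then obtain d where d: "\<delta> = of_int d" using O_real \<delta>(1) by blast
    have "of_int (T\<^sup>2 - 4 * N) = (of_int (d * n) :: complex)" using \<delta>(3) by (simp add: d n)
    then have dn: "T\<^sup>2 - 4 * N = d * n" by (simp only: of_int_eq_iff)
    have "\<not> n dvd 1"
    proof
      assume "n dvd 1"
      then have "n * n = 1" by (metis abs_mult_self_eq mult_1 zdvd1_eq)
      then have "\<delta> = of_int (T\<^sup>2 - 4 * N) * of_int n"
        unfolding dn d by (metis mult.assoc mult.right_neutral of_int_mult)
      then show False using proper by blast
    qed
    then obtain p where p: "Factorial_Ring.prime p" "p dvd n" using \<open>n \<noteq> 0\<close> by (metis prime_divisor_exists)
    then have "p dvd 4 * N - T\<^sup>2" using dn by (metis dvd_mult dvd_minus_iff minus_diff_eq)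
    then obtain l m where lm: "essential l m" "D\<^sup>2 / (8 * of_int p) < cmod m"
      using essential_lower_bound_prime p by blast
    have "p \<le> \<bar>n\<bar>" using p \<open>n \<noteq> 0\<close> by (meson dvd_abs_iff zdvd_imp_le zero_less_abs_iff)
    then have "real_of_int p \<le> cmod e" by (simp add: n) 
    then have "cmod \<delta> * of_int p \<le> D\<^sup>2" using D2 by (metis mult_left_mono norm_ge_zero)
    moreover have "0 < real_of_int p" using p(1) prime_gt_0_int by simp
    ultimately have "cmod \<delta> / 8 \<le> D\<^sup>2 / (8 * of_int p)" by (simp add: field_simps)
    then show ?thesis using lm by force
  qed
qed

end

context imag_quad_field
begin

section \<open>Maximal ideals and gaps\<close>

lemma idealD:
  assumes "ideal A R"
  shows "x \<in> A \<Longrightarrow> x \<in> \<O>" "0 \<in> A" "x \<in> A \<Longrightarrow> y \<in> A \<Longrightarrow> x + y \<in> A" "x \<in> A \<Longrightarrow> r \<in> \<O> \<Longrightarrow> r * x \<in> A"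
    "x \<in> A \<Longrightarrow> r \<in> \<O> \<Longrightarrow> x * r \<in> A" "x \<in> A \<Longrightarrow> - x \<in> A" "x \<in> A \<Longrightarrow> y \<in> A \<Longrightarrow> x - y \<in> A"
proof -
  show 1: "x \<in> A \<Longrightarrow> x \<in> \<O>" "0 \<in> A" "x \<in> A \<Longrightarrow> y \<in> A \<Longrightarrow> x + y \<in> A" "x \<in> A \<Longrightarrow> r \<in> \<O> \<Longrightarrow> r * x \<in> A" for x y r
    using assms unfolding ideal_iff by auto
  show "x \<in> A \<Longrightarrow> r \<in> \<O> \<Longrightarrow> x * r \<in> A" by (subst mult.commute) (rule 1(4))
  show 2: "x \<in> A \<Longrightarrow> - x \<in> A" for x using 1(4)[of x "-1"] by simp
  show "x \<in> A \<Longrightarrow> y \<in> A \<Longrightarrow> x - y \<in> A" using 1(3)[of x "- y"] 2[of y] by simp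
qed

lemma Idl_singleton: assumes "g \<in> \<O>" shows "Idl\<^bsub>R\<^esub> {g} = {x * g | x. x \<in> \<O>}"
  using R.cgenideal_eq_genideal[of g] assms by (simp add: cgenideal_def)

definition max_ideal :: "complex set \<Rightarrow> bool" where
  "max_ideal Q \<longleftrightarrow> ideal Q R \<and> 1 \<notin> Q \<and> (\<forall>x\<in>\<O>. x \<notin> Q \<longrightarrow> (\<exists>a\<in>Q. \<exists>y\<in>\<O>. a + y * x = 1))"

definition principal :: "complex set \<Rightarrow> bool" where
  "principal Q \<longleftrightarrow> (\<exists>g\<in>\<O>. Q = {x * g | x. x \<in> \<O>})"

lemma max_ideal_ideal: "max_ideal Q \<Longrightarrow> ideal Q R" and max_ideal_1: "max_ideal Q \<Longrightarrow> 1 \<notin> Q"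
  by (auto simp: max_ideal_def)

lemma max_ideal_prime:
  assumes Q: "max_ideal Q" and "x \<in> \<O>" "y \<in> \<O>" "x * y \<in> Q"
  shows "x \<in> Q \<or> y \<in> Q"
proof (rule disjCI)
  note I = idealD[OF max_ideal_ideal[OF Q]]
  assume "y \<notin> Q"
  then obtain a r where ar: "a \<in> Q" "r \<in> \<O>" "a + r * y = 1" using Q assms by (auto simp: max_ideal_def)
  have "x = x * a + r * (x * y)" using ar(3) by (metis distrib_left mult.left_commute mult.right_neutral)
  then show "x \<in> Q" using ar assms I(3,4) by metis
qed

lemma max_ideal_subset_eq:
  assumes "max_ideal Q" "ideal P R" "1 \<notin> P" "Q \<subseteq> P" shows "Q = P"
proof (rule ccontr)
  assume "Q \<noteq> P"
  then obtain x where x: "x \<in> P" "x \<notin> Q" using assms by auto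
  then obtain a y where "a \<in> Q" "y \<in> \<O>" "a + y * x = 1"
    using assms idealD(1)[OF assms(2)] by (metis max_ideal_def)
  then show False using x assms idealD(3,4)[OF assms(2)] by (metis subsetD)
qed

lemma ideal_int_dvd:
  assumes Q: "ideal Q R" "1 \<notin> Q" and p: "Factorial_Ring.prime p" "of_int p \<in> Q" "of_int k \<in> Q"
  shows "p dvd k"
proof (rule ccontr)
  assume "\<not> p dvd k"
  then have "Rings.coprime p k" using p(1) by (simp add: prime_imp_coprime)
  then obtain r s where "r * p + s * k = 1" by (metis bezout_int coprime_iff_gcd_eq_1)
  then have "of_int r * of_int p + of_int s * of_int k = (1 :: complex)"
    by (metis of_int_1 of_int_add of_int_mult)
  then show False using Q(2) idealD(3,4)[OF Q(1)] p(2,3) by (metis O_int)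
qed

definition reps :: "int \<Rightarrow> complex set" where
  "reps n = (\<lambda>(a, b). of_int a + of_int b * \<omega>) ` ({0..<n} \<times> {0..<n})"

lemma reps: 
  assumes "0 < n" "x \<in> \<O>"
  obtains y where "y \<in> reps n" "y \<in> \<O>" "\<exists>z\<in>\<O>. x - y = z * of_int n"
proof -
  obtain a b where x: "x = of_int a + of_int b * \<omega>" using assms(2) by (rule O_E)
  define y where "y = of_int (a mod n) + of_int (b mod n) * \<omega>"
  have "x = of_int (n * (a div n) + a mod n) + of_int (n * (b div n) + b mod n) * \<omega>" unfolding x by simp
  then have "x - y = (of_int (a div n) + of_int (b div n) * \<omega>) * of_int n"
    unfolding y_def of_int_add of_int_mult by (simp add: algebra_simps)
  then have "\<exists>z\<in>\<O>. x - y = z * of_int n" by (metis O_I)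
  moreover have "y \<in> reps n" unfolding y_def reps_def using assms(1)
    by (intro image_eqI[of _ _ "(a mod n, b mod n)"]) auto
  ultimately show ?thesis using that by (auto simp: y_def)
qed

lemma finite_reps: "finite (reps n)" and card_reps: "0 < n \<Longrightarrow> card (reps n) \<le> nat n * nat n"
  using card_image_le[of "{0..<n} \<times> {0..<n}" "\<lambda>(a, b). of_int a + of_int b * \<omega>"]
  by (auto simp: reps_def card_cartesian_product)

text \<open>An ideal containing n is a union of cosets of the multiples of n, hence determined by
  the representatives in it. This finiteness takes the place of the Noetherian property in
  \<open>exists_max_ideal\<close>.\<close>

lemma finite_ideals: assumes "0 < n" shows "finite {A. ideal A R \<and> of_int n \<in> A}"
proof -
  have "inj_on (\<lambda>A. A \<inter> reps n) {A. ideal A R \<and> of_int n \<in> A}"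
  proof (rule inj_onI)
    fix A B assume "A \<in> {A. ideal A R \<and> of_int n \<in> A}" "B \<in> {A. ideal A R \<and> of_int n \<in> A}"
      and eq: "A \<inter> reps n = B \<inter> reps n"
    then have A: "ideal A R" "of_int n \<in> A" and B: "ideal B R" "of_int n \<in> B" by auto
    have sub: "A \<subseteq> B" if A: "ideal A R" "of_int n \<in> A" and B: "ideal B R" "of_int n \<in> B"
      and eq: "A \<inter> reps n = B \<inter> reps n" for A B
    proof
      fix x assume x: "x \<in> A"
      then obtain y z where y: "y \<in> reps n" "y \<in> \<O>" "z \<in> \<O>" "x - y = z * of_int n"
        using reps[OF assms idealD(1)[OF A(1)]] by metis
      then have "x - y \<in> A" "x - y \<in> B" using idealD(4) A B by auto
      then have "x - (x - y) \<in> A" using idealD(7)[OF A(1)] x by blast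
      moreover have "x - (x - y) = y" by simp
      ultimately have "y \<in> A" by (simp only:)
      then have "y \<in> B" using y(1) eq by blast
      then have "(x - y) + y \<in> B" using \<open>x - y \<in> B\<close> idealD(3)[OF B(1)] by blast
      then show "x \<in> B" by simp
    qed
    show "A = B" using sub[OF A B eq] sub[OF B A eq[symmetric]] by blast
  qed
  moreover have "finite ((\<lambda>A. A \<inter> reps n) ` {A. ideal A R \<and> of_int n \<in> A})"
    by (rule finite_subset[of _ "Pow (reps n)"]) (auto simp: finite_reps)
  ultimately show ?thesis by (rule finite_imageD[rotated])
qed

lemma ideal_adjoin:
  assumes "ideal A R" "x \<in> \<O>"
  shows "ideal {a + y * x | a y. a \<in> A \<and> y \<in> \<O>} R"
  unfolding ideal_iff
proof (intro conjI ballI)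
  note I = idealD[OF assms(1)]
  let ?I = "{a + y * x | a y. a \<in> A \<and> y \<in> \<O>}"
  show "?I \<subseteq> \<O>" using I(1) assms by auto
  show "0 \<in> ?I" using I(2) by (auto intro!: exI[of _ 0])
  fix u assume "u \<in> ?I"
  then obtain a y where u: "u = a + y * x" "a \<in> A" "y \<in> \<O>" by blast
  { fix w assume "w \<in> ?I"
    then obtain b z where w: "w = b + z * x" "b \<in> A" "z \<in> \<O>" by blast
    have "u + w = (a + b) + (y + z) * x" unfolding u w by (simp add: algebra_simps)
    then show "u + w \<in> ?I" using I(3) u w O_add by blast }
  fix r assume "r \<in> \<O>"
  have "r * u = r * a + (r * y) * x" unfolding u by (simp add: algebra_simps)
  then show "r * u \<in> ?I" using I(4) u \<open>r \<in> \<O>\<close> O_mult by blast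
qed

lemma exists_max_ideal:
  assumes "ideal I R" "1 \<notin> I" "0 < n" "of_int n \<in> I"
  obtains Q where "max_ideal Q" "I \<subseteq> Q"
proof -
  let ?S = "{A. ideal A R \<and> of_int n \<in> A \<and> 1 \<notin> A}"
  have "finite ?S" by (rule finite_subset[OF _ finite_ideals[OF assms(3)]]) auto
  then obtain Q where Q: "Q \<in> ?S" "I \<subseteq> Q" "\<And>B. B \<in> ?S \<Longrightarrow> Q \<subseteq> B \<Longrightarrow> Q = B"
    using finite_has_maximal2[of ?S I] assms by auto
  have "max_ideal Q"
    unfolding max_ideal_def
  proof (intro conjI ballI impI)
    show id: "ideal Q R" "1 \<notin> Q" using Q by auto
    fix x assume x: "x \<in> \<O>" "x \<notin> Q"
    let ?J = "{a + y * x | a y. a \<in> Q \<and> y \<in> \<O>}"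
    have "Q \<subseteq> ?J"
    proof
      fix q assume "q \<in> Q"
      moreover have "q = q + 0 * x" by simp
      ultimately show "q \<in> ?J" using O_0 by blast
    qed
    moreover have "x = 0 + 1 * x" by simp
    then have "x \<in> ?J" using idealD(2)[OF id(1)] O_1 by blast
    ultimately have "?J \<notin> ?S" using Q(3)[of ?J] x by auto
    moreover have "of_int n \<in> ?J" using \<open>Q \<subseteq> ?J\<close> Q(1) by blast
    ultimately have "1 \<in> ?J" using ideal_adjoin[OF id(1) x(1)] by blast
    then show "\<exists>a\<in>Q. \<exists>y\<in>\<O>. a + y * x = 1" by force
  qed
  then show ?thesis using that Q by blast
qed

lemma nonzero_ideal_int:
  assumes "ideal A R" "x \<in> A" "x \<noteq> 0"
  obtains n where "0 < n" "of_int n \<in> A"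
proof -
  obtain n :: int where n: "(cmod x)\<^sup>2 = of_int n" "x * cnj x = of_int n"
    using norm_O idealD(1)[OF assms(1,2)] by blast
  have "0 < (cmod x)\<^sup>2" using assms by simp
  then have "0 < n" using n by simp
  moreover have "of_int n \<in> A" unfolding n(2)[symmetric]
    using idealD(1,5)[OF assms(1)] assms(2) by blast
  ultimately show ?thesis using that by blast
qed

lemma carrier_Quot: "carrier (R Quot A) = (\<lambda>x. (\<lambda>a. a + x) ` A) ` \<O>"
  by (auto simp: FactRing_def A_RCOSETS_def' a_r_coset_def')

lemma coset_eq:
  assumes A: "ideal A R" and "x - y \<in> A" shows "(\<lambda>a. a + x) ` A = (\<lambda>a. a + y) ` A"
proof -
  have sub: "(\<lambda>a. a + x) ` A \<subseteq> (\<lambda>a. a + y) ` A" if "x - y \<in> A" for x y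
  proof
    fix u assume "u \<in> (\<lambda>a. a + x) ` A"
    then obtain a where a: "a \<in> A" "u = a + x" by auto
    then have "u = (a + (x - y)) + y" by simp
    then show "u \<in> (\<lambda>a. a + y) ` A" using a that idealD(3)[OF A] by blast
  qed
  have "y - x \<in> A" using idealD(6)[OF A assms(2)] by simp
  then show ?thesis using sub[OF assms(2)] sub[of y x] by blast
qed

lemma ideal_norm_le:
  assumes A: "ideal A R" "of_int n \<in> A" "0 < n"
  shows "finite (carrier (R Quot A))" "ideal_norm R A \<le> nat n * nat n"
proof -
  have sub: "carrier (R Quot A) \<subseteq> (\<lambda>x. (\<lambda>a. a + x) ` A) ` reps n"
  proof
    fix c assume "c \<in> carrier (R Quot A)"
    then obtain x where x: "x \<in> \<O>" "c = (\<lambda>a. a + x) ` A" by (auto simp: carrier_Quot)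
    obtain y z where y: "y \<in> reps n" "z \<in> \<O>" "x - y = z * of_int n" using reps[OF A(3) x(1)] by metis
    then have "x - y \<in> A" using idealD(4)[OF A(1,2)] by simp
    then show "c \<in> (\<lambda>x. (\<lambda>a. a + x) ` A) ` reps n" using coset_eq[OF A(1)] x y by blast
  qed
  then show "finite (carrier (R Quot A))" by (rule finite_subset) (intro finite_imageI finite_reps)
  have "ideal_norm R A \<le> card ((\<lambda>x. (\<lambda>a. a + x) ` A) ` reps n)"
    unfolding ideal_norm_def using sub finite_reps by (intro card_mono) auto
  also have "\<dots> \<le> card (reps n)" by (rule card_image_le[OF finite_reps])
  finally show "ideal_norm R A \<le> nat n * nat n" using card_reps[OF A(3)] by linarith
qed

text \<open>Two of the numbers 0, ..., B - 1 are congruent modulo A, and their difference divides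
  B!, so all these ideals contain B!. The zero ideal is excluded because its infinite quotient has
  \<open>card\<close> 0.\<close>

lemma finite_ideals_bounded_norm: "finite {A. ideal A R \<and> A \<noteq> {0} \<and> ideal_norm R A < B}"
proof (rule finite_subset)
  show "finite {A. ideal A R \<and> of_int (fact B) \<in> A}" by (rule finite_ideals) simp
  show "{A. ideal A R \<and> A \<noteq> {0} \<and> ideal_norm R A < B} \<subseteq> {A. ideal A R \<and> of_int (fact B) \<in> A}"
  proof
    fix A assume "A \<in> {A. ideal A R \<and> A \<noteq> {0} \<and> ideal_norm R A < B}"
    then have A: "ideal A R" "A \<noteq> {0}" "card (carrier (R Quot A)) < B" by (auto simp: ideal_norm_def)
    obtain x where "x \<in> A" "x \<noteq> 0" using A(2) idealD(2)[OF A(1)] by blast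
    then obtain n where n: "0 < n" "of_int n \<in> A" using nonzero_ideal_int A(1) by metis
    have fin: "finite (carrier (R Quot A))" by (rule ideal_norm_le(1)[OF A(1) n(2,1)])
    define f where "f i = (\<lambda>a. a + (of_nat i :: complex)) ` A" for i :: nat
    have "f ` {..<B} \<subseteq> carrier (R Quot A)" by (auto simp: f_def carrier_Quot)
    then have "\<not> inj_on f {..<B}"
      using card_inj_on_le[of f "{..<B}" "carrier (R Quot A)"] fin A(3) by auto
    then obtain i j where ij: "i < j" "j < B" "f i = f j"
      unfolding inj_on_def by (metis lessThan_iff linorder_neqE_nat)
    have "of_nat j \<in> f j" using idealD(2)[OF A(1)] by (auto simp: f_def)
    then obtain a where a: "a \<in> A" "of_nat j = a + of_nat i" using ij by (auto simp: f_def)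
    then have "a = of_nat (j - i)" using ij by (simp add: of_nat_diff)
    moreover have "j - i dvd fact B" using ij by (intro dvd_fact) auto
    then obtain k where "fact B = (j - i) * k" by blast
    then have "(fact B :: complex) = of_nat k * of_nat (j - i)" by (metis mult.commute of_nat_fact of_nat_mult)
    ultimately have "(fact B :: complex) \<in> A" using a idealD(4)[OF A(1) a(1), of "of_nat k"] by simp
    then show "A \<in> {A. ideal A R \<and> of_int (fact B) \<in> A}" using A by simp
  qed
qed

section \<open>Gap bounds, and the values of \<open>LEAST\<close> and \<open>Max\<close>\<close>

definition admissible :: "complex set \<Rightarrow> complex \<Rightarrow> bool" where
  "admissible A \<alpha> \<longleftrightarrow> (ideal_dvd R (Idl\<^bsub>R\<^esub> {2}) A \<longrightarrow>
     \<not> (primeideal (Idl\<^bsub>R\<^esub> {2, \<alpha>}) R \<and> split_prime R 2))"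

definition gap_bound :: "complex set \<Rightarrow> real \<Rightarrow> bool" where
  "gap_bound A x \<longleftrightarrow> x \<ge> 0 \<and> (\<forall>\<alpha>\<in>\<O>. admissible A \<alpha> \<longrightarrow>
     (\<forall>c. \<exists>j :: int. of_int j \<in> {c..c + x} \<and> Idl\<^bsub>R\<^esub> (A \<union> {\<alpha> + of_int j}) = carrier R))"

lemma max_gap_eq: "max_gap R A = (LEAST x. gap_bound A x)"
  by (simp add: max_gap_def gap_bound_def admissible_def)

lemma gap_bound_mono: assumes "gap_bound A x" "x \<le> y" shows "gap_bound A y"
  unfolding gap_bound_def
proof (intro conjI ballI impI allI)
  show "0 \<le> y" using assms by (simp add: gap_bound_def)
  fix \<alpha> c assume "\<alpha> \<in> \<O>" "admissible A \<alpha>"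
  then obtain j :: int where "of_int j \<in> {c..c + x}" "Idl\<^bsub>R\<^esub> (A \<union> {\<alpha> + of_int j}) = carrier R"
    using assms(1) unfolding gap_bound_def by blast
  then show "\<exists>j :: int. of_int j \<in> {c..c + y} \<and> Idl\<^bsub>R\<^esub> (A \<union> {\<alpha> + of_int j}) = carrier R"
    using assms(2) by (intro exI[of _ j]) auto
qed

text \<open>The least bound is attained because the interval \<open>{c..c + x}\<close> contains no new integer when \<open>x\<close> grows
  by a small amount.\<close>

lemma gap_bound_max_gap:
  assumes "gap_bound A x0" shows "gap_bound A (max_gap R A)"
proof -
  define S where "S = {x. gap_bound A x}"
  have S: "x0 \<in> S" "\<And>x. x \<in> S \<Longrightarrow> 0 \<le> x" using assms by (auto simp: S_def gap_bound_def)
  then have bdd: "bdd_below S" by (meson bdd_below.I)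
  have m: "gap_bound A (Inf S)"
    unfolding gap_bound_def
  proof (intro conjI ballI impI allI)
    show "0 \<le> Inf S" using S by (intro cInf_greatest) auto
    fix \<alpha> c assume \<alpha>: "\<alpha> \<in> \<O>" "admissible A \<alpha>"
    have "Inf S < of_int \<lfloor>c + Inf S\<rfloor> + 1 - c" by linarith
    then obtain x where x: "x \<in> S" "x < of_int \<lfloor>c + Inf S\<rfloor> + 1 - c" using cInf_lessD[of S] S(1) by blast
    then obtain j :: int where j: "of_int j \<in> {c..c + x}" "Idl\<^bsub>R\<^esub> (A \<union> {\<alpha> + of_int j}) = carrier R"
      using \<alpha> unfolding S_def gap_bound_def by blast
    have "real_of_int j < of_int \<lfloor>c + Inf S\<rfloor> + 1" using j x by auto
    then have "j \<le> \<lfloor>c + Inf S\<rfloor>" by linarith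
    then have "of_int j \<le> c + Inf S" by linarith
    then show "\<exists>j :: int. of_int j \<in> {c..c + Inf S} \<and> Idl\<^bsub>R\<^esub> (A \<union> {\<alpha> + of_int j}) = carrier R"
      using j by (intro exI[of _ j]) auto
  qed
  have "max_gap R A = Inf S"
    unfolding max_gap_eq using m bdd by (intro Least_equality) (auto simp: S_def intro: cInf_lower)
  then show ?thesis using m by simp
qed

text \<open>The \<open>Max\<close> runs over finitely many ideals by
  \<open>finite_ideals_bounded_norm\<close>. The \<open>LEAST\<close> is a gap bound once some gap
  bound exists, which \<open>ex\<close> supplies.\<close>

lemma gap_bound_max_gap_below:
  assumes A: "ideal A R" "A \<noteq> {0}" "\<And>P. primeideal P R \<Longrightarrow> principalideal P R \<Longrightarrow> \<not> ideal_dvd R P A"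
    and norm: "sqrt (real (ideal_norm R A)) < x" and ex: "gap_bound A x0"
  shows "gap_bound A (max_gap_below R x)"
proof -
  let ?S = "{A. ideal A R \<and> A \<noteq> {0} \<and> (\<forall>P. primeideal P R \<and> principalideal P R \<longrightarrow> \<not> ideal_dvd R P A) \<and>
     sqrt (real (ideal_norm R A)) < x}"
  have "?S \<subseteq> {A. ideal A R \<and> A \<noteq> {0} \<and> ideal_norm R A < nat \<lceil>x\<^sup>2\<rceil> + 1}"
  proof
    fix A assume A: "A \<in> ?S"
    then have "sqrt (real (ideal_norm R A)) < x" by blast
    then have "(sqrt (real (ideal_norm R A)))\<^sup>2 \<le> x\<^sup>2" by (intro power_mono) auto
    then have "real (ideal_norm R A) \<le> x\<^sup>2" by simp
    then have "ideal_norm R A < nat \<lceil>x\<^sup>2\<rceil> + 1" by linarith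
    then show "A \<in> {A. ideal A R \<and> A \<noteq> {0} \<and> ideal_norm R A < nat \<lceil>x\<^sup>2\<rceil> + 1}" using A by blast
  qed
  then have "finite ?S" using finite_ideals_bounded_norm finite_subset by blast
  then have "finite (max_gap R ` ?S)" by simp
  moreover have "max_gap_below R x = Max (max_gap R ` ?S)"
    unfolding max_gap_below_def by (rule arg_cong[of _ _ Max]) blast
  moreover have "A \<in> ?S" using A norm by blast
  ultimately have "max_gap R A \<le> max_gap_below R x" by simp
  then show ?thesis using gap_bound_mono gap_bound_max_gap[OF ex] by blast
qed

text \<open>The intersection is taken inside the ring, so that the empty family gives the unit
  ideal.\<close>

definition cap :: "complex set set \<Rightarrow> complex set" where
  "cap \<Q> = {x \<in> \<O>. \<forall>Q\<in>\<Q>. x \<in> Q}"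

lemma ideal_cap: assumes "\<And>Q. Q \<in> \<Q> \<Longrightarrow> ideal Q R" shows "ideal (cap \<Q>) R"
  unfolding ideal_iff cap_def using assms unfolding ideal_iff by auto

lemma cap_subset_prime:
  assumes "finite \<Q>" "\<And>Q. Q \<in> \<Q> \<Longrightarrow> ideal Q R" and P: "1 \<notin> P"
    "\<And>x y. x \<in> \<O> \<Longrightarrow> y \<in> \<O> \<Longrightarrow> x * y \<in> P \<Longrightarrow> x \<in> P \<or> y \<in> P" and "cap \<Q> \<subseteq> P"
  shows "\<exists>Q\<in>\<Q>. Q \<subseteq> P"
  using assms(1,2,5)
proof (induction \<Q>)
  case empty
  then show ?case using P(1) by (auto simp: cap_def)
next
  case (insert Q \<Q>)
  show ?case
  proof (cases "Q \<subseteq> P")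
    case False
    then obtain x where x: "x \<in> Q" "x \<notin> P" by blast
    have Q: "ideal Q R" using insert.prems by blast
    have "cap \<Q> \<subseteq> P"
    proof
      fix y assume y: "y \<in> cap \<Q>"
      then have "x * y \<in> cap (insert Q \<Q>)"
        using x idealD(1,5)[OF Q x(1)] insert.prems(1) idealD(4) by (auto simp: cap_def)
      then have "x * y \<in> P" using insert.prems by blast
      then show "y \<in> P" using P(2)[of x y] x y idealD(1)[OF Q x(1)] by (auto simp: cap_def)
    qed
    then show ?thesis using insert by blast
  qed auto
qed

lemma max_ideal_cap_mem:
  assumes "finite \<Q>" "\<And>Q. Q \<in> \<Q> \<Longrightarrow> max_ideal Q" "max_ideal P" "cap \<Q> \<subseteq> P"
  shows "P \<in> \<Q>"
proof -
  have "\<And>Q. Q \<in> \<Q> \<Longrightarrow> ideal Q R" using assms(2) max_ideal_ideal by blast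
  then have "\<exists>Q\<in>\<Q>. Q \<subseteq> P"
    using cap_subset_prime[OF assms(1)] max_ideal_1[OF assms(3)] max_ideal_prime[OF assms(3)] assms(4) by blast
  then obtain Q where "Q \<in> \<Q>" "Q \<subseteq> P" by blast
  then show ?thesis
    using max_ideal_subset_eq[OF assms(2) max_ideal_ideal[OF assms(3)] max_ideal_1[OF assms(3)]] by metis
qed

lemma ideal_dvd_subset:
  assumes "ideal P R" "ideal_dvd R P A" shows "A \<subseteq> P"
  using assms R.ideal_prod_inter unfolding ideal_dvd_def by blast

lemma primeidealD:
  assumes "primeideal P R"
  shows "ideal P R" "1 \<notin> P" "x \<in> \<O> \<Longrightarrow> y \<in> \<O> \<Longrightarrow> x * y \<in> P \<Longrightarrow> x \<in> P \<or> y \<in> P"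
proof -
  interpret primeideal P R by fact
  show "ideal P R" by (rule ideal_axioms)
  show "1 \<notin> P" using I_notcarr one_imp_carrier by auto
  show "x \<in> \<O> \<Longrightarrow> y \<in> \<O> \<Longrightarrow> x * y \<in> P \<Longrightarrow> x \<in> P \<or> y \<in> P" using I_prime by simp
qed

lemma primeidealI':
  assumes "ideal P R" "1 \<notin> P" "\<And>x y. x \<in> \<O> \<Longrightarrow> y \<in> \<O> \<Longrightarrow> x * y \<in> P \<Longrightarrow> x \<in> P \<or> y \<in> P"
  shows "primeideal P R"
  using assms by (intro primeidealI R.is_cring) auto

lemma cap_no_principal_prime_divisor:
  assumes "finite \<Q>" "\<And>Q. Q \<in> \<Q> \<Longrightarrow> max_ideal Q \<and> \<not> principal Q" "primeideal P R" "principalideal P R"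
  shows "\<not> ideal_dvd R P (cap \<Q>)"
proof
  note P = primeidealD[OF assms(3)]
  assume "ideal_dvd R P (cap \<Q>)"
  then have "cap \<Q> \<subseteq> P" using ideal_dvd_subset P(1) by blast
  moreover have "\<And>Q. Q \<in> \<Q> \<Longrightarrow> ideal Q R" using assms(2) max_ideal_ideal by blast
  ultimately have "\<exists>Q\<in>\<Q>. Q \<subseteq> P" using cap_subset_prime[OF assms(1)] P(2,3) by blast
  then obtain Q where Q: "Q \<in> \<Q>" "Q \<subseteq> P" by blast
  then have "Q = P" using max_ideal_subset_eq P assms(2) by blast
  moreover obtain i where "i \<in> \<O>" "P = Idl\<^bsub>R\<^esub> {i}" using assms(4) by (auto simp: principalideal_def principalideal_axioms_def)
  then have "principal P" unfolding principal_def using Idl_singleton by blast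
  ultimately show False using assms(2) Q by blast
qed

section \<open>Residues forbidden by maximal ideals\<close>

lemma max_ideal_prime_mem:
  assumes "max_ideal Q" "0 < n" "of_nat n \<in> Q"
  shows "\<exists>p. Factorial_Ring.prime p \<and> p dvd n \<and> of_nat p \<in> Q"
  using assms(2,3)
proof (induction n rule: less_induct)
  case (less n)
  have "n \<noteq> 1" using less.prems max_ideal_1[OF assms(1)] by auto
  then obtain p where p: "Factorial_Ring.prime p" "p dvd n" using prime_factor_nat by blast
  then obtain k where k: "n = p * k" by blast
  have "of_nat p \<in> Q \<or> of_nat k \<in> Q"
    using max_ideal_prime[OF assms(1), of "of_nat p" "of_nat k"] less.prems k by simp
  moreover have "k < n" "0 < k" using k less.prems prime_gt_1_nat[OF p(1)] by auto
  ultimately show ?case using less.IH[of k] p k by (metis dvd_mult)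
qed

lemma ideal_nat_dvd:
  assumes Q: "max_ideal Q" and p: "Factorial_Ring.prime (p :: nat)" "of_nat p \<in> Q" "of_int k \<in> Q"
  shows "int p dvd k"
  using ideal_int_dvd[OF max_ideal_ideal[OF Q] max_ideal_1[OF Q], of "int p" k] p by simp

text \<open>If \<alpha> + j lies in a maximal ideal over p, then p divides its norm n + j t + j^2.
  For j = 0, 1, 2 the second difference of these norms is 2, which an odd p does not divide.\<close>

lemma residue_odd:
  assumes p: "Factorial_Ring.prime (p :: nat)" "p \<noteq> 2" and \<alpha>: "\<alpha> \<in> \<O>"
  shows "\<exists>j :: int. \<forall>Q. max_ideal Q \<longrightarrow> of_nat p \<in> Q \<longrightarrow> \<alpha> + of_int j \<notin> Q"
proof (rule ccontr)
  assume neg: "\<not> ?thesis"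
  obtain n :: int where n: "\<alpha> * cnj \<alpha> = of_int n" using norm_O[OF \<alpha>] by blast
  obtain t :: int where t: "2 * Re \<alpha> = of_int t" using Re_O[OF \<alpha>] by blast
  have t': "\<alpha> + cnj \<alpha> = of_int t" using t by (simp add: complex_add_cnj)
  have dvd: "int p dvd n + j * t + j\<^sup>2" for j :: int
  proof -
    obtain Q where Q: "max_ideal Q" "of_nat p \<in> Q" "\<alpha> + of_int j \<in> Q" using neg by blast
    have "cnj \<alpha> + of_int j \<in> \<O>" using \<alpha> by simp
    then have "(\<alpha> + of_int j) * (cnj \<alpha> + of_int j) \<in> Q" using idealD(5)[OF max_ideal_ideal[OF Q(1)] Q(3)] by blast
    moreover have "(\<alpha> + of_int j) * (cnj \<alpha> + of_int j) = \<alpha> * cnj \<alpha> + of_int j * (\<alpha> + cnj \<alpha>) + (of_int j)\<^sup>2"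
      by (simp add: power2_eq_square algebra_simps)
    ultimately have "of_int (n + j * t + j\<^sup>2) \<in> Q" unfolding n t' by simp
    then show ?thesis using ideal_nat_dvd[OF Q(1) p(1) Q(2)] by blast
  qed
  have d: "int p dvd n" "int p dvd n + t + 1" "int p dvd n + 2 * t + 4" using dvd[of 0] dvd[of 1] dvd[of 2] by simp_all
  have "int p dvd (n + 2 * t + 4) - 2 * (n + t + 1) + n"
    by (rule dvd_add[OF dvd_diff[OF d(3) dvd_mult[OF d(2)]] d(1)])
  then have "int p dvd 2" by (simp add: algebra_simps)
  then have "p dvd 2" by (metis int_dvd_int_iff of_nat_numeral)
  then show False using p by (metis primes_dvd_imp_eq two_is_prime_nat)
qed

lemma prod_ideal_subset_induct:
  assumes "x \<in> I \<cdot>\<^bsub>R\<^esub> B" "ideal A R" "\<And>i j. i \<in> I \<Longrightarrow> j \<in> B \<Longrightarrow> i * j \<in> A"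
  shows "x \<in> A"
  using assms(1) by (induction rule: ideal_prod.induct) (use assms idealD(3) in auto)

text \<open>If both residues modulo 2 are forbidden, then 2 splits into the two ideals forbidding them.\<close>

lemma residue_two:
  assumes \<Q>: "\<And>Q. Q \<in> \<Q> \<Longrightarrow> max_ideal Q" and \<alpha>: "\<alpha> \<in> \<O>" "admissible (cap \<Q>) \<alpha>"
  shows "\<exists>j :: int. \<forall>Q\<in>\<Q>. 2 \<in> Q \<longrightarrow> \<alpha> + of_int j \<notin> Q"
proof (rule ccontr)
  assume neg: "\<not> ?thesis"
  obtain Q0 where "Q0 \<in> \<Q>" "2 \<in> Q0" "\<alpha> + of_int 0 \<in> Q0" using neg by blast
  then have Q0: "max_ideal Q0" "2 \<in> Q0" "\<alpha> \<in> Q0" "Q0 \<in> \<Q>" using \<Q> by auto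
  obtain Q1 where "Q1 \<in> \<Q>" "2 \<in> Q1" "\<alpha> + of_int 1 \<in> Q1" using neg by blast
  then have Q1: "max_ideal Q1" "2 \<in> Q1" "\<alpha> + 1 \<in> Q1" "Q1 \<in> \<Q>" using \<Q> by auto
  note I0 = idealD[OF max_ideal_ideal[OF Q0(1)]] and I1 = idealD[OF max_ideal_ideal[OF Q1(1)]]
  have two: "Factorial_Ring.prime (2 :: nat)" by (rule two_is_prime_nat)
  have even0: "even k" if "of_int k \<in> Q0" for k using ideal_nat_dvd[OF Q0(1) two] Q0(2) that by simp
  have even1: "even k" if "of_int k \<in> Q1" for k using ideal_nat_dvd[OF Q1(1) two] Q1(2) that by simp
  obtain a b where ab: "\<alpha> = of_int a + of_int b * \<omega>" using \<alpha>(1) by (rule O_E)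
  \<comment> \<open>For even b, \<alpha> is congruent to the integer a modulo 2, and a and a + 1
    would both be even. With b odd, 1 and \<alpha> generate the ring modulo 2.\<close>
  have "odd b"
  proof
    assume "even b"
    then obtain k where k: "b = 2 * k" by blast
    have 2: "of_int k * \<omega> * 2 \<in> Q0" "of_int k * \<omega> * 2 \<in> Q1" using Q0(2) Q1(2) I0(4) I1(4) by auto
    have "of_int a = \<alpha> - of_int k * \<omega> * 2" "of_int (a + 1) = \<alpha> + 1 - of_int k * \<omega> * 2" unfolding ab k by simp_all
    then have "of_int a \<in> Q0" "of_int (a + 1) \<in> Q1" using 2 I0(7) I1(7) Q0(3) Q1(3) by metis+
    then have "even a" "even (a + 1)" using even0 even1 by blast+
    then show False by simp
  qed
  then obtain k where k: "b = 2 * k + 1" by (metis oddE)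
  have rep: "\<exists>c d. \<exists>y\<in>\<O>. x = of_int c + of_int d * \<alpha> + 2 * y" if x: "x \<in> \<O>" for x
  proof -
    obtain e f where "x = of_int e + of_int f * \<omega>" using x by (rule O_E)
    then have "x = of_int (e - f * a) + of_int f * \<alpha> + 2 * (- (of_int (f * k) * \<omega>))"
      unfolding ab k by (simp add: algebra_simps)
    then show ?thesis by (metis O_int O_mult O_omega O_uminus)
  qed
  have Q0rep: "\<exists>r\<in>\<O>. \<exists>s\<in>\<O>. x = r * 2 + s * \<alpha>" and Q0c: "\<exists>c d. \<exists>y\<in>\<O>. even c \<and> x = of_int c + of_int d * \<alpha> + 2 * y" if x: "x \<in> Q0" for x
  proof -
    obtain c d y where r: "y \<in> \<O>" "x = of_int c + of_int d * \<alpha> + 2 * y" using rep[OF I0(1)[OF x]] by blast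
    have "of_int c = x - of_int d * \<alpha> - y * 2" using r by simp
    moreover have "x - of_int d * \<alpha> - y * 2 \<in> Q0" using x Q0 r by (intro I0(4,7)) auto
    ultimately have c: "even c" using even0 by simp
    then show "\<exists>c d. \<exists>y\<in>\<O>. even c \<and> x = of_int c + of_int d * \<alpha> + 2 * y" using r by blast
    obtain c' where "c = 2 * c'" using c by blast
    then have "x = (of_int c' + y) * 2 + of_int d * \<alpha>" using r by (simp add: algebra_simps)
    then show "\<exists>r\<in>\<O>. \<exists>s\<in>\<O>. x = r * 2 + s * \<alpha>" using r by (metis O_add O_int)
  qed
  have "Idl\<^bsub>R\<^esub> {2, \<alpha>} = Q0"
  proof
    show "Idl\<^bsub>R\<^esub> {2, \<alpha>} \<subseteq> Q0" using Q0 max_ideal_ideal by (intro R.genideal_minimal) auto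
    show "Q0 \<subseteq> Idl\<^bsub>R\<^esub> {2, \<alpha>}" unfolding Idl_pair[OF O_numeral \<alpha>(1)] using Q0rep by blast
  qed
  moreover have prime: "primeideal Q0 R" "primeideal Q1 R"
    using Q0(1) Q1(1) max_ideal_ideal max_ideal_1 max_ideal_prime by (intro primeidealI'; blast)+
  moreover have two_cap: "\<exists>y\<in>\<O>. x = y * 2" if x: "x \<in> Q0" "x \<in> Q1" for x
  proof -
    obtain c d y where r: "y \<in> \<O>" "even c" "x = of_int c + of_int d * \<alpha> + 2 * y" using Q0c[OF x(1)] by blast
    have "of_int (c - d) = x - of_int d * (\<alpha> + 1) - y * 2" using r by (simp add: algebra_simps)
    moreover have "x - of_int d * (\<alpha> + 1) - y * 2 \<in> Q1" using x Q1 r by (intro I1(4,7)) auto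
    ultimately have "even (c - d)" using even1 by metis
    then have "even d" using r(2) by simp
    obtain c' where "c = 2 * c'" using r(2) by blast
    moreover obtain d' where "d = 2 * d'" using \<open>even d\<close> by blast
    ultimately have "x = (of_int c' + of_int d' * \<alpha> + y) * 2" using r by (simp add: algebra_simps)
    then show ?thesis using r \<alpha> by (metis O_add O_int O_mult)
  qed
  have split: "split_prime R 2"
    unfolding split_prime_def
  proof (intro conjI exI)
    show "Factorial_Ring.prime (2 :: nat)" "primeideal Q0 R" "primeideal Q1 R" by fact+
    show "Q0 \<noteq> Q1"
    proof
      assume "Q0 = Q1"
      then have "(\<alpha> + 1) - \<alpha> \<in> Q1" using Q0 Q1 I1(7) by blast
      then show False using max_ideal_1[OF Q1(1)] by simp
    qed
    show "Idl\<^bsub>R\<^esub> {of_nat 2} = Q0 \<cdot>\<^bsub>R\<^esub> Q1"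
    proof
      show "Q0 \<cdot>\<^bsub>R\<^esub> Q1 \<subseteq> Idl\<^bsub>R\<^esub> {of_nat 2}"
        using R.ideal_prod_inter[OF max_ideal_ideal[OF Q0(1)] max_ideal_ideal[OF Q1(1)]] two_cap
          Idl_singleton[of 2] by auto
      show "Idl\<^bsub>R\<^esub> {of_nat 2} \<subseteq> Q0 \<cdot>\<^bsub>R\<^esub> Q1"
      proof
        fix z assume "z \<in> Idl\<^bsub>R\<^esub> {of_nat 2}"
        then obtain x where x: "x \<in> \<O>" "z = x * 2" using Idl_singleton[of 2] by auto
        \<comment> \<open>The element 2 x lies in the product of the two ideals because 1 =
          (\<alpha> + 1) - \<alpha>.\<close>
        have 1: "2 * ((\<alpha> + 1) * x) \<in> Q0 \<cdot>\<^bsub>R\<^esub> Q1"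
          using ideal_prod.prod[of 2 Q0 "(\<alpha> + 1) * x" Q1 R] Q0 I1(5)[OF Q1(3) x(1)] by simp
        have 2: "(\<alpha> * (- x)) * 2 \<in> Q0 \<cdot>\<^bsub>R\<^esub> Q1"
          using ideal_prod.prod[of "\<alpha> * (- x)" Q0 2 Q1 R] Q1 I0(5)[OF Q0(3), of "- x"] x by simp
        have "2 * ((\<alpha> + 1) * x) \<oplus>\<^bsub>R\<^esub> (\<alpha> * (- x)) * 2 \<in> Q0 \<cdot>\<^bsub>R\<^esub> Q1"
          by (rule ideal_prod.sum[OF 1 2])
        moreover have "2 * ((\<alpha> + 1) * x) \<oplus>\<^bsub>R\<^esub> (\<alpha> * (- x)) * 2 = z" unfolding x by (simp add: algebra_simps)
        ultimately show "z \<in> Q0 \<cdot>\<^bsub>R\<^esub> Q1" by (simp only:)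
      qed
    qed
  qed
  have idA: "ideal (cap \<Q>) R" using \<Q> max_ideal_ideal by (intro ideal_cap) blast
  moreover have "ideal_dvd R (Idl\<^bsub>R\<^esub> {2}) (cap \<Q>)"
  proof -
    \<comment> \<open>The intersection lies in both ideals, hence in (2) by \<open>two_cap\<close>.
      Halving its elements gives the cofactor.\<close>
    let ?B = "{x \<in> \<O>. x * 2 \<in> cap \<Q>}"
    have "ideal ?B R" unfolding ideal_iff
    proof (intro conjI ballI)
      show "?B \<subseteq> \<O>" "0 \<in> ?B" using idealD(2)[OF idA] by auto
      fix x assume x: "x \<in> ?B"
      { fix y assume "y \<in> ?B"
        then show "x + y \<in> ?B" using x idealD(3)[OF idA, of "x * 2" "y * 2"] by (auto simp: algebra_simps) }
      fix r assume "r \<in> \<O>"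
      then show "r * x \<in> ?B" using x idealD(4)[OF idA, of "x * 2" r] by (auto simp: mult.assoc)
    qed
    moreover have "cap \<Q> = (Idl\<^bsub>R\<^esub> {2}) \<cdot>\<^bsub>R\<^esub> ?B"
    proof
      show "cap \<Q> \<subseteq> (Idl\<^bsub>R\<^esub> {2}) \<cdot>\<^bsub>R\<^esub> ?B"
      proof
        fix x assume x: "x \<in> cap \<Q>"
        then obtain y where y: "y \<in> \<O>" "x = y * 2" using two_cap Q0(4) Q1(4) by (auto simp: cap_def)
        have "2 \<in> Idl\<^bsub>R\<^esub> {2}" by (rule R.genideal_self') simp
        then have "2 * y \<in> (Idl\<^bsub>R\<^esub> {2}) \<cdot>\<^bsub>R\<^esub> ?B"
          using ideal_prod.prod[of 2 "Idl\<^bsub>R\<^esub> {2}" y ?B R] x y by simp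
        then show "x \<in> (Idl\<^bsub>R\<^esub> {2}) \<cdot>\<^bsub>R\<^esub> ?B" using y by (simp add: mult.commute)
      qed
      show "(Idl\<^bsub>R\<^esub> {2}) \<cdot>\<^bsub>R\<^esub> ?B \<subseteq> cap \<Q>"
      proof
        fix x assume "x \<in> (Idl\<^bsub>R\<^esub> {2}) \<cdot>\<^bsub>R\<^esub> ?B"
        then show "x \<in> cap \<Q>"
        proof (rule prod_ideal_subset_induct[OF _ idA])
          fix i j assume "i \<in> Idl\<^bsub>R\<^esub> {2}" "j \<in> ?B"
          then obtain r where "r \<in> \<O>" "i = r * 2" "j * 2 \<in> cap \<Q>" using Idl_singleton[of 2] by auto
          moreover have "r * 2 * j = r * (j * 2)" by simp
          ultimately show "i * j \<in> cap \<Q>" using idealD(4)[OF idA] by metis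
        qed
      qed
    qed
    ultimately show ?thesis unfolding ideal_dvd_def by blast
  qed
  ultimately show False using \<alpha>(2) split unfolding admissible_def by metis
qed

lemma Idl_eq_carrier_iff:
  assumes A: "ideal A R" "0 < n" "of_int n \<in> A" and x: "x \<in> \<O>"
  shows "Idl\<^bsub>R\<^esub> (A \<union> {x}) = carrier R \<longleftrightarrow> (\<forall>Q. max_ideal Q \<longrightarrow> A \<subseteq> Q \<longrightarrow> x \<notin> Q)"
proof
  assume eq: "Idl\<^bsub>R\<^esub> (A \<union> {x}) = carrier R"
  show "\<forall>Q. max_ideal Q \<longrightarrow> A \<subseteq> Q \<longrightarrow> x \<notin> Q"
  proof (intro allI impI notI)
    fix Q assume Q: "max_ideal Q" "A \<subseteq> Q" "x \<in> Q"
    then have "Idl\<^bsub>R\<^esub> (A \<union> {x}) \<subseteq> Q" using max_ideal_ideal by (intro R.genideal_minimal) auto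
    then show False using eq max_ideal_1[OF Q(1)] by auto
  qed
next
  assume *: "\<forall>Q. max_ideal Q \<longrightarrow> A \<subseteq> Q \<longrightarrow> x \<notin> Q"
  have sub: "A \<union> {x} \<subseteq> carrier R" using idealD(1)[OF A(1)] x by auto
  have I: "ideal (Idl\<^bsub>R\<^esub> (A \<union> {x})) R" using sub by (rule R.genideal_ideal)
  have self: "A \<union> {x} \<subseteq> Idl\<^bsub>R\<^esub> (A \<union> {x})" using sub by (rule R.genideal_self)
  have "1 \<in> Idl\<^bsub>R\<^esub> (A \<union> {x})"
  proof (rule ccontr)
    assume "1 \<notin> Idl\<^bsub>R\<^esub> (A \<union> {x})"
    then obtain Q where "max_ideal Q" "Idl\<^bsub>R\<^esub> (A \<union> {x}) \<subseteq> Q"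
      using exists_max_ideal[OF I _ A(2)] A(3) self by blast
    then show False using * self by blast
  qed
  then show "Idl\<^bsub>R\<^esub> (A \<union> {x}) = carrier R" using ideal.one_imp_carrier[OF I] by simp
qed

text \<open>A crude bound, showing that gap bounds exist. For each prime divisor of n some residue
  avoids all the ideals over it; the Chinese remainder theorem combines these residues into a class
  modulo n.\<close>

lemma gap_bound_cap:
  assumes \<Q>: "finite \<Q>" "\<And>Q. Q \<in> \<Q> \<Longrightarrow> max_ideal Q" "\<And>Q. Q \<in> \<Q> \<Longrightarrow> of_int n \<in> Q" and n: "0 < n"
  shows "gap_bound (cap \<Q>) (real_of_int n)"
  unfolding gap_bound_def
proof (intro conjI ballI impI allI)
  show "0 \<le> real_of_int n" using n by simp
  fix \<alpha> and c :: real assume \<alpha>: "\<alpha> \<in> \<O>" "admissible (cap \<Q>) \<alpha>"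
  have idA: "ideal (cap \<Q>) R" using \<Q> max_ideal_ideal by (intro ideal_cap) blast
  have nA: "of_int n \<in> cap \<Q>" using \<Q> by (auto simp: cap_def)
  have res: "\<exists>j :: int. \<forall>Q\<in>\<Q>. of_nat p \<in> Q \<longrightarrow> \<alpha> + of_int j \<notin> Q" if "Factorial_Ring.prime (p :: nat)" for p
  proof (cases "p = 2")
    case True then show ?thesis using residue_two[OF \<Q>(2) \<alpha>] by simp
  next
    case False then show ?thesis using residue_odd[OF that False \<alpha>(1)] \<Q>(2) by blast
  qed
  then obtain f :: "nat \<Rightarrow> int" where f: "\<And>p Q. Factorial_Ring.prime p \<Longrightarrow> Q \<in> \<Q> \<Longrightarrow> of_nat p \<in> Q \<Longrightarrow> \<alpha> + of_int (f p) \<notin> Q"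
    by metis
  let ?P = "{p :: nat. Factorial_Ring.prime p \<and> p dvd nat n}"
  have finP: "finite ?P" by (rule finite_subset[of _ "{..nat n}"]) (use n in \<open>auto dest: dvd_imp_le\<close>)
  have "\<exists>x. \<forall>p\<in>?P. [x = nat (f p mod int p)] (mod p)"
    using chinese_remainder_nat[OF finP, of "\<lambda>p. p" "\<lambda>p. nat (f p mod int p)"] primes_coprime by auto
  then obtain x :: nat where x: "\<And>p. p \<in> ?P \<Longrightarrow> [x = nat (f p mod int p)] (mod p)" by blast
  have xf: "\<exists>t. int x = f p + int p * t" if p: "p \<in> ?P" for p
  proof -
    have "0 < p" using p prime_gt_0_nat by auto
    have "[int x = int (nat (f p mod int p))] (mod int p)" by (rule cong_int_iff[THEN iffD2, OF x[OF p]])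
    moreover have "int (nat (f p mod int p)) = f p mod int p" using \<open>0 < p\<close> by simp
    ultimately have "[int x = f p mod int p] (mod int p)" by (simp only:)
    then have "[int x = f p] (mod int p)" by (simp add: cong_def)
    then have "int p dvd int x - f p" by (simp add: cong_iff_dvd_diff)
    then obtain t where "int x - f p = int p * t" by blast
    then have "int x = f p + int p * t" by simp
    then show ?thesis by blast
  qed
  \<comment> \<open>The representative of x modulo n among the n integers starting at the ceiling of
    c.\<close>
  define j where "j = \<lceil>c\<rceil> + ((int x - \<lceil>c\<rceil>) mod n)"
  have jc: "of_int j \<in> {c..c + of_int n}"
  proof -
    have "0 \<le> (int x - \<lceil>c\<rceil>) mod n" "(int x - \<lceil>c\<rceil>) mod n \<le> n - 1" using n by simp_all
    then have "\<lceil>c\<rceil> \<le> j" "j \<le> \<lceil>c\<rceil> + n - 1" by (simp_all add: j_def)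
    then show ?thesis unfolding atLeastAtMost_iff by linarith
  qed
  obtain u where u: "j = int x + n * u"
  proof -
    have "j = int x + n * (- ((int x - \<lceil>c\<rceil>) div n))"
      unfolding j_def by (simp add: minus_div_mult_eq_mod[symmetric] mult.commute)
    then show ?thesis using that by blast
  qed
  have "\<alpha> + of_int j \<notin> Q" if Q: "max_ideal Q" "cap \<Q> \<subseteq> Q" for Q
  proof
    assume in_Q: "\<alpha> + of_int j \<in> Q"
    have Q\<Q>: "Q \<in> \<Q>" using max_ideal_cap_mem[OF \<Q>(1,2) Q] by blast
    note I = idealD[OF max_ideal_ideal[OF Q(1)]]
    have "of_nat (nat n) \<in> Q" using \<Q>(3)[OF Q\<Q>] n by simp
    then obtain p where p: "Factorial_Ring.prime p" "p dvd nat n" "of_nat p \<in> Q"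
      using max_ideal_prime_mem[OF Q(1), of "nat n"] n by auto
    then obtain t where t: "int x = f p + int p * t" using xf by blast
    have "of_int t * of_nat p \<in> Q" "of_int u * of_int n \<in> Q" using I(4) p(3) \<Q>(3)[OF Q\<Q>] by auto
    then have "\<alpha> + of_int j - of_int t * of_nat p - of_int u * of_int n \<in> Q" using in_Q I(7) by blast
    moreover have "\<alpha> + of_int j - of_int t * of_nat p - of_int u * of_int n = \<alpha> + of_int (f p)"
    proof -
      have "j = f p + int p * t + n * u" using u t by simp
      then show ?thesis by (simp add: algebra_simps)
    qed
    ultimately show False using f[OF p(1) Q\<Q> p(3)] by simp
  qed
  then have "Idl\<^bsub>R\<^esub> (cap \<Q> \<union> {\<alpha> + of_int j}) = carrier R"
    using Idl_eq_carrier_iff[OF idA n nA, of "\<alpha> + of_int j"] \<alpha>(1) by blast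
  then show "\<exists>j :: int. of_int j \<in> {c..c + of_int n} \<and> Idl\<^bsub>R\<^esub> (cap \<Q> \<union> {\<alpha> + of_int j}) = carrier R"
    using jc by blast
qed

text \<open>The intersection contains n, so its norm is at most n^2 and the square root of the norm
  is below x.\<close>

lemma gap_bound_cap_max_gap_below:
  assumes \<Q>: "\<And>Q. Q \<in> \<Q> \<Longrightarrow> max_ideal Q \<and> \<not> principal Q \<and> of_int n \<in> Q" and n: "0 < n" "real_of_int n < x"
  shows "finite \<Q>" "gap_bound (cap \<Q>) (max_gap_below R x)"
proof -
  have "\<Q> \<subseteq> {A. ideal A R \<and> of_int n \<in> A}" using \<Q> max_ideal_ideal by blast
  then show fin: "finite \<Q>" using finite_ideals[OF n(1)] finite_subset by blast
  have idA: "ideal (cap \<Q>) R" using \<Q> max_ideal_ideal by (intro ideal_cap) blast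
  have nA: "of_int n \<in> cap \<Q>" using \<Q> by (auto simp: cap_def)
  show "gap_bound (cap \<Q>) (max_gap_below R x)"
  proof (rule gap_bound_max_gap_below[OF idA])
    have "(of_int n :: complex) \<noteq> 0" using n by simp
    then show "cap \<Q> \<noteq> {0}" using nA by blast
    show "\<And>P. primeideal P R \<Longrightarrow> principalideal P R \<Longrightarrow> \<not> ideal_dvd R P (cap \<Q>)"
      using cap_no_principal_prime_divisor[OF fin] \<Q> by blast
    have "real (ideal_norm R (cap \<Q>)) \<le> real (nat n * nat n)"
      using ideal_norm_le(2)[OF idA nA n(1)] by (simp only: of_nat_le_iff)
    then have "real (ideal_norm R (cap \<Q>)) \<le> (real (nat n))\<^sup>2" by (simp add: power2_eq_square)
    then have "sqrt (real (ideal_norm R (cap \<Q>))) \<le> real (nat n)" by (intro real_le_lsqrt) auto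
    then show "sqrt (real (ideal_norm R (cap \<Q>))) < x" using n by simp
    show "gap_bound (cap \<Q>) (real_of_int n)" by (rule gap_bound_cap) (use fin \<Q> n in auto)
  qed
qed

text \<open>For the unit ideal every integer j is allowed, but an interval shorter than 1 may
  contain none. In the theorem this yields that J is at least 1.\<close>

lemma max_gap_below_ge_1:
  assumes "1 < x" shows "1 \<le> max_gap_below R x"
proof -
  have "gap_bound (cap {}) (max_gap_below R x)" using gap_bound_cap_max_gap_below(2)[of "{}" 1] assms by simp
  moreover have "cap {} = \<O>" by (auto simp: cap_def)
  ultimately have g: "gap_bound \<O> (max_gap_below R x)" by simp
  have "\<not> ideal_dvd R (Idl\<^bsub>R\<^esub> {2}) \<O>"
  proof
    assume dvd: "ideal_dvd R (Idl\<^bsub>R\<^esub> {2}) \<O>"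
    have "\<O> \<subseteq> Idl\<^bsub>R\<^esub> {2}" by (rule ideal_dvd_subset[OF R.genideal_ideal dvd]) simp
    then obtain y where y: "y \<in> \<O>" "1 = y * 2" using Idl_singleton[of 2] O_1 by auto
    then have "cmod y * 2 = 1" by (metis norm_mult norm_numeral norm_one)
    then show False using O_norm_ge_1[OF y(1)] y by (cases "y = 0") auto
  qed
  then have "admissible \<O> 0" by (simp add: admissible_def)
  then have "\<exists>j :: int. of_int j \<in> {c..c + max_gap_below R x}" for c
    using g O_0 unfolding gap_bound_def by blast
  \<comment> \<open>The interval is centred at 1 / 2, so a length below 1 keeps it strictly between
    0 and 1.\<close>
  then obtain j :: int where j: "of_int j \<in> {(1 - max_gap_below R x) / 2..(1 - max_gap_below R x) / 2 + max_gap_below R x}"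
    by blast
  show ?thesis
  proof (rule ccontr)
    assume "\<not> ?thesis"
    then have "0 < real_of_int j" "real_of_int j < 1" using j by (auto simp: field_simps)
    then have "0 < j" "j < 1" by simp_all
    then show False by simp
  qed
qed

text \<open>As long as the pair is not coprime, some maximal ideal contains both entries and its
  generator can be divided out. The generator is not a unit, so its squared absolute value is at
  least 2 and the sum of squares decreases.\<close>

lemma primitive_of_principal:
  assumes "c1 \<in> \<O>" "c2 \<in> \<O>" "c1 \<noteq> 0 \<or> c2 \<noteq> 0"
    "\<And>Q. max_ideal Q \<Longrightarrow> c1 \<in> Q \<Longrightarrow> c2 \<in> Q \<Longrightarrow> principal Q"
  shows "\<exists>g d1 d2. g \<in> \<O> \<and> g \<noteq> 0 \<and> d1 \<in> \<O> \<and> d2 \<in> \<O> \<and> c1 = g * d1 \<and> c2 = g * d2 \<and> cop d1 d2"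
  using assms
proof (induction "nat \<lceil>(cmod c1)\<^sup>2 + (cmod c2)\<^sup>2\<rceil>" arbitrary: c1 c2 rule: less_induct)
  case less
  note c = less.prems
  show ?case
  proof (cases "cop c1 c2")
    case True
    then show ?thesis using c by (intro exI[of _ 1] exI[of _ c1] exI[of _ c2]) auto
  next
    case False
    let ?I = "Idl\<^bsub>R\<^esub> {c1, c2}"
    have I: "ideal ?I R" using c by (intro R.genideal_ideal) auto
    have mem: "c1 \<in> ?I" "c2 \<in> ?I" using R.genideal_self[of "{c1, c2}"] c by auto
    have "1 \<notin> ?I" using False Idl_pair_eq_carrier[OF c(1,2)] ideal.one_imp_carrier[OF I] by auto
    moreover obtain n where "0 < n" "of_int n \<in> ?I" using nonzero_ideal_int[OF I] mem c(3) by metis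
    ultimately obtain Q where Q: "max_ideal Q" "?I \<subseteq> Q" using exists_max_ideal[OF I] by blast
    then obtain g where g: "g \<in> \<O>" "Q = {x * g | x. x \<in> \<O>}" using c(4)[OF Q(1)] mem unfolding principal_def by blast
    obtain e1 where e1: "e1 \<in> \<O>" "c1 = e1 * g" using mem Q g by blast
    obtain e2 where e2: "e2 \<in> \<O>" "c2 = e2 * g" using mem Q g by blast
    have g0: "g \<noteq> 0" using e1 e2 c(3) by auto
    obtain n :: int where n: "(cmod g)\<^sup>2 = of_int n" "g * cnj g = of_int n" using norm_O g by blast
    have "n \<noteq> 1"
    proof
      assume "n = 1"
      then have "1 = cnj g * g" using n by (simp add: mult.commute)
      then have "1 \<in> Q" unfolding g(2) using O_cnj[OF g(1)] by blast
      then show False using max_ideal_1[OF Q(1)] by blast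
    qed
    moreover have "1 \<le> n" using O_norm_ge_1[OF g(1) g0] n(1) by (metis of_int_1_le_iff one_le_power)
    ultimately have n2: "2 \<le> (cmod g)\<^sup>2" using n(1) by simp
    define E where "E = (cmod e1)\<^sup>2 + (cmod e2)\<^sup>2"
    have CE: "(cmod c1)\<^sup>2 + (cmod c2)\<^sup>2 = (cmod g)\<^sup>2 * E"
      unfolding e1 e2 E_def by (simp add: norm_mult power_mult_distrib algebra_simps)
    have e0: "e1 \<noteq> 0 \<or> e2 \<noteq> 0" using e1 e2 c(3) by auto
    have "1 \<le> E"
    proof -
      have "1 \<le> (cmod e1)\<^sup>2 \<or> 1 \<le> (cmod e2)\<^sup>2" using e0 O_norm_ge_1 e1(1) e2(1) by (metis one_le_power)
      then show ?thesis unfolding E_def using zero_le_power2[of "cmod e1"] zero_le_power2[of "cmod e2"] by linarith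
    qed
    then have "E + 1 \<le> (cmod g)\<^sup>2 * E" using mult_right_mono[OF n2, of E] by linarith
    then have "nat \<lceil>E\<rceil> < nat \<lceil>(cmod c1)\<^sup>2 + (cmod c2)\<^sup>2\<rceil>" unfolding CE using \<open>1 \<le> E\<close> by linarith
    moreover have "principal P" if "max_ideal P" "e1 \<in> P" "e2 \<in> P" for P
      using that c(4)[of P] e1 e2 g(1) idealD(5)[OF max_ideal_ideal[OF that(1)]] by blast
    ultimately obtain h d1 d2 where h: "h \<in> \<O>" "h \<noteq> 0" "d1 \<in> \<O>" "d2 \<in> \<O>" "e1 = h * d1" "e2 = h * d2" "cop d1 d2"
      using less.hyps[of e1 e2] e1 e2 e0 unfolding E_def by blast
    then show ?thesis using e1 e2 g g0 by (intro exI[of _ "g * h"] exI[of _ d1] exI[of _ d2]) auto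
  qed
qed

end

section \<open>The upper bound\<close>

text \<open>Gauss reduction with Hermite's constant: in a planar lattice of covolume |A| a shortest
  vector F has |F|^2 at most 2 |A| / sqrt 3. It is primitive and hence belongs to a basis.\<close>

lemma planar_lattice_reduction:
  fixes e1 e2 :: complex
  assumes A: "Im (cnj e1 * e2) \<noteq> 0"
  shows "\<exists>\<alpha> \<beta> \<gamma> \<delta> :: int. \<alpha> * \<delta> - \<beta> * \<gamma> = 1 \<and>
    3 * (cmod (of_int \<alpha> * e1 + of_int \<beta> * e2)) ^ 4 \<le> 4 * (Im (cnj e1 * e2))\<^sup>2"
proof -
  define A where "A = Im (cnj e1 * e2)"
  have A0: "A \<noteq> 0" using A by (simp add: A_def)
  define f where "f = (\<lambda>(\<alpha>, \<beta>). of_int \<alpha> * e1 + of_int \<beta> * e2)"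
  have f1: "Im (cnj (f (\<alpha>, \<beta>)) * e2) = of_int \<alpha> * A" and f2: "Im (cnj e1 * f (\<alpha>, \<beta>)) = of_int \<beta> * A" for \<alpha> \<beta>
    by (simp_all add: f_def A_def algebra_simps)
  have f0: "f (\<alpha>, \<beta>) \<noteq> 0" if "(\<alpha>, \<beta>) \<noteq> (0, 0)" for \<alpha> \<beta>
    using that f1[of \<alpha> \<beta>] f2[of \<alpha> \<beta>] A0 by auto
  define S where "S = {p. p \<noteq> (0, 0) \<and> cmod (f p) \<le> cmod e1}"
  define B where "B = \<lceil>cmod e1 * (cmod e1 + cmod e2) / \<bar>A\<bar>\<rceil>"
  have "S \<subseteq> {-B..B} \<times> {-B..B}"
  proof
    fix p assume p: "p \<in> S"
    obtain \<alpha> \<beta> where p_eq: "p = (\<alpha>, \<beta>)" by (cases p)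
    have le: "cmod (f p) \<le> cmod e1" using p by (simp add: S_def)
    have bound: "\<bar>k\<bar> \<le> B" if "\<bar>of_int k * A\<bar> \<le> cmod e1 * (cmod e1 + cmod e2)" for k
    proof -
      have "\<bar>real_of_int k\<bar> \<le> cmod e1 * (cmod e1 + cmod e2) / \<bar>A\<bar>" using that A0 by (simp add: abs_mult field_simps)
      then show ?thesis unfolding B_def by linarith
    qed
    have "\<bar>of_int \<alpha> * A\<bar> \<le> cmod (cnj (f p) * e2)" unfolding p_eq f1[of \<alpha> \<beta>, symmetric] by (rule abs_Im_le_cmod)
    also have "\<dots> \<le> cmod e1 * (cmod e1 + cmod e2)" using le by (simp add: norm_mult) (intro mult_mono; simp)
    finally have 1: "\<bar>\<alpha>\<bar> \<le> B" by (rule bound)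
    have "\<bar>of_int \<beta> * A\<bar> \<le> cmod (cnj e1 * f p)" unfolding p_eq f2[of \<alpha> \<beta>, symmetric] by (rule abs_Im_le_cmod)
    also have "\<dots> \<le> cmod e1 * (cmod e1 + cmod e2)"
    proof -
      have "cmod (f p) \<le> cmod e1 + cmod e2" using le norm_ge_zero[of e2] by linarith
      then show ?thesis unfolding norm_mult complex_mod_cnj by (rule mult_left_mono) simp
    qed
    finally have 2: "\<bar>\<beta>\<bar> \<le> B" by (rule bound)
    show "p \<in> {-B..B} \<times> {-B..B}" using 1 2 by (auto simp: p_eq abs_le_iff)
  qed
  then have "finite S" by (rule finite_subset) auto
  moreover have "(1, 0) \<in> S" by (simp add: S_def f_def)
  then have "S \<noteq> {}" by blast
  ultimately obtain p where p: "p \<in> S" and pmin: "\<And>p'. p' \<in> S \<Longrightarrow> cmod (f p) \<le> cmod (f p')"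
    using ex_min_image[of S "\<lambda>p. cmod (f p)"] by blast
  have minimal: "cmod (f p) \<le> cmod (f p')" if "p' \<noteq> (0, 0)" for p'
    using pmin[of p'] that p by (cases "p' \<in> S") (auto simp: S_def)
  obtain \<alpha> \<beta> where p_eq: "p = (\<alpha>, \<beta>)" by (cases p)
  have ab: "(\<alpha>, \<beta>) \<noteq> (0, 0)" using p by (simp add: S_def p_eq)
  define F where "F = f (\<alpha>, \<beta>)"
  have F0: "0 < cmod F" using f0[OF ab] by (simp add: F_def)
  define g where "g = gcd \<alpha> \<beta>"
  obtain a' b' where gab: "\<alpha> = g * a'" "\<beta> = g * b'" by (metis g_def gcd_dvd1 gcd_dvd2 dvdE)
  have "g = 1"
  proof (rule ccontr)
    assume "g \<noteq> 1"
    have "g \<noteq> 0" "0 \<le> g" using ab by (auto simp: g_def)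
    then have g2: "2 \<le> real_of_int g" using \<open>g \<noteq> 1\<close> by simp
    have "(a', b') \<noteq> (0, 0)" using ab gab by auto
    then have "cmod F \<le> cmod (f (a', b'))" using minimal p_eq F_def by simp
    moreover have "F = of_int g * f (a', b')" unfolding F_def gab by (simp add: f_def algebra_simps)
    then have "cmod F = g * cmod (f (a', b'))" using \<open>0 \<le> g\<close> by (simp add: norm_mult)
    ultimately have "g * cmod (f (a', b')) \<le> 1 * cmod (f (a', b'))" by simp
    moreover have "0 < cmod (f (a', b'))" using F0 \<open>cmod F \<le> _\<close> by linarith
    ultimately show False using g2 by simp
  qed
  then obtain \<delta> \<gamma>' where bez: "\<delta> * \<alpha> + \<gamma>' * \<beta> = 1" by (metis bezout_int g_def)
  define \<gamma> where "\<gamma> = - \<gamma>'"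
  have det: "\<alpha> * \<delta> - \<beta> * \<gamma> = 1" using bez by (simp add: \<gamma>_def algebra_simps)
  define H where "H = f (\<gamma>, \<delta>)"
  have "Im (cnj F * H) = of_int (\<alpha> * \<delta> - \<beta> * \<gamma>) * A" unfolding F_def H_def f_def A_def by (simp add: algebra_simps)
  then have FH: "Im (cnj F * H) = A" by (simp add: det)
  define c where "c = Re (cnj F * H) / (cmod F)\<^sup>2"
  \<comment> \<open>Adding k F brings the component of H along F to at most half of F, while the
    result is still no shorter than F.\<close>
  define k where "k = round (- c)"
  have ck: "\<bar>c + of_int k\<bar> \<le> 1 / 2" unfolding k_def using of_int_round_abs_le[of "- c"] by linarith
  define H' where "H' = f (\<gamma> + k * \<alpha>, \<delta> + k * \<beta>)"
  have H': "H' = H + of_int k * F" unfolding H'_def H_def F_def f_def by (simp add: algebra_simps)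
  have "(\<gamma> + k * \<alpha>, \<delta> + k * \<beta>) \<noteq> (0, 0)"
  proof
    assume "(\<gamma> + k * \<alpha>, \<delta> + k * \<beta>) = (0, 0)"
    then have "\<gamma> = - k * \<alpha>" "\<delta> = - k * \<beta>" by auto
    then have "\<alpha> * \<delta> - \<beta> * \<gamma> = 0" by simp
    then show False using det by simp
  qed
  then have FH': "cmod F \<le> cmod H'" using minimal p_eq F_def H'_def by simp
  have FF: "cnj F * F = of_real ((cmod F)\<^sup>2)" unfolding complex_norm_square by (rule mult.commute)
  have prod: "cnj F * H' = cnj F * H + of_int k * of_real ((cmod F)\<^sup>2)" unfolding H' FF[symmetric] by (simp add: algebra_simps)
  have "Re (cnj F * H') = (cmod F)\<^sup>2 * (c + k)" "Im (cnj F * H') = A"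
    unfolding prod using F0 FH by (simp_all add: c_def algebra_simps)
  then have "(cmod (cnj F * H'))\<^sup>2 = (cmod F) ^ 4 * (c + k)\<^sup>2 + A\<^sup>2"
    unfolding cmod_power2[of "cnj F * H'"] by (simp add: power_mult_distrib)
  then have "(cmod F)\<^sup>2 * (cmod H')\<^sup>2 = (cmod F) ^ 4 * (c + k)\<^sup>2 + A\<^sup>2"
    by (simp add: norm_mult power_mult_distrib)
  moreover have "(cmod F) ^ 4 \<le> (cmod F)\<^sup>2 * (cmod H')\<^sup>2"
  proof -
    have "(cmod F)\<^sup>2 * (cmod F)\<^sup>2 \<le> (cmod F)\<^sup>2 * (cmod H')\<^sup>2"
      using FH' by (intro mult_left_mono power_mono) auto
    then show ?thesis by (simp flip: power_add)
  qed
  moreover have "(c + k)\<^sup>2 \<le> 1 / 4"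
    using power_mono[OF ck, of 2] by (simp add: power_divide)
  then have "(cmod F) ^ 4 * (c + k)\<^sup>2 \<le> (cmod F) ^ 4 * (1 / 4)" by (intro mult_left_mono) auto
  ultimately have "3 * (cmod F) ^ 4 \<le> 4 * A\<^sup>2" by linarith
  then show ?thesis using det unfolding F_def f_def A_def by auto
qed

section \<open>Choosing integers by the gap condition\<close>

context imag_quad_field
begin

lemma sieve_shift:
  assumes \<Q>: "\<And>Q. Q \<in> \<Q> \<Longrightarrow> max_ideal Q \<and> \<not> principal Q \<and> of_int n \<in> Q" and n: "0 < n" "real_of_int n < x"
    and J: "max_gap_below R x \<le> J" and \<alpha>: "\<alpha> \<in> \<O>" "admissible (cap \<Q>) \<alpha>"
  shows "\<exists>j :: int. \<bar>y + of_int j\<bar> \<le> J / 2 \<and> (\<forall>Q\<in>\<Q>. \<alpha> + of_int j \<notin> Q)"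
proof -
  have "gap_bound (cap \<Q>) J" using gap_bound_cap_max_gap_below(2)[OF \<Q> n] J gap_bound_mono by blast
  then obtain j :: int where j: "of_int j \<in> {- y - J / 2..- y - J / 2 + J}"
    "Idl\<^bsub>R\<^esub> (cap \<Q> \<union> {\<alpha> + of_int j}) = carrier R"
    using \<alpha> unfolding gap_bound_def by blast
  have idA: "ideal (cap \<Q>) R" using \<Q> max_ideal_ideal by (intro ideal_cap) blast
  have nA: "of_int n \<in> cap \<Q>" using \<Q> by (auto simp: cap_def)
  have "\<alpha> + of_int j \<notin> Q" if "Q \<in> \<Q>" for Q
  proof -
    have "cap \<Q> \<subseteq> Q" using that by (auto simp: cap_def)
    then show ?thesis using Idl_eq_carrier_iff[OF idA n(1) nA, of "\<alpha> + of_int j"] \<alpha>(1) j(2) \<Q>[OF that] by blast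
  qed
  moreover have "\<bar>y + of_int j\<bar> \<le> J / 2" using j(1) unfolding atLeastAtMost_iff by linarith
  ultimately show ?thesis by blast
qed

text \<open>The maximal ideals containing the intersection are members of the family, and none
  contains both entries of v. The coefficients (r, s) define a functional taking v to 1 modulo each
  member, which turns conditions on pairs into conditions on single elements.\<close>

lemma cap_bezout:
  assumes \<Q>: "finite \<Q>" "\<And>Q. Q \<in> \<Q> \<Longrightarrow> max_ideal Q \<and> of_int n \<in> Q" and n: "0 < n"
    and v: "v1 \<in> \<O>" "v2 \<in> \<O>" "\<And>Q. Q \<in> \<Q> \<Longrightarrow> \<not> (v1 \<in> Q \<and> v2 \<in> Q)"
  obtains r s a where "r \<in> \<O>" "s \<in> \<O>" "a \<in> cap \<Q>" "r * v1 + s * v2 = 1 - a"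
proof -
  have idA: "ideal (cap \<Q>) R" using \<Q> max_ideal_ideal by (intro ideal_cap) blast
  have nA: "of_int n \<in> cap \<Q>" using \<Q> by (auto simp: cap_def)
  define I1 where "I1 = {a + y * v1 | a y. a \<in> cap \<Q> \<and> y \<in> \<O>}"
  define I2 where "I2 = {a + y * v2 | a y. a \<in> I1 \<and> y \<in> \<O>}"
  have I1: "ideal I1 R" unfolding I1_def using idA v(1) by (rule ideal_adjoin)
  have I2: "ideal I2 R" unfolding I2_def using I1 v(2) by (rule ideal_adjoin)
  have sub1: "cap \<Q> \<subseteq> I1"
  proof
    fix x assume "x \<in> cap \<Q>"
    moreover have "x = x + 0 * v1" by simp
    ultimately show "x \<in> I1" unfolding I1_def using O_0 by blast
  qed
  have sub2: "I1 \<subseteq> I2"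
  proof
    fix x assume "x \<in> I1"
    moreover have "x = x + 0 * v2" by simp
    ultimately show "x \<in> I2" unfolding I2_def using O_0 by blast
  qed
  have "v1 = 0 + 1 * v1" by simp
  then have "v1 \<in> I1" unfolding I1_def using idealD(2)[OF idA] O_1 by blast
  have "v2 = 0 + 1 * v2" by simp
  then have "v2 \<in> I2" unfolding I2_def using idealD(2)[OF I1] O_1 by blast
  have "1 \<in> I2"
  proof (rule ccontr)
    assume "1 \<notin> I2"
    then obtain Q where Q: "max_ideal Q" "I2 \<subseteq> Q"
      using exists_max_ideal[OF I2 _ n] nA sub1 sub2 by blast
    then have "Q \<in> \<Q>" using max_ideal_cap_mem[OF \<Q>(1)] \<Q>(2) sub1 sub2 by blast
    then show False using v(3) Q \<open>v1 \<in> I1\<close> \<open>v2 \<in> I2\<close> sub2 by blast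
  qed
  then obtain a r s where "a \<in> cap \<Q>" "r \<in> \<O>" "s \<in> \<O>" "1 = (a + r * v1) + s * v2"
    unfolding I2_def I1_def by blast
  then show ?thesis using that[of r s a] by (simp add: algebra_simps)
qed

text \<open>Taking the determinant with v, a maximal ideal containing both entries of \<epsilon> w +
  j v contains \<epsilon> e. The functional of \<open>cap_bezout\<close> takes v to 1 and w to
  \<alpha>, so it suffices that \<epsilon> \<alpha> + j avoids the ideals in \<open>\<Q>\<close>. If
  \<alpha> is excluded from the gap condition, w is doubled, and 2 \<alpha> is then admissible. In
  that case (2) divides the intersection, which makes e even and r v1 + s v2 congruent to 1 modulo
  2; \<open>no_half\<close> will contradict this.\<close>

lemma sieve_determinant:
  assumes vw: "v1 \<in> \<O>" "v2 \<in> \<O>" "w1 \<in> \<O>" "w2 \<in> \<O>" "v1 * w2 - v2 * w1 = of_int e" "e \<noteq> 0"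
    and e: "\<bar>real_of_int e\<bar> < x" and J: "max_gap_below R x \<le> J"
    and common: "\<And>Q. max_ideal Q \<Longrightarrow> \<not> (v1 \<in> Q \<and> v2 \<in> Q \<and> w1 \<in> Q \<and> w2 \<in> Q)"
  shows "\<exists>\<epsilon> :: int. (\<epsilon> = 1 \<or> \<epsilon> = 2 \<and> even e \<and> (\<exists>r\<in>\<O>. \<exists>s\<in>\<O>. \<exists>b\<in>\<O>. r * v1 + s * v2 = 1 - b * 2)) \<and>
    (\<forall>y. \<exists>j :: int. \<bar>y + of_int j\<bar> \<le> J / 2 \<and>
      (\<forall>Q. max_ideal Q \<longrightarrow> of_int \<epsilon> * w1 + of_int j * v1 \<in> Q \<longrightarrow> of_int \<epsilon> * w2 + of_int j * v2 \<in> Q \<longrightarrow> principal Q))"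
proof -
  define n where "n = \<bar>e\<bar>"
  have n: "0 < n" "real_of_int n < x" using vw e by (simp_all add: n_def)
  define \<Q> where "\<Q> = {Q. max_ideal Q \<and> \<not> principal Q \<and> of_int n \<in> Q \<and> \<not> (v1 \<in> Q \<and> v2 \<in> Q)}"
  have \<Q>: "max_ideal Q \<and> \<not> principal Q \<and> of_int n \<in> Q" if "Q \<in> \<Q>" for Q using that by (auto simp: \<Q>_def)
  have fin: "finite \<Q>" by (rule gap_bound_cap_max_gap_below(1)[OF \<Q> n])
  have \<Q>1: "max_ideal Q \<and> of_int n \<in> Q" and \<Q>2: "\<not> (v1 \<in> Q \<and> v2 \<in> Q)" if "Q \<in> \<Q>" for Q
    using that unfolding \<Q>_def by blast+
  obtain r s a where rsa: "r \<in> \<O>" "s \<in> \<O>" "a \<in> cap \<Q>" "r * v1 + s * v2 = 1 - a"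
    by (rule cap_bezout[OF fin \<Q>1 n(1) vw(1,2) \<Q>2])
  define \<alpha> where "\<alpha> = r * w1 + s * w2"
  have \<alpha>: "\<alpha> \<in> \<O>" using rsa vw by (simp add: \<alpha>_def)
  have n_mem: "of_int n \<in> Q \<longleftrightarrow> of_int e \<in> Q" if "ideal Q R" for Q
    using idealD(6)[OF that, of "of_int e"] idealD(6)[OF that, of "- of_int e"]
    by (cases "0 \<le> e") (auto simp: n_def)
  have main: "\<alpha>' + of_int j \<in> Q"
    if Q: "Q \<in> \<Q>" and c: "of_int \<epsilon> * w1 + of_int j * v1 \<in> Q" "of_int \<epsilon> * w2 + of_int j * v2 \<in> Q"
      and \<alpha>': "\<alpha>' = of_int \<epsilon> * \<alpha>" for Q j \<alpha>' \<epsilon>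
  proof -
    note I = idealD[OF max_ideal_ideal]
    have mQ: "max_ideal Q" using \<Q>[OF Q] by blast
    have "a \<in> Q" using rsa(3) Q by (simp add: cap_def)
    have "r * (of_int \<epsilon> * w1 + of_int j * v1) + s * (of_int \<epsilon> * w2 + of_int j * v2) + of_int j * a \<in> Q"
      by (rule I(3)[OF mQ I(3)[OF mQ I(4)[OF mQ c(1) rsa(1)] I(4)[OF mQ c(2) rsa(2)]] I(4)[OF mQ \<open>a \<in> Q\<close> O_int]])
    also have "r * (of_int \<epsilon> * w1 + of_int j * v1) + s * (of_int \<epsilon> * w2 + of_int j * v2) + of_int j * a
        = of_int \<epsilon> * \<alpha> + of_int j * (r * v1 + s * v2 + a)" by (simp add: \<alpha>_def algebra_simps)
    finally show ?thesis using rsa(4) \<alpha>' by simp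
  qed
  show ?thesis
  proof (cases "admissible (cap \<Q>) \<alpha>")
    case True
    have "\<exists>j :: int. \<bar>y + of_int j\<bar> \<le> J / 2 \<and> (\<forall>Q. max_ideal Q \<longrightarrow> of_int 1 * w1 + of_int j * v1 \<in> Q \<longrightarrow>
      of_int 1 * w2 + of_int j * v2 \<in> Q \<longrightarrow> principal Q)" for y
    proof -
      obtain j :: int where j: "\<bar>y + of_int j\<bar> \<le> J / 2" "\<And>Q. Q \<in> \<Q> \<Longrightarrow> \<alpha> + of_int j \<notin> Q"
        using sieve_shift[OF \<Q> n J \<alpha> True] by blast
      have "principal Q" if Q: "max_ideal Q" "of_int 1 * w1 + of_int j * v1 \<in> Q" "of_int 1 * w2 + of_int j * v2 \<in> Q" for Q
      proof (rule ccontr)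
        assume np: "\<not> principal Q"
        note I = idealD[OF max_ideal_ideal[OF Q(1)]]
        show False
        proof (cases "v1 \<in> Q \<and> v2 \<in> Q")
          case True
          then have "of_int 1 * w1 + of_int j * v1 - of_int j * v1 \<in> Q" "of_int 1 * w2 + of_int j * v2 - of_int j * v2 \<in> Q"
            using I(7)[OF Q(2) I(4)[OF _ O_int]] I(7)[OF Q(3) I(4)[OF _ O_int]] by blast+
          then show False using common Q True by simp
        next
          case False
          have "v1 * (of_int 1 * w2 + of_int j * v2) - v2 * (of_int 1 * w1 + of_int j * v1) \<in> Q"
            using Q vw by (intro I(4,7)) auto
          moreover have "v1 * (of_int 1 * w2 + of_int j * v2) - v2 * (of_int 1 * w1 + of_int j * v1) = of_int e"
            using vw(5) by (simp add: algebra_simps)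
          ultimately have "Q \<in> \<Q>" using n_mem[OF max_ideal_ideal[OF Q(1)]] Q np False by (simp add: \<Q>_def)
          then show False using main[OF _ Q(2,3), of \<alpha>] j(2) by simp
        qed
      qed
      then show ?thesis using j by blast
    qed
    then show ?thesis by (intro exI[of _ 1]) blast
  next
    case False
    then have dvd: "ideal_dvd R (Idl\<^bsub>R\<^esub> {2}) (cap \<Q>)" by (simp add: admissible_def)
    have Idl2: "ideal (Idl\<^bsub>R\<^esub> {2}) R" by (rule R.genideal_ideal) simp
    have sub2: "\<exists>b\<in>\<O>. c = b * 2" if "c \<in> cap \<Q>" for c
      using ideal_dvd_subset[OF Idl2 dvd] that Idl_singleton[of 2] by auto
    \<comment> \<open>This ideal is just (2). If it were prime, it would be a principal prime
      dividing an intersection of nonprincipal maximal ideals.\<close>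
    have "\<not> primeideal (Idl\<^bsub>R\<^esub> {2, 2 * \<alpha>}) R"
    proof
      assume prime: "primeideal (Idl\<^bsub>R\<^esub> {2, 2 * \<alpha>}) R"
      have "Idl\<^bsub>R\<^esub> {2, 2 * \<alpha>} = Idl\<^bsub>R\<^esub> {2}"
      proof
        have 2: "2 \<in> Idl\<^bsub>R\<^esub> {2}" by (rule R.genideal_self') simp
        then have "2 * \<alpha> \<in> Idl\<^bsub>R\<^esub> {2}" using idealD(5)[OF Idl2] \<alpha> by blast
        then show "Idl\<^bsub>R\<^esub> {2, 2 * \<alpha>} \<subseteq> Idl\<^bsub>R\<^esub> {2}" using 2 Idl2 by (intro R.genideal_minimal) auto
        show "Idl\<^bsub>R\<^esub> {2} \<subseteq> Idl\<^bsub>R\<^esub> {2, 2 * \<alpha>}"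
          using R.genideal_self[of "{2, 2 * \<alpha>}"] \<alpha> by (intro R.genideal_minimal R.genideal_ideal) auto
      qed
      then have "primeideal (Idl\<^bsub>R\<^esub> {2}) R" using prime by simp
      moreover have "principalideal (Idl\<^bsub>R\<^esub> {2}) R"
        by (rule principalidealI[OF Idl2]) (auto intro!: bexI[of _ 2])
      ultimately show False using cap_no_principal_prime_divisor[OF fin] \<Q> dvd by blast
    qed
    then have adm: "admissible (cap \<Q>) (2 * \<alpha>)" by (simp add: admissible_def)
    \<comment> \<open>The intersection is contained in (2), so the extra factor 2 of the determinant
      brings in no new maximal ideals.\<close>
    have two_mem: "Q \<in> \<Q>" if "max_ideal Q" "2 \<in> Q" for Q
    proof (rule max_ideal_cap_mem[OF fin])
      show "cap \<Q> \<subseteq> Q"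
      proof
        fix c assume "c \<in> cap \<Q>"
        then obtain b where "b \<in> \<O>" "c = b * 2" using sub2 by blast
        then show "c \<in> Q" using idealD(4)[OF max_ideal_ideal] that by blast
      qed
    qed (use \<Q> that in auto)
    have "\<exists>j :: int. \<bar>y + of_int j\<bar> \<le> J / 2 \<and> (\<forall>Q. max_ideal Q \<longrightarrow> of_int 2 * w1 + of_int j * v1 \<in> Q \<longrightarrow>
      of_int 2 * w2 + of_int j * v2 \<in> Q \<longrightarrow> principal Q)" for y
    proof -
      have "2 * \<alpha> \<in> \<O>" using \<alpha> by simp
      then obtain j :: int where j: "\<bar>y + of_int j\<bar> \<le> J / 2" "\<And>Q. Q \<in> \<Q> \<Longrightarrow> 2 * \<alpha> + of_int j \<notin> Q"
        using sieve_shift[OF \<Q> n J _ adm] by blast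
      have "principal Q" if Q: "max_ideal Q" "of_int 2 * w1 + of_int j * v1 \<in> Q" "of_int 2 * w2 + of_int j * v2 \<in> Q" for Q
      proof (rule ccontr)
        assume np: "\<not> principal Q"
        note I = idealD[OF max_ideal_ideal[OF Q(1)]]
        have "Q \<in> \<Q>"
        proof (cases "v1 \<in> Q \<and> v2 \<in> Q")
          case True
          then have "of_int 2 * w1 + of_int j * v1 - of_int j * v1 \<in> Q" "of_int 2 * w2 + of_int j * v2 - of_int j * v2 \<in> Q"
            using I(7)[OF Q(2) I(4)[OF _ O_int]] I(7)[OF Q(3) I(4)[OF _ O_int]] by blast+
          then have "2 * w1 \<in> Q" "2 * w2 \<in> Q" by simp_all
          then have "2 \<in> Q" using common Q(1) True max_ideal_prime[OF Q(1)] vw O_numeral by metis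
          then show ?thesis using two_mem Q by blast
        next
          case False
          have "v1 * (of_int 2 * w2 + of_int j * v2) - v2 * (of_int 2 * w1 + of_int j * v1) \<in> Q"
            using Q vw by (intro I(4,7)) auto
          moreover have "v1 * (of_int 2 * w2 + of_int j * v2) - v2 * (of_int 2 * w1 + of_int j * v1) = 2 * (v1 * w2 - v2 * w1)"
            by (simp add: algebra_simps)
          ultimately have "2 * of_int e \<in> Q" using vw(5) by simp
          then have "2 \<in> Q \<or> of_int e \<in> Q" using max_ideal_prime[OF Q(1)] by simp
          then show ?thesis
          proof
            assume "2 \<in> Q" then show ?thesis using two_mem Q by blast
          next
            assume "of_int e \<in> Q"
            then show ?thesis using n_mem[OF max_ideal_ideal[OF Q(1)]] Q np False by (simp add: \<Q>_def)
          qed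
        qed
        then show False using main[OF _ Q(2,3), of "2 * \<alpha>"] j(2) by simp
      qed
      then show ?thesis using j by blast
    qed
    moreover have "even e"
    proof -
      have "of_int n \<in> cap \<Q>" using \<Q> by (auto simp: cap_def)
      then obtain b where b: "b \<in> \<O>" "of_int n = b * 2" using sub2 by blast
      have "Im b = 0" using arg_cong[OF b(2), of Im] by simp
      then obtain k where "b = of_int k" using O_real b(1) by blast
      then have "of_int n = (of_int (k * 2) :: complex)" using b by simp
      then have "n = k * 2" by (simp only: of_int_eq_iff)
      then show ?thesis unfolding n_def by (metis dvd_abs_iff dvd_triv_right)
    qed
    moreover obtain b where "b \<in> \<O>" "a = b * 2" using sub2 rsa(3) by blast
    ultimately show ?thesis using rsa by (intro exI[of _ 2]) blast
  qed
qed

lemma sieve_common: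
  assumes vwu: "v1 \<in> \<O>" "v2 \<in> \<O>" "w1 \<in> \<O>" "w2 \<in> \<O>" "u1 \<in> \<O>" "u2 \<in> \<O>"
    and n: "0 < n" "real_of_int n < x" "\<exists>r\<in>\<O>. \<exists>s\<in>\<O>. of_int n = r * v1 + s * v2"
    and J: "max_gap_below R x \<le> J"
    and np: "\<And>Q. max_ideal Q \<Longrightarrow> v1 \<in> Q \<Longrightarrow> v2 \<in> Q \<Longrightarrow> \<not> principal Q"
    and two: "\<not> (\<exists>a\<in>\<O>. \<exists>b\<in>\<O>. v1 = a * 2 \<and> v2 = b * 2)"
    and common: "\<And>Q. max_ideal Q \<Longrightarrow> v1 \<in> Q \<Longrightarrow> v2 \<in> Q \<Longrightarrow> w1 \<in> Q \<Longrightarrow> w2 \<in> Q \<Longrightarrow> \<not> (u1 \<in> Q \<and> u2 \<in> Q)"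
  shows "\<exists>i :: int. \<bar>y + of_int i\<bar> \<le> J / 2 \<and> (\<forall>Q. max_ideal Q \<longrightarrow>
    \<not> (v1 \<in> Q \<and> v2 \<in> Q \<and> u1 + of_int i * w1 \<in> Q \<and> u2 + of_int i * w2 \<in> Q))"
proof -
  define \<Q> where "\<Q> = {Q. max_ideal Q \<and> v1 \<in> Q \<and> v2 \<in> Q \<and> \<not> (w1 \<in> Q \<and> w2 \<in> Q)}"
  have \<Q>: "max_ideal Q \<and> \<not> principal Q \<and> of_int n \<in> Q" if "Q \<in> \<Q>" for Q
  proof -
    have Q: "max_ideal Q" "v1 \<in> Q" "v2 \<in> Q" using that by (auto simp: \<Q>_def)
    then have "of_int n \<in> Q" using n(3) idealD(3,4)[OF max_ideal_ideal[OF Q(1)]] by metis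
    then show ?thesis using Q np by blast
  qed
  have fin: "finite \<Q>" by (rule gap_bound_cap_max_gap_below(1)[OF \<Q> n(1,2)])
  have \<Q>1: "max_ideal Q \<and> of_int n \<in> Q" and \<Q>2: "\<not> (w1 \<in> Q \<and> w2 \<in> Q)" if "Q \<in> \<Q>" for Q
    using \<Q>[OF that] that unfolding \<Q>_def by blast+
  obtain r s a where rsa: "r \<in> \<O>" "s \<in> \<O>" "a \<in> cap \<Q>" "r * w1 + s * w2 = 1 - a"
    by (rule cap_bezout[OF fin \<Q>1 n(1) vwu(3,4) \<Q>2])
  define \<alpha> where "\<alpha> = r * u1 + s * u2"
  have \<alpha>: "\<alpha> \<in> \<O>" using rsa vwu by (simp add: \<alpha>_def)
  have "\<not> ideal_dvd R (Idl\<^bsub>R\<^esub> {2}) (cap \<Q>)"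
  proof
    assume dvd: "ideal_dvd R (Idl\<^bsub>R\<^esub> {2}) (cap \<Q>)"
    have Idl2: "ideal (Idl\<^bsub>R\<^esub> {2}) R" by (rule R.genideal_ideal) simp
    have "v1 \<in> cap \<Q>" "v2 \<in> cap \<Q>" using vwu by (auto simp: cap_def \<Q>_def)
    then have "v1 \<in> Idl\<^bsub>R\<^esub> {2}" "v2 \<in> Idl\<^bsub>R\<^esub> {2}" using ideal_dvd_subset[OF Idl2 dvd] by auto
    then show False using two Idl_singleton[of 2] by auto
  qed
  then have adm: "admissible (cap \<Q>) \<alpha>" by (simp add: admissible_def)
  obtain i :: int where i: "\<bar>y + of_int i\<bar> \<le> J / 2" "\<And>Q. Q \<in> \<Q> \<Longrightarrow> \<alpha> + of_int i \<notin> Q"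
    using sieve_shift[OF \<Q> n(1,2) J \<alpha> adm] by blast
  have "\<not> (v1 \<in> Q \<and> v2 \<in> Q \<and> u1 + of_int i * w1 \<in> Q \<and> u2 + of_int i * w2 \<in> Q)" if Q: "max_ideal Q" for Q
  proof
    note I = idealD[OF max_ideal_ideal[OF Q]]
    assume *: "v1 \<in> Q \<and> v2 \<in> Q \<and> u1 + of_int i * w1 \<in> Q \<and> u2 + of_int i * w2 \<in> Q"
    show False
    proof (cases "w1 \<in> Q \<and> w2 \<in> Q")
      case True
      then have "u1 + of_int i * w1 - of_int i * w1 \<in> Q" "u2 + of_int i * w2 - of_int i * w2 \<in> Q"
        using I(7)[OF _ I(4)[OF _ O_int]] * by blast+
      then show False using common Q * True by simp
    next
      case False
      then have Q\<Q>: "Q \<in> \<Q>" using * Q by (simp add: \<Q>_def)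
      then have "a \<in> Q" using rsa(3) by (simp add: cap_def)
      have "r * (u1 + of_int i * w1) + s * (u2 + of_int i * w2) + of_int i * a \<in> Q"
        using I(3)[OF I(3)[OF I(4)[OF _ rsa(1)] I(4)[OF _ rsa(2)]] I(4)[OF \<open>a \<in> Q\<close> O_int]] * by blast
      also have "r * (u1 + of_int i * w1) + s * (u2 + of_int i * w2) + of_int i * a
        = \<alpha> + of_int i * (r * w1 + s * w2 + a)" by (simp add: \<alpha>_def algebra_simps)
      finally show False using rsa(4) i(2)[OF Q\<Q>] by simp
    qed
  qed
  then show ?thesis using i by blast
qed

section \<open>The ideal of a primitive vector and its inverse\<close>

lemma O_coords_unique:
  assumes "of_int a + of_int b * \<omega> = of_int c + of_int d * \<omega>"
  shows "a = c" "b = d"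
proof -
  show "b = d" using arg_cong[OF assms, of Im] Im_omega by simp
  then show "a = c" using assms by simp
qed

lemma int_subgroup_generator:
  fixes S :: "int set"
  assumes "k \<in> S" "0 < k" and mod: "\<And>x y q. x \<in> S \<Longrightarrow> y \<in> S \<Longrightarrow> x - q * y \<in> S"
  obtains n where "0 < n" "n \<in> S" "\<And>x. x \<in> S \<Longrightarrow> n dvd x"
proof -
  define m where "m = (LEAST m :: nat. 0 < m \<and> int m \<in> S)"
  have "0 < nat k \<and> int (nat k) \<in> S" using assms by simp
  then have m: "0 < m \<and> int m \<in> S" unfolding m_def by (rule LeastI)
  have "int m dvd x" if x: "x \<in> S" for x
  proof (rule ccontr)
    assume "\<not> int m dvd x"
    then have "x mod int m \<noteq> 0" by (simp add: dvd_eq_mod_eq_0)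
    moreover have bnd: "0 \<le> x mod int m" "x mod int m < int m" using m by simp_all
    moreover have "x mod int m = x - (x div int m) * int m" by (simp add: minus_div_mult_eq_mod)
    then have "x mod int m \<in> S" using mod x m by simp
    ultimately have "0 < nat (x mod int m) \<and> int (nat (x mod int m)) \<in> S" by simp
    then have "m \<le> nat (x mod int m)" unfolding m_def by (rule Least_le)
    then show False using bnd by linarith
  qed
  then show ?thesis using that[of "int m"] m by simp
qed

text \<open>Since no integer \<open>m \<ge> 2\<close> divides \<open>(v1, v2)\<close>, the ideal \<open>(v1, v2)\<close> has a basis of the form
  \<open>n, r + \<omega>\<close>. The multipliers of \<open>(v1, v2)\<close> into \<open>\<O>\<^sup>2\<close> are then \<open>\<int> + \<int>\<kappa>\<close> with \<open>\<kappa> = (r + cnj \<omega>) / n\<close>.\<close>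

definition standard_basis :: "complex \<Rightarrow> complex \<Rightarrow> int \<Rightarrow> int \<Rightarrow> bool" where
  "standard_basis v1 v2 n r \<longleftrightarrow> v1 \<in> \<O> \<and> v2 \<in> \<O> \<and> 0 < n \<and> n dvd r\<^sup>2 + r * T + N \<and>
     {x * v1 + y * v2 | x y. x \<in> \<O> \<and> y \<in> \<O>} = {of_int x * of_int n + of_int y * (of_int r + \<omega>) | x y. True} \<and>
     (\<forall>m\<ge>2. \<not> (\<exists>a\<in>\<O>. \<exists>b\<in>\<O>. v1 = a * of_int m \<and> v2 = b * of_int m))"

text \<open>This is the Hermite normal form of the ideal, with n generating its rational integers
  and s the \<omega>-coordinates. Multiplying by \<omega> shows that s divides n and r0, hence the
  whole ideal, so primitivity forces s = 1.\<close>

lemma exists_standard_basis: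
  assumes v: "v1 \<in> \<O>" "v2 \<in> \<O>" "v1 \<noteq> 0 \<or> v2 \<noteq> 0"
    and prim: "\<And>m. 2 \<le> m \<Longrightarrow> \<not> (\<exists>a\<in>\<O>. \<exists>b\<in>\<O>. v1 = a * of_int m \<and> v2 = b * of_int m)"
  obtains n r where "standard_basis v1 v2 n r"
proof -
  define A where "A = Idl\<^bsub>R\<^esub> {v1, v2}"
  have A: "ideal A R" unfolding A_def using v by (intro R.genideal_ideal) auto
  have mem: "v1 \<in> A" "v2 \<in> A" unfolding A_def using R.genideal_self[of "{v1, v2}"] v by auto
  note I = idealD[OF A]
  obtain n0 where n0: "0 < n0" "of_int n0 \<in> A" using nonzero_ideal_int[OF A] mem v(3) by metis
  obtain n where n: "0 < n" "of_int n \<in> A" "\<And>x. of_int x \<in> A \<Longrightarrow> n dvd x"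
  proof (rule int_subgroup_generator[of n0 "{x. of_int x \<in> A}"])
    show "\<And>x y q. x \<in> {x. of_int x \<in> A} \<Longrightarrow> y \<in> {x. of_int x \<in> A} \<Longrightarrow> x - q * y \<in> {x. of_int x \<in> A}"
      using I(4,7) by auto
  qed (use n0 that in auto)
  define S where "S = {b. \<exists>a. of_int a + of_int b * \<omega> \<in> A}"
  have nS: "n \<in> S" unfolding S_def using I(5)[OF n(2) O_omega] by (auto intro!: exI[of _ 0])
  obtain s where s: "0 < s" "s \<in> S" "\<And>x. x \<in> S \<Longrightarrow> s dvd x"
  proof (rule int_subgroup_generator[OF nS n(1)])
    fix x y q assume "x \<in> S" "y \<in> S"
    then obtain a b where "of_int a + of_int x * \<omega> \<in> A" "of_int b + of_int y * \<omega> \<in> A" by (auto simp: S_def)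
    then have "(of_int a + of_int x * \<omega>) - of_int q * (of_int b + of_int y * \<omega>) \<in> A" using I(4,7) by blast
    also have "(of_int a + of_int x * \<omega>) - of_int q * (of_int b + of_int y * \<omega>) = of_int (a - q * b) + of_int (x - q * y) * \<omega>"
      by (simp add: algebra_simps)
    finally show "x - q * y \<in> S" unfolding S_def by blast
  qed (use that in blast)
  obtain r0 where r0: "of_int r0 + of_int s * \<omega> \<in> A" using s(2) by (auto simp: S_def)
  have sn: "s dvd n" using s(3) nS by blast
  have "\<omega> * (of_int r0 + of_int s * \<omega>) \<in> A" using I(4)[OF r0 O_omega] .
  also have "\<omega> * (of_int r0 + of_int s * \<omega>) = of_int r0 * \<omega> + of_int s * \<omega>\<^sup>2"
    by (simp add: power2_eq_square algebra_simps)
  also have "\<dots> = of_int (- s * N) + of_int (r0 + s * T) * \<omega>" unfolding omega_square by (simp add: algebra_simps)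
  finally have "r0 + s * T \<in> S" unfolding S_def by blast
  then have "s dvd r0 + s * T" by (rule s(3))
  then have sr: "s dvd r0" by (simp add: dvd_add_left_iff)
  have rep: "\<exists>x y. u = of_int x * of_int n + of_int y * (of_int r0 + of_int s * \<omega>)" if u: "u \<in> A" for u
  proof -
    obtain a b where ab: "u = of_int a + of_int b * \<omega>" using I(1)[OF u] by (rule O_E)
    then have "s dvd b" using u s(3) by (auto simp: S_def)
    then obtain y where y: "b = s * y" by blast
    have "u - of_int y * (of_int r0 + of_int s * \<omega>) \<in> A" using I(4,7) u r0 by blast
    also have "u - of_int y * (of_int r0 + of_int s * \<omega>) = of_int (a - y * r0)" unfolding ab y by (simp add: algebra_simps)
    finally obtain x where "a - y * r0 = n * x" using n(3) by blast
    then have "u = of_int x * of_int n + of_int y * (of_int r0 + of_int s * \<omega>)"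
      using \<open>u - of_int y * (of_int r0 + of_int s * \<omega>) = of_int (a - y * r0)\<close> by (simp add: algebra_simps)
    then show ?thesis by blast
  qed
  have "s = 1"
  proof (rule ccontr)
    assume "s \<noteq> 1"
    then have s2: "2 \<le> s" using s(1) by simp
    obtain n' where n': "n = s * n'" using sn by blast
    obtain r' where r': "r0 = s * r'" using sr by blast
    have "\<exists>a\<in>\<O>. u = a * of_int s" if u: "u \<in> A" for u
    proof -
      obtain x y where "u = of_int x * of_int n + of_int y * (of_int r0 + of_int s * \<omega>)" using rep u by blast
      then have "u = (of_int (x * n' + y * r') + of_int y * \<omega>) * of_int s" unfolding n' r' by (simp add: algebra_simps)
      then show ?thesis by blast
    qed
    then show False using prim[OF s2] mem by blast
  qed
  then have rho: "of_int r0 + \<omega> \<in> A" using r0 by simp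
  have "A = {x * v1 + y * v2 | x y. x \<in> \<O> \<and> y \<in> \<O>}" unfolding A_def by (rule Idl_pair[OF v(1,2)])
  moreover have "A = {of_int x * of_int n + of_int y * (of_int r0 + \<omega>) | x y. True}"
  proof
    show "A \<subseteq> {of_int x * of_int n + of_int y * (of_int r0 + \<omega>) | x y. True}" using rep \<open>s = 1\<close> by fastforce
    show "{of_int x * of_int n + of_int y * (of_int r0 + \<omega>) | x y. True} \<subseteq> A"
      using I(3)[OF I(4)[OF n(2) O_int] I(4)[OF rho O_int]] by auto
  qed
  moreover have "n dvd r0\<^sup>2 + r0 * T + N"
  proof (rule n(3))
    have "(of_int r0 + \<omega>) * (of_int r0 + (of_int T - \<omega>)) \<in> A" by (rule I(5)[OF rho]) (intro O_add O_diff O_int O_omega)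
    also have "(of_int r0 + \<omega>) * (of_int r0 + (of_int T - \<omega>)) = of_int (r0\<^sup>2 + r0 * T) - (\<omega>\<^sup>2 - of_int T * \<omega>)"
      by (simp add: power2_eq_square algebra_simps)
    also have "\<dots> = of_int (r0\<^sup>2 + r0 * T + N)" unfolding omega_square by simp
    finally show "of_int (r0\<^sup>2 + r0 * T + N) \<in> A" .
  qed
  ultimately have "standard_basis v1 v2 n r0" unfolding standard_basis_def using v n prim by blast
  then show ?thesis by (rule that)
qed

context
  fixes v1 v2 \<kappa> :: complex and n r :: int
  assumes sb: "standard_basis v1 v2 n r"
    and kappa: "\<kappa> = (of_int r + (of_int T - \<omega>)) / of_int n"
begin

lemma sb_simps: "v1 \<in> \<O>" "v2 \<in> \<O>" "0 < n" "n dvd r\<^sup>2 + r * T + N"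
  "\<And>m. 2 \<le> m \<Longrightarrow> \<not> (\<exists>a\<in>\<O>. \<exists>b\<in>\<O>. v1 = a * of_int m \<and> v2 = b * of_int m)"
  using sb unfolding standard_basis_def by blast+

lemma sb_fwd: "x \<in> \<O> \<Longrightarrow> y \<in> \<O> \<Longrightarrow> \<exists>a b. x * v1 + y * v2 = of_int a * of_int n + of_int b * (of_int r + \<omega>)"
  using sb unfolding standard_basis_def by blast

lemma sb_bwd: "\<exists>x\<in>\<O>. \<exists>y\<in>\<O>. of_int a * of_int n + of_int b * (of_int r + \<omega>) = x * v1 + y * v2"
  using sb unfolding standard_basis_def by blast

lemma kappa_n: "\<kappa> * of_int n = of_int r + (of_int T - \<omega>)"
  using sb_simps(3) by (simp add: kappa)

lemma rho_square: "(of_int r + \<omega>) * (of_int r + (of_int T - \<omega>)) = of_int (r\<^sup>2 + r * T + N)"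
proof -
  have "(of_int r + \<omega>) * (of_int r + (of_int T - \<omega>)) = of_int (r\<^sup>2 + r * T) - (\<omega>\<^sup>2 - of_int T * \<omega>)"
    by (simp add: power2_eq_square algebra_simps)
  then show ?thesis unfolding omega_square by simp
qed

lemma kappa_rho: obtains m where "\<kappa> * (of_int r + \<omega>) = of_int m" "r\<^sup>2 + r * T + N = n * m"
proof -
  obtain m where m: "r\<^sup>2 + r * T + N = n * m" using sb_simps(4) by blast
  have "\<kappa> * (of_int r + \<omega>) * of_int n = of_int (n * m)"
    using rho_square kappa_n m by (metis mult.assoc mult.commute)
  then have "\<kappa> * (of_int r + \<omega>) = of_int m" using sb_simps(3) by (simp add: mult.commute)
  then show ?thesis using that m by blast
qed

lemma kappa_mem: assumes "x \<in> \<O>" "y \<in> \<O>" shows "\<kappa> * (x * v1 + y * v2) \<in> \<O>"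
proof -
  obtain a b where ab: "x * v1 + y * v2 = of_int a * of_int n + of_int b * (of_int r + \<omega>)"
    using sb_fwd assms by blast
  obtain m where m: "\<kappa> * (of_int r + \<omega>) = of_int m" by (rule kappa_rho)
  have "\<kappa> * (x * v1 + y * v2) = of_int a * (\<kappa> * of_int n) + of_int b * (\<kappa> * (of_int r + \<omega>))"
    unfolding ab by (simp add: algebra_simps)
  then show ?thesis unfolding m kappa_n by simp
qed

lemma kappa_v: "\<kappa> * v1 \<in> \<O>" "\<kappa> * v2 \<in> \<O>"
  using kappa_mem[of 1 0] kappa_mem[of 0 1] by simp_all

lemma Im_kappa: "Im \<kappa> = - D / (2 * of_int n)"
proof -
  have "Im \<kappa> * of_int n = Im (\<kappa> * of_int n)" by simp
  also have "\<dots> = - D / 2" unfolding kappa_n by (simp add: D_def)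
  finally show ?thesis using sb_simps(3) by (simp add: field_simps)
qed

text \<open>Adding b \<kappa> to k removes the \<omega>-coordinate of k n and leaves a rational
  number A' / n' in lowest terms that still multiplies v into the ring. By Bezout n' divides both
  entries of v, so n' = 1.\<close>

lemma quotient_ideal:
  assumes "k * v1 \<in> \<O>" "k * v2 \<in> \<O>"
  shows "\<exists>x y. k = of_int x + of_int y * \<kappa>"
proof -
  have n: "0 < n" by (rule sb_simps)
  obtain x0 y0 where xy: "x0 \<in> \<O>" "y0 \<in> \<O>" "of_int n = x0 * v1 + y0 * v2" using sb_bwd[of 1 0] by auto
  have "k * of_int n = x0 * (k * v1) + y0 * (k * v2)" unfolding xy by (simp add: algebra_simps)
  then have "k * of_int n \<in> \<O>" using assms xy by simp
  then obtain a b where ab: "k * of_int n = of_int a + of_int b * \<omega>" by (rule O_E)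
  define A where "A = a + b * (r + T)"
  have "(k + of_int b * \<kappa>) * of_int n = k * of_int n + of_int b * (\<kappa> * of_int n)" by (simp add: algebra_simps)
  also have "\<dots> = of_int A" unfolding ab kappa_n A_def by (simp add: algebra_simps)
  finally have kA: "(k + of_int b * \<kappa>) * of_int n = of_int A" .
  define g where "g = gcd A n"
  have g0: "0 < g" using n by (simp add: g_def)
  obtain A' n' where An: "A = g * A'" "n = g * n'" by (metis g_def gcd_dvd1 gcd_dvd2 dvdE)
  have n'0: "0 < n'" using n g0 An by (simp add: zero_less_mult_iff)
  have "(k + of_int b * \<kappa>) * of_int n' * of_int g = of_int A' * of_int g"
    using kA unfolding An by (simp add: algebra_simps)
  then have kA': "(k + of_int b * \<kappa>) * of_int n' = of_int A'" using g0 by simp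
  have "Rings.coprime A' n'"
  proof -
    have "g * gcd A' n' = gcd A n" using gcd_mult_distrib_int[of g A' n'] g0 An by simp
    then have "g * gcd A' n' = g * 1" by (simp add: g_def)
    then have "gcd A' n' = 1" using g0 by simp
    then show ?thesis by (simp add: coprime_iff_gcd_eq_1)
  qed
  then obtain x y where bez: "x * A' + y * n' = 1" by (metis bezout_int coprime_iff_gcd_eq_1)
  have "n' = 1"
  proof (rule ccontr)
    assume "n' \<noteq> 1"
    then have n2: "2 \<le> n'" using n'0 by simp
    have div: "\<exists>c\<in>\<O>. v = c * of_int n'" if v: "v \<in> \<O>" "k * v \<in> \<O>" "\<kappa> * v \<in> \<O>" for v
    proof -
      have "v = of_int (x * A' + y * n') * v" by (simp add: bez)
      also have "\<dots> = of_int x * (of_int A' * v) + of_int y * of_int n' * v" by (simp add: algebra_simps)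
      also have "\<dots> = (of_int x * (k * v + of_int b * (\<kappa> * v)) + of_int y * v) * of_int n'"
        unfolding kA'[symmetric] by (simp add: algebra_simps)
      finally show ?thesis using v by (metis O_add O_int O_mult)
    qed
    show False using sb_simps(5)[OF n2] div[OF sb_simps(1) assms(1) kappa_v(1)] div[OF sb_simps(2) assms(2) kappa_v(2)] by blast
  qed
  then have "k = of_int A' + of_int (- b) * \<kappa>" using kA' by (simp add: algebra_simps)
  then show ?thesis by blast
qed

text \<open>The lattice spanned by u, \<kappa> v and v is saturated. The determinant with v isolates
  x, and comparing coordinates in the basis n, r + \<omega> gives p dvd x. What remains is a
  multiplier of v divided by p, to which \<open>quotient_ideal\<close> applies.\<close>

lemma coefficients_dvd:
  assumes u: "u1 \<in> \<O>" "u2 \<in> \<O>" "v1 * u2 - v2 * u1 = of_int n"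
    and p: "p \<noteq> 0" and a: "a1 \<in> \<O>" "a2 \<in> \<O>"
    "of_int x * u1 + of_int y * (\<kappa> * v1) + of_int j * v1 = of_int p * a1"
    "of_int x * u2 + of_int y * (\<kappa> * v2) + of_int j * v2 = of_int p * a2"
  shows "p dvd x \<and> p dvd y \<and> p dvd j"
proof -
  have n: "0 < n" by (rule sb_simps)
  have "of_int x * of_int n = v1 * (of_int p * a2) - v2 * (of_int p * a1)"
    unfolding a(3,4)[symmetric] u(3)[symmetric] by (simp add: algebra_simps)
  then have xn: "of_int x * of_int n = of_int p * (a2 * v1 + (- a1) * v2)" by (simp add: algebra_simps)
  obtain c d where cd: "a2 * v1 + (- a1) * v2 = of_int c * of_int n + of_int d * (of_int r + \<omega>)"
    using sb_fwd a by blast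
  have "of_int (x * n) + of_int 0 * \<omega> = of_int (p * (c * n + d * r)) + of_int (p * d) * \<omega>"
    using xn unfolding cd by (simp add: algebra_simps)
  note un = O_coords_unique[OF this]
  then have "d = 0" using p by simp
  then have x: "x = p * c" using un n by simp
  have k: "(of_int y * \<kappa> + of_int j) / of_int p * v1 \<in> \<O>" "(of_int y * \<kappa> + of_int j) / of_int p * v2 \<in> \<O>"
  proof -
    have "(of_int y * \<kappa> + of_int j) * v1 = of_int p * (a1 - of_int c * u1)"
      "(of_int y * \<kappa> + of_int j) * v2 = of_int p * (a2 - of_int c * u2)"
      using a(3,4) unfolding x by (simp_all add: algebra_simps)
    then have "(of_int y * \<kappa> + of_int j) / of_int p * v1 = a1 - of_int c * u1"
      "(of_int y * \<kappa> + of_int j) / of_int p * v2 = a2 - of_int c * u2"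
      using p by (simp_all add: field_simps)
    then show "(of_int y * \<kappa> + of_int j) / of_int p * v1 \<in> \<O>" "(of_int y * \<kappa> + of_int j) / of_int p * v2 \<in> \<O>"
      using a u by simp_all
  qed
  then obtain e f where "(of_int y * \<kappa> + of_int j) / of_int p = of_int e + of_int f * \<kappa>"
    using quotient_ideal by blast
  then have eq: "of_int y * \<kappa> + of_int j = of_int (p * e) + of_int (p * f) * \<kappa>" using p by (simp add: field_simps)
  have "of_int y * Im \<kappa> = of_int (p * f) * Im \<kappa>" using arg_cong[OF eq, of Im] by simp
  moreover have "Im \<kappa> \<noteq> 0" using Im_kappa D_pos n by simp
  ultimately have "real_of_int y = of_int (p * f)" by simp
  then have y: "y = p * f" by (simp only: of_int_eq_iff)
  then have "of_int j = (of_int (p * e) :: complex)" using eq by simp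
  then have "j = p * e" by (simp only: of_int_eq_iff)
  then show ?thesis using x y by simp
qed

text \<open>This is the invertibility of the ideal (v1, v2). A prime p below such a Q would divide
  n, m and the trace 2 r + T of r + \<omega>, whose norm is n m. Then (r + \<omega>) / p would be
  integral, against \<open>maximal\<close>.\<close>

lemma no_max_ideal_v_kappa:
  assumes Q: "max_ideal Q" "v1 \<in> Q" "v2 \<in> Q" "\<kappa> * v1 \<in> Q" "\<kappa> * v2 \<in> Q"
  shows False
proof -
  note I = idealD[OF max_ideal_ideal[OF Q(1)]]
  have n: "0 < n" by (rule sb_simps)
  have mem: "x \<in> Q \<and> \<kappa> * x \<in> Q" if x: "x = of_int a * of_int n + of_int b * (of_int r + \<omega>)" for x a b
  proof -
    obtain c d where cd: "c \<in> \<O>" "d \<in> \<O>" "x = c * v1 + d * v2" using sb_bwd x by blast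
    have "\<kappa> * x = c * (\<kappa> * v1) + d * (\<kappa> * v2)" unfolding cd by (simp add: algebra_simps)
    then show ?thesis using cd I(3)[OF I(4)[OF Q(2) cd(1)] I(4)[OF Q(3) cd(2)]]
      I(3)[OF I(4)[OF Q(4) cd(1)] I(4)[OF Q(5) cd(2)]] by simp
  qed
  have 1: "of_int n \<in> Q" "\<kappa> * of_int n \<in> Q" using mem[of "of_int n" 1 0] by simp_all
  have 2: "of_int r + \<omega> \<in> Q" "\<kappa> * (of_int r + \<omega>) \<in> Q" using mem[of "of_int r + \<omega>" 0 1] by simp_all
  obtain m where m: "\<kappa> * (of_int r + \<omega>) = of_int m" "r\<^sup>2 + r * T + N = n * m" by (rule kappa_rho)
  have "of_int r + \<omega> + \<kappa> * of_int n \<in> Q" using I(3) 1 2 by blast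
  then have "of_int (2 * r + T) \<in> Q" unfolding kappa_n by simp
  moreover have "of_int m \<in> Q" using 2 m by simp
  moreover obtain p where p: "Factorial_Ring.prime p" "of_nat p \<in> Q"
    using max_ideal_prime_mem[OF Q(1), of "nat n"] n 1 by auto
  ultimately have "int p dvd 2 * r + T" "int p dvd m" "int p dvd n" using ideal_nat_dvd[OF Q(1) p] 1 by blast+
  then obtain t' m' n' where d: "2 * r + T = int p * t'" "m = int p * m'" "n = int p * n'" by blast
  have p0: "int p \<noteq> 0" using p(1) by auto
  have "(of_int r + \<omega>)\<^sup>2 = of_int (2 * r + T) * (of_int r + \<omega>) - (of_int r + \<omega>) * (of_int r + (of_int T - \<omega>))"
    by (simp add: power2_eq_square algebra_simps)
  also have "\<dots> = of_int (int p * t') * (of_int r + \<omega>) - of_int (int p * n' * (int p * m'))"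
    unfolding rho_square m(2) d(1) d(2) by (subst d(3)) simp
  finally have "(of_int r + of_int 1 * \<omega>)\<^sup>2 / (of_int (int p))\<^sup>2 =
      (of_int (int p * t') * (of_int r + of_int 1 * \<omega>) - of_int (int p * n' * (int p * m'))) / (of_int (int p))\<^sup>2" by simp
  then have "((of_int r + of_int 1 * \<omega>) / of_int (int p))\<^sup>2 =
      of_int t' * ((of_int r + of_int 1 * \<omega>) / of_int (int p)) - of_int (n' * m')"
    using p0 by (simp add: power_divide diff_divide_distrib power2_eq_square)
  from maximal[OF p0 this] have "int p dvd 1" by blast
  then show False using p(1) by simp
qed

text \<open>The point is that the determinant x n of v and w is rational. Expanded in the basis p,
  \<rho> of Q it has imaginary part (p A + B (2 r0 + T)) Im \<omega>, so p divides B (2 r0 + T). As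
  v and w are independent modulo p, p does not divide B. So p divides the trace and the norm of
  \<rho>, hence the discriminant.\<close>

lemma common_prime_ramified:
  assumes u: "u1 \<in> \<O>" "u2 \<in> \<O>" "v1 * u2 - v2 * u1 = of_int n"
    and Q: "max_ideal Q" "\<not> principal Q" "v1 \<in> Q" "v2 \<in> Q"
    and w: "w1 = of_int x * u1 + of_int y * (\<kappa> * v1)" "w2 = of_int x * u2 + of_int y * (\<kappa> * v2)"
      "w1 \<in> Q" "w2 \<in> Q" "gcd x y = 1"
  obtains p where "Factorial_Ring.prime (p :: int)" "p dvd n" "p dvd 4 * N - T\<^sup>2"
proof -
  note I = idealD[OF max_ideal_ideal[OF Q(1)]]
  have n: "0 < n" by (rule sb_simps)
  obtain c d where cd: "c \<in> \<O>" "d \<in> \<O>" "of_int n = c * v1 + d * v2" using sb_bwd[of 1 0] by auto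
  have nQ: "of_int n \<in> Q" unfolding cd by (rule I(3)[OF I(4)[OF Q(3) cd(1)] I(4)[OF Q(4) cd(2)]])
  obtain p' where p': "Factorial_Ring.prime p'" "of_nat p' \<in> Q"
    using max_ideal_prime_mem[OF Q(1), of "nat n"] n nQ by auto
  define p where "p = int p'"
  have p: "Factorial_Ring.prime p" "of_int p \<in> Q" "p \<noteq> 0" "2 \<le> p" using p' prime_ge_2_nat[OF p'(1)] by (auto simp: p_def)
  have intQ: "p dvd k" if "of_int k \<in> Q" for k using ideal_nat_dvd[OF Q(1) p' that] by (simp add: p_def)
  have pn: "p dvd n" using intQ nQ by blast
  \<comment> \<open>Being nonprincipal, Q is larger than the multiples of p. An extra element has an
    \<omega>-coordinate prime to p and can be normalised to r0 + \<omega>.\<close>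
  obtain x0 where x0: "x0 \<in> Q" "\<not> (\<exists>g\<in>\<O>. x0 = g * of_int p)"
  proof -
    have "Q \<noteq> {g * of_int p | g. g \<in> \<O>}" using Q(2) unfolding principal_def by (metis O_int)
    moreover have "{g * of_int p | g. g \<in> \<O>} \<subseteq> Q" using I(4)[OF p(2)] by auto
    ultimately have "\<not> Q \<subseteq> {g * of_int p | g. g \<in> \<O>}" by blast
    then show ?thesis using that by blast
  qed
  obtain a b where ab: "x0 = of_int a + of_int b * \<omega>" using I(1)[OF x0(1)] by (rule O_E)
  have "\<not> p dvd b"
  proof
    assume "p dvd b"
    then obtain b' where b': "b = p * b'" by blast
    have "x0 - (of_int b' * \<omega>) * of_int p \<in> Q" by (rule I(7)[OF x0(1) I(4)[OF p(2)]]) simp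
    also have "x0 - (of_int b' * \<omega>) * of_int p = of_int a" unfolding ab b' by (simp add: algebra_simps)
    finally obtain a' where "a = p * a'" using intQ by blast
    then have "x0 = (of_int a' + of_int b' * \<omega>) * of_int p" unfolding ab b' by (simp add: algebra_simps)
    then show False using x0 by blast
  qed
  then have "Rings.coprime p b" using p(1) by (simp add: prime_imp_coprime)
  then obtain k b' where bez: "k * p + b' * b = 1" by (metis bezout_int coprime_iff_gcd_eq_1)
  define r0 where "r0 = a * b'"
  have rho: "of_int r0 + \<omega> \<in> Q"
  proof -
    have "of_int b' * x0 + (of_int k * \<omega>) * of_int p \<in> Q"
      by (rule I(3)[OF I(4)[OF x0(1) O_int] I(4)[OF p(2)]]) simp
    also have "of_int b' * x0 + (of_int k * \<omega>) * of_int p = of_int r0 + of_int (k * p + b' * b) * \<omega>"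
      unfolding ab r0_def by (simp add: algebra_simps)
    finally show ?thesis by (simp add: bez)
  qed
  define \<rho> where "\<rho> = of_int r0 + \<omega>"
  have rep: "\<exists>e f. c = of_int p * of_int e + \<rho> * of_int f" if c: "c \<in> Q" for c
  proof -
    obtain a b where ab: "c = of_int a + of_int b * \<omega>" using I(1)[OF c] by (rule O_E)
    have "c - of_int b * (of_int r0 + \<omega>) \<in> Q" by (rule I(7)[OF c I(4)[OF rho O_int]])
    also have "c - of_int b * (of_int r0 + \<omega>) = of_int (a - b * r0)" unfolding ab by (simp add: algebra_simps)
    finally obtain e where "a - b * r0 = p * e" using intQ by blast
    then have "a = p * e + b * r0" by simp
    then have "c = of_int p * of_int e + \<rho> * of_int b" unfolding ab \<rho>_def by (simp add: algebra_simps)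
    then show ?thesis by blast
  qed
  obtain a1 b1 where 1: "v1 = of_int p * of_int a1 + \<rho> * of_int b1" using rep Q(3) by blast
  obtain a2 b2 where 2: "v2 = of_int p * of_int a2 + \<rho> * of_int b2" using rep Q(4) by blast
  obtain c1 d1 where 3: "w1 = of_int p * of_int c1 + \<rho> * of_int d1" using rep w(3) by blast
  obtain c2 d2 where 4: "w2 = of_int p * of_int c2 + \<rho> * of_int d2" using rep w(4) by blast
  define B where "B = b1 * d2 - b2 * d1"
  define A where "A = a1 * d2 - a2 * d1 + b1 * c2 - b2 * c1"
  have "v1 * w2 - v2 * w1 = of_int x * (v1 * u2 - v2 * u1)" unfolding w(1,2) by (simp add: algebra_simps)
  then have im0: "Im (v1 * w2 - v2 * w1) = 0" unfolding u(3) by simp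
  have "v1 * w2 - v2 * w1 = of_int (p * p * (a1 * c2 - a2 * c1)) + of_int (p * A) * \<rho> + of_int B * (\<rho> * \<rho>)"
    unfolding 1 2 3 4 A_def B_def by (simp add: algebra_simps)
  moreover have "\<rho> * \<rho> = of_int (2 * r0 + T) * \<rho> - of_int (r0\<^sup>2 + r0 * T + N)"
  proof -
    have "\<rho> * \<rho> = of_int (2 * r0) * \<rho> - of_int (r0\<^sup>2) + \<omega>\<^sup>2" unfolding \<rho>_def by (simp add: power2_eq_square algebra_simps)
    also have "\<dots> = of_int (2 * r0 + T) * \<rho> - of_int (r0\<^sup>2 + r0 * T + N)" unfolding omega_square \<rho>_def by (simp add: algebra_simps)
    finally show ?thesis .
  qed
  ultimately have "v1 * w2 - v2 * w1 = of_int (p * p * (a1 * c2 - a2 * c1)) + of_int (p * A) * \<rho> +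
      of_int B * (of_int (2 * r0 + T) * \<rho> - of_int (r0\<^sup>2 + r0 * T + N))" by (simp only:)
  also have "\<dots> = of_int (p * p * (a1 * c2 - a2 * c1) - B * (r0\<^sup>2 + r0 * T + N)) + of_int (p * A + B * (2 * r0 + T)) * \<rho>"
    by (simp add: algebra_simps)
  finally have "Im (v1 * w2 - v2 * w1) = of_int (p * A + B * (2 * r0 + T)) * Im \<omega>"
    unfolding \<rho>_def by simp
  then have "real_of_int (p * A + B * (2 * r0 + T)) = 0" using im0 Im_omega by simp
  then have "p * A + B * (2 * r0 + T) = 0" by (simp only: of_int_eq_0_iff)
  then have "B * (2 * r0 + T) = p * (- A)" by simp
  then have "p dvd B * (2 * r0 + T)" by simp
  moreover have "\<not> p dvd B"
  proof
    assume pB: "p dvd B"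
    have indep: "p dvd e \<and> p dvd f" if *: "p dvd e * b1 + f * d1" "p dvd e * b2 + f * d2" for e f
    proof -
      obtain g1 where g1: "e * b1 + f * d1 = p * g1" using *(1) by blast
      obtain g2 where g2: "e * b2 + f * d2 = p * g2" using *(2) by blast
      have "of_int e * v1 + of_int f * w1 = of_int p * of_int (e * a1 + f * c1) + \<rho> * of_int (e * b1 + f * d1)"
        unfolding 1 3 by (simp add: algebra_simps)
      then have e1: "of_int (f * x) * u1 + of_int (f * y) * (\<kappa> * v1) + of_int e * v1 = of_int p * (of_int (e * a1 + f * c1) + \<rho> * of_int g1)"
        unfolding g1 w(1) by (simp add: algebra_simps)
      have "of_int e * v2 + of_int f * w2 = of_int p * of_int (e * a2 + f * c2) + \<rho> * of_int (e * b2 + f * d2)"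
        unfolding 2 4 by (simp add: algebra_simps)
      then have e2: "of_int (f * x) * u2 + of_int (f * y) * (\<kappa> * v2) + of_int e * v2 = of_int p * (of_int (e * a2 + f * c2) + \<rho> * of_int g2)"
        unfolding g2 w(2) by (simp add: algebra_simps)
      have "of_int (e * a1 + f * c1) + \<rho> * of_int g1 \<in> \<O>" "of_int (e * a2 + f * c2) + \<rho> * of_int g2 \<in> \<O>"
        unfolding \<rho>_def by simp_all
      from coefficients_dvd[OF u p(3) this e1 e2] have pd: "p dvd f * x" "p dvd f * y" "p dvd e" by auto
      obtain g h where "g * x + h * y = 1" using w(5) by (metis bezout_int)
      then have "f = g * (f * x) + h * (f * y)" by (metis distrib_left mult.assoc mult.commute mult.right_neutral)
      then have "p dvd f" using pd by (metis dvd_add dvd_mult)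
      then show ?thesis using pd by blast
    qed
    \<comment> \<open>If p divides B, the rows (-d1, b1) and (d2, -b2) of the adjugate give
      combinations of v and w divisible by p. Then p divides b1 and b2, so v itself is divisible by
      p.\<close>
    have z1: "p dvd - d1 \<and> p dvd b1" using indep[of "- d1" b1] pB by (simp add: B_def algebra_simps)
    have z2: "p dvd d2 \<and> p dvd - b2" using indep[of d2 "- b2"] pB by (simp add: B_def algebra_simps)
    have "p dvd 1 * b1 + 0 * d1" "p dvd 1 * b2 + 0 * d2" using z1 z2 by simp_all
    from indep[OF this] have "p dvd 1" by blast
    then show False using p(4) zdvd_imp_le[of p 1] by simp
  qed
  ultimately have pt: "p dvd 2 * r0 + T" using p(1) by (metis prime_dvd_mult_iff)
  have "p dvd r0\<^sup>2 + r0 * T + N"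
  proof (rule intQ)
    have "(of_int r0 + \<omega>) * (of_int r0 + (of_int T - \<omega>)) \<in> Q" by (rule I(5)[OF rho]) (intro O_add O_diff O_int O_omega)
    also have "(of_int r0 + \<omega>) * (of_int r0 + (of_int T - \<omega>)) = of_int (r0\<^sup>2 + r0 * T) - (\<omega>\<^sup>2 - of_int T * \<omega>)"
      by (simp add: power2_eq_square algebra_simps)
    also have "\<dots> = of_int (r0\<^sup>2 + r0 * T + N)" unfolding omega_square by simp
    finally show "of_int (r0\<^sup>2 + r0 * T + N) \<in> Q" .
  qed
  then have "p dvd 4 * (r0\<^sup>2 + r0 * T + N) - (2 * r0 + T) * (2 * r0 + T)" using pt by (intro dvd_diff dvd_mult) auto
  then have "p dvd 4 * N - T\<^sup>2" by (simp add: power2_eq_square algebra_simps)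
  then show ?thesis using that p(1) pn by blast
qed

end

section \<open>Shortest vectors of the height form\<close>

definition qform :: "complex \<Rightarrow> real \<Rightarrow> complex \<Rightarrow> complex \<Rightarrow> real" where
  "qform z t a b = (cmod (a - b * z))\<^sup>2 + (cmod b)\<^sup>2 * t\<^sup>2"

lemma qform_scale: "qform z t (g * a) (g * b) = (cmod g)\<^sup>2 * qform z t a b"
proof -
  have "g * a - g * b * z = g * (a - b * z)" by (simp add: algebra_simps)
  then show ?thesis unfolding qform_def by (simp only: norm_mult power_mult_distrib distrib_left mult.assoc)
qed

lemma qform_pos: assumes "0 < t" "a \<noteq> 0 \<or> b \<noteq> 0" shows "0 < qform z t a b"
proof (cases "b = 0")
  case False
  then have "0 < (cmod b)\<^sup>2 * t\<^sup>2" using assms by simp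
  then show ?thesis unfolding qform_def using zero_le_power2[of "cmod (a - b * z)"] by linarith
qed (use assms in \<open>auto simp: qform_def\<close>)

lemma exists_minimal_vector:
  assumes t: "0 < t"
  obtains v1 v2 where "v1 \<in> \<O>" "v2 \<in> \<O>" "v1 \<noteq> 0 \<or> v2 \<noteq> 0"
    "\<And>a b. a \<in> \<O> \<Longrightarrow> b \<in> \<O> \<Longrightarrow> a \<noteq> 0 \<or> b \<noteq> 0 \<Longrightarrow> qform z t v1 v2 \<le> qform z t a b"
proof -
  define S where "S = {p. fst p \<in> \<O> \<and> snd p \<in> \<O> \<and> p \<noteq> (0, 0) \<and> qform z t (fst p) (snd p) \<le> 1}"
  have "S \<subseteq> {x \<in> \<O>. cmod x \<le> 1 + 1 / t * cmod z} \<times> {x \<in> \<O>. cmod x \<le> 1 / t}"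
  proof
    fix p assume p: "p \<in> S"
    obtain a b where ab: "p = (a, b)" by (cases p)
    have q: "(cmod (a - b * z))\<^sup>2 + (cmod b * t)\<^sup>2 \<le> 1" using p by (simp add: S_def ab qform_def power_mult_distrib)
    have "(cmod (a - b * z))\<^sup>2 \<le> 1\<^sup>2" "(cmod b * t)\<^sup>2 \<le> 1\<^sup>2"
      using q zero_le_power2[of "cmod (a - b * z)"] zero_le_power2[of "cmod b * t"] by (simp_all, linarith+)
    then have *: "cmod (a - b * z) \<le> 1" "cmod b * t \<le> 1" by (auto intro: power2_le_imp_le)
    then have b: "cmod b \<le> 1 / t" using t by (simp add: field_simps)
    have "cmod a \<le> cmod (a - b * z) + cmod (b * z)" using norm_triangle_ineq[of "a - b * z" "b * z"] by simp
    also have "\<dots> \<le> 1 + 1 / t * cmod z" unfolding norm_mult using * b by (intro add_mono mult_right_mono) auto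
    finally show "p \<in> {x \<in> \<O>. cmod x \<le> 1 + 1 / t * cmod z} \<times> {x \<in> \<O>. cmod x \<le> 1 / t}"
      using b p by (simp add: ab S_def)
  qed
  then have "finite S" by (rule finite_subset) (intro finite_cartesian_product finite_O)
  moreover have S1: "(1, 0) \<in> S" by (simp add: S_def qform_def)
  then have "S \<noteq> {}" by blast
  ultimately obtain p where p: "p \<in> S" and
    min: "\<And>p'. p' \<in> S \<Longrightarrow> qform z t (fst p) (snd p) \<le> qform z t (fst p') (snd p')"
    using ex_min_image[of S "\<lambda>p. qform z t (fst p) (snd p)"] by blast
  have "qform z t (fst p) (snd p) \<le> qform z t a b" if "a \<in> \<O>" "b \<in> \<O>" "a \<noteq> 0 \<or> b \<noteq> 0" for a b
  proof (cases "qform z t a b \<le> 1")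
    case True then show ?thesis using min[of "(a, b)"] that by (simp add: S_def)
  next
    case False then show ?thesis using p by (simp add: S_def)
  qed
  moreover have "fst p \<in> \<O>" "snd p \<in> \<O>" "fst p \<noteq> 0 \<or> snd p \<noteq> 0" using p by (auto simp: S_def prod_eq_iff)
  ultimately show ?thesis using that by blast
qed

lemma minimal_vector_primitive:
  assumes t: "0 < t" and v: "v1 \<noteq> 0 \<or> v2 \<noteq> 0"
    and min: "\<And>a b. a \<in> \<O> \<Longrightarrow> b \<in> \<O> \<Longrightarrow> a \<noteq> 0 \<or> b \<noteq> 0 \<Longrightarrow> qform z t v1 v2 \<le> qform z t a b"
    and g: "a \<in> \<O>" "b \<in> \<O>" "v1 = a * g" "v2 = b * g"
  shows "cmod g \<le> 1"
proof -
  have ab: "a \<noteq> 0 \<or> b \<noteq> 0" using v g by auto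
  have "v1 = g * a" "v2 = g * b" using g by (simp_all add: mult.commute)
  then have "qform z t v1 v2 = (cmod g)\<^sup>2 * qform z t a b" using qform_scale by simp
  then have "(cmod g)\<^sup>2 * qform z t a b \<le> 1 * qform z t a b" using min[OF g(1,2) ab] by simp
  then have "(cmod g)\<^sup>2 \<le> 1" using qform_pos[OF t ab, of z] by simp
  then show ?thesis using power2_le_imp_le[of "cmod g" 1] by simp
qed

text \<open>Dividing both entries by a generator would give a shorter vector unless the generator is
  a unit, and a maximal ideal contains no unit.\<close>

lemma max_ideal_minimal_vector_not_principal:
  assumes t: "0 < t" and v: "v1 \<noteq> 0 \<or> v2 \<noteq> 0"
    and min: "\<And>a b. a \<in> \<O> \<Longrightarrow> b \<in> \<O> \<Longrightarrow> a \<noteq> 0 \<or> b \<noteq> 0 \<Longrightarrow> qform z t v1 v2 \<le> qform z t a b"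
    and Q: "max_ideal Q" "v1 \<in> Q" "v2 \<in> Q"
  shows "\<not> principal Q"
proof
  assume "principal Q"
  then obtain g where g: "g \<in> \<O>" "Q = {x * g | x. x \<in> \<O>}" unfolding principal_def by blast
  obtain a where a: "a \<in> \<O>" "v1 = a * g" using Q(2) unfolding g(2) by blast
  obtain b where b: "b \<in> \<O>" "v2 = b * g" using Q(3) unfolding g(2) by blast
  have "cmod g \<le> 1" by (rule minimal_vector_primitive[OF t v min a(1) b(1) a(2) b(2)])
  moreover have g0: "g \<noteq> 0" using a b v by auto
  then have "1 \<le> cmod g" using O_norm_ge_1 g by blast
  ultimately have "cmod g = 1" by simp
  then have "1 = cnj g * g" using complex_norm_square[of g] by (simp add: mult.commute)
  then have "1 \<in> Q" unfolding g(2) using O_cnj[OF g(1)] by blast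
  then show False using max_ideal_1[OF Q(1)] by blast
qed

section \<open>The lattice of rank 3 around a shortest vector\<close>

context
  fixes z :: complex and t G :: real and v1 v2 \<kappa> u1 u2 :: complex and n r :: int
  assumes t: "0 < t"
    and v: "v1 \<noteq> 0 \<or> v2 \<noteq> 0" "qform z t v1 v2 = G"
    and minimal: "\<And>a b. a \<in> \<O> \<Longrightarrow> b \<in> \<O> \<Longrightarrow> a \<noteq> 0 \<or> b \<noteq> 0 \<Longrightarrow> G \<le> qform z t a b"
    and sb: "standard_basis v1 v2 n r"
    and kappa: "\<kappa> = (of_int r + (of_int T - \<omega>)) / of_int n"
    and u: "u1 \<in> \<O>" "u2 \<in> \<O>" "v1 * u2 - v2 * u1 = of_int n"
begin

lemmas basis_simps = sb_simps[OF sb kappa] 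

lemma G_pos: "0 < G"
  using qform_pos[OF t v(1), of z] v(2) by simp

text \<open>The orthogonal decomposition of a vector along \<open>(v1, v2)\<close>: \<open>zc\<close> is its coordinate, and the
  orthogonal part is measured by the determinant with \<open>(v1, v2)\<close>.\<close>

definition zc :: "complex \<Rightarrow> complex \<Rightarrow> complex" where
  "zc a b = ((a - b * z) * cnj (v1 - v2 * z) + of_real (t\<^sup>2) * b * cnj v2) / of_real G"

lemma zc_lin: "zc (x * a + y * c) (x * b + y * d) = x * zc a b + y * zc c d"
  unfolding zc_def by (simp add: add_divide_distrib[symmetric] algebra_simps)

lemma G_complex: "(v1 - v2 * z) * cnj (v1 - v2 * z) + of_real (t\<^sup>2) * v2 * cnj v2 = of_real G"
  unfolding v(2)[symmetric] qform_def of_real_add of_real_mult complex_norm_square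
  by (simp add: mult_ac)

lemma zc_v: "zc v1 v2 = 1"
  unfolding zc_def G_complex using G_pos by simp

lemma qform_split: "qform z t a b = t\<^sup>2 * (cmod (v1 * b - v2 * a))\<^sup>2 / G + G * (cmod (zc a b))\<^sup>2"
proof -
  have nt: "cmod (of_real t * x) = t * cmod x" for x using t by (simp add: norm_mult)
  have "G * qform z t a b = ((cmod (v1 - v2 * z))\<^sup>2 + (cmod (of_real t * v2))\<^sup>2) * ((cmod (a - b * z))\<^sup>2 + (cmod (of_real t * b))\<^sup>2)"
    unfolding v(2)[symmetric] qform_def nt by (simp add: power_mult_distrib mult.commute)
  also have "\<dots> = (cmod ((v1 - v2 * z) * (of_real t * b) - of_real t * v2 * (a - b * z)))\<^sup>2 +
      (cmod ((a - b * z) * cnj (v1 - v2 * z) + of_real t * b * cnj (of_real t * v2)))\<^sup>2"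
    by (rule complex_lagrange)
  also have "(v1 - v2 * z) * (of_real t * b) - of_real t * v2 * (a - b * z) = of_real t * (v1 * b - v2 * a)"
    by (simp add: algebra_simps)
  also have "(a - b * z) * cnj (v1 - v2 * z) + of_real t * b * cnj (of_real t * v2) = of_real G * zc a b"
    unfolding zc_def using G_pos by (simp add: power2_eq_square mult_ac)
  finally have "G * qform z t a b = t\<^sup>2 * (cmod (v1 * b - v2 * a))\<^sup>2 + G * G * (cmod (zc a b))\<^sup>2"
    unfolding norm_mult[of "of_real _"] power_mult_distrib by (simp add: power2_eq_square)
  then have "G * qform z t a b = G * (t\<^sup>2 * (cmod (v1 * b - v2 * a))\<^sup>2 / G + G * (cmod (zc a b))\<^sup>2)"
    using G_pos by (simp add: distrib_left)
  then show ?thesis using G_pos by simp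
qed

text \<open>The vectors \<open>x u + y \<kappa>v + j v\<close> with integers \<open>x, y, j\<close> form a lattice of rank 3 containing the
  shortest vector \<open>v\<close>; \<open>ff\<close> is the projection to the plane orthogonal to \<open>v\<close>, where they form a lattice of
  covolume \<open>t D / 2\<close>, and \<open>rr\<close> the component along \<open>v\<close>.\<close>

definition e1 where "e1 = Complex (t * of_int n / sqrt G) (sqrt G * Im (zc u1 u2))"
definition e2 where "e2 = Complex 0 (sqrt G * Im \<kappa>)"
definition ff :: "int \<Rightarrow> int \<Rightarrow> complex" where "ff x y = of_int x * e1 + of_int y * e2"
definition rr :: "int \<Rightarrow> int \<Rightarrow> real" where "rr x y = of_int x * Re (zc u1 u2) + of_int y * Re \<kappa>"
definition V1 :: "int \<Rightarrow> int \<Rightarrow> complex" where "V1 x y = of_int x * u1 + of_int y * (\<kappa> * v1)"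
definition V2 :: "int \<Rightarrow> int \<Rightarrow> complex" where "V2 x y = of_int x * u2 + of_int y * (\<kappa> * v2)"

lemma V_O: "V1 x y \<in> \<O>" "V2 x y \<in> \<O>"
  unfolding V1_def V2_def using u kappa_v[OF sb kappa] by simp_all

lemma V_det: "v1 * V2 x y - v2 * V1 x y = of_int (x * n)"
proof -
  have "v1 * V2 x y - v2 * V1 x y = of_int x * (v1 * u2 - v2 * u1)" unfolding V1_def V2_def by (simp add: algebra_simps)
  then show ?thesis unfolding u(3) by simp
qed

lemma V_add: "V1 (a + i * b) (c + i * d) = V1 a c + of_int i * V1 b d"
    "V2 (a + i * b) (c + i * d) = V2 a c + of_int i * V2 b d"
  and V_scale: "V1 (e * a) (e * b) = of_int e * V1 a b" "V2 (e * a) (e * b) = of_int e * V2 a b"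
  and ff_add: "ff (a + i * b) (c + i * d) = ff a c + of_int i * ff b d"
  and ff_scale: "ff (e * a) (e * b) = of_int e * ff a b"
  unfolding V1_def V2_def ff_def by (simp_all add: algebra_simps)

lemma e_det: "Im (cnj e1 * e2) = - t * D / 2"
proof -
  have "0 < sqrt G" using G_pos by simp
  then show ?thesis unfolding e1_def e2_def Im_kappa[OF sb kappa] using basis_simps(3) by (simp add: field_simps)
qed

lemma ff_det: "Im (cnj (ff a b) * ff c d) = of_int (a * d - b * c) * (- t * D / 2)"
proof -
  have "Im (cnj (ff a b) * ff c d) = of_int (a * d - b * c) * Im (cnj e1 * e2)"
    unfolding ff_def by (simp add: algebra_simps)
  then show ?thesis unfolding e_det .
qed

lemma qform_V: "qform z t (V1 x y + of_int j * v1) (V2 x y + of_int j * v2) = (cmod (ff x y))\<^sup>2 + G * (rr x y + of_int j)\<^sup>2"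
proof -
  have det: "v1 * (V2 x y + of_int j * v2) - v2 * (V1 x y + of_int j * v1) = of_int (x * n)"
    using V_det[of x y] by (simp add: algebra_simps)
  have "zc (V1 x y + of_int j * v1) (V2 x y + of_int j * v2) =
      zc (of_int x * u1 + (of_int y * \<kappa> + of_int j) * v1) (of_int x * u2 + (of_int y * \<kappa> + of_int j) * v2)"
    unfolding V1_def V2_def by (simp add: algebra_simps)
  also have "\<dots> = of_int x * zc u1 u2 + (of_int y * \<kappa> + of_int j)" unfolding zc_lin zc_v by simp
  finally have zc: "zc (V1 x y + of_int j * v1) (V2 x y + of_int j * v2) = of_int x * zc u1 u2 + (of_int y * \<kappa> + of_int j)" .
  have sG: "0 < sqrt G" "sqrt G * sqrt G = G" using G_pos by simp_all
  have ff: "(cmod (ff x y))\<^sup>2 = t\<^sup>2 * (of_int (x * n))\<^sup>2 / G + G * (of_int x * Im (zc u1 u2) + of_int y * Im \<kappa>)\<^sup>2"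
  proof -
    have "Re (ff x y) = t * of_int (x * n) / sqrt G" "Im (ff x y) = sqrt G * (of_int x * Im (zc u1 u2) + of_int y * Im \<kappa>)"
      unfolding ff_def e1_def e2_def by (simp_all add: algebra_simps)
    then show ?thesis unfolding cmod_power2 using G_pos by (simp add: power_mult_distrib power_divide)
  qed
  have "(cmod (of_int x * zc u1 u2 + (of_int y * \<kappa> + of_int j)))\<^sup>2 = (rr x y + of_int j)\<^sup>2 + (of_int x * Im (zc u1 u2) + of_int y * Im \<kappa>)\<^sup>2"
    unfolding cmod_power2 rr_def by (simp add: algebra_simps)
  then show ?thesis unfolding qform_split det zc ff by (simp add: distrib_left power2_abs[of "of_int x * of_int n :: real"] norm_mult power_mult_distrib)
qed

lemma round_int: obtains j :: int where "\<bar>y + real_of_int j\<bar> \<le> 1 / 2"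
proof -
  have "\<bar>y + real_of_int (- round y)\<bar> \<le> 1 / 2" using of_int_round_abs_le[of y] by (simp add: abs_minus_commute)
  then show ?thesis by (rule that)
qed

text \<open>Subtracting a multiple of v leaves a component along v of squared length at most G / 4,
  so minimality gives G <= |ff|^2 + G / 4.\<close>

lemma G_le_ff: assumes "ff x y \<noteq> 0" shows "G \<le> 4 / 3 * (cmod (ff x y))\<^sup>2"
proof -
  obtain j :: int where j: "\<bar>rr x y + of_int j\<bar> \<le> 1 / 2" by (rule round_int)
  have "(rr x y + of_int j)\<^sup>2 \<le> (1 / 2)\<^sup>2" using j power2_le_iff_abs_le[of "1 / 2" "rr x y + of_int j"] by simp
  then have "G * (rr x y + of_int j)\<^sup>2 \<le> G * (1 / 4)" using G_pos by (intro mult_left_mono) (auto simp: power_divide)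
  moreover have "0 < (cmod (ff x y))\<^sup>2" using assms by simp
  then have "0 < qform z t (V1 x y + of_int j * v1) (V2 x y + of_int j * v2)"
    unfolding qform_V using G_pos by (simp add: add_pos_nonneg)
  then have "V1 x y + of_int j * v1 \<noteq> 0 \<or> V2 x y + of_int j * v2 \<noteq> 0" by (auto simp: qform_def)
  then have "G \<le> qform z t (V1 x y + of_int j * v1) (V2 x y + of_int j * v2)"
    using minimal V_O basis_simps by simp
  ultimately show ?thesis unfolding qform_V by simp
qed

text \<open>Apply \<open>G_le_ff\<close> to \<kappa> v, whose orthogonal part \<open>e2\<close> has
  squared length G (D / (2 n))^2.\<close>

lemma n_bound: "3 * (of_int n)\<^sup>2 \<le> D\<^sup>2" "of_int n \<le> D"
proof -
  have n: "0 < real_of_int n" using basis_simps(3) by simp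
  have ff: "ff 0 1 = e2" by (simp add: ff_def)
  have sG: "(cmod e2)\<^sup>2 = G * (D / (2 * of_int n))\<^sup>2" unfolding e2_def Im_kappa[OF sb kappa] cmod_power2
    using G_pos by (simp add: power_mult_distrib power_divide)
  then have "e2 \<noteq> 0" using G_pos D_pos n by auto
  then have "G * 1 \<le> G * (4 / 3 * (D / (2 * of_int n))\<^sup>2)" using G_le_ff[of 0 1] unfolding ff sG by simp
  then have "1 \<le> 4 / 3 * (D / (2 * of_int n))\<^sup>2" using G_pos by (simp only: mult_le_cancel_left_pos)
  then show 1: "3 * (of_int n)\<^sup>2 \<le> D\<^sup>2" using n by (simp add: power_divide field_simps)
  have "(of_int n)\<^sup>2 \<le> D\<^sup>2" using 1 zero_le_power2[of "real_of_int n"] by linarith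
  then show "of_int n \<le> D" using D_pos by (simp add: power2_le_iff_abs_le)
qed

lemma det_bound: "t\<^sup>2 * (of_int (x * n))\<^sup>2 \<le> G * (cmod (ff x y))\<^sup>2"
proof -
  have sG: "0 < sqrt G" "sqrt G * sqrt G = G" using G_pos by simp_all
  have "Re (ff x y) = t * of_int (x * n) / sqrt G" unfolding ff_def e1_def e2_def by (simp add: algebra_simps)
  then have "(Re (ff x y))\<^sup>2 = t\<^sup>2 * (of_int (x * n))\<^sup>2 / G" using G_pos by (simp add: power_mult_distrib power_divide)
  then have "t\<^sup>2 * (of_int (x * n))\<^sup>2 = G * (Re (ff x y))\<^sup>2" using G_pos by (simp add: field_simps)
  also have "\<dots> \<le> G * (cmod (ff x y))\<^sup>2" using G_pos by (simp add: cmod_power2)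
  finally show ?thesis .
qed

text \<open>Since the covolume is t D / 2, the part of the second basis vector orthogonal to the
  first has squared length (t D)^2 / (4 W).\<close>

lemma ff_shift:
  assumes "a * d - b * c = 1" and W: "W = (cmod (ff a b))\<^sup>2" and y: "y = Re (cnj (ff a b) * ff c d) / W"
  shows "0 < W" "(cmod (ff (c + i * a) (d + i * b)))\<^sup>2 = W * (y + of_int i)\<^sup>2 + (t * D)\<^sup>2 / (4 * W)"
proof -
  have det: "Im (cnj (ff a b) * ff c d) = - t * D / 2" unfolding ff_det assms(1) by simp
  then have "ff a b \<noteq> 0" using t D_pos by auto
  then show W0: "0 < W" by (simp add: W)
  have "cnj (ff a b) * ff (c + i * a) (d + i * b) = cnj (ff a b) * ff c d + of_int i * (ff a b * cnj (ff a b))"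
    unfolding ff_add by (simp add: algebra_simps)
  also have "ff a b * cnj (ff a b) = of_real W" unfolding W complex_norm_square ..
  finally have eq: "cnj (ff a b) * ff (c + i * a) (d + i * b) = cnj (ff a b) * ff c d + of_int i * of_real W" .
  have "W * (cmod (ff (c + i * a) (d + i * b)))\<^sup>2 = (cmod (cnj (ff a b) * ff (c + i * a) (d + i * b)))\<^sup>2"
    unfolding W by (simp add: norm_mult power_mult_distrib)
  also have "\<dots> = (y * W + of_int i * W)\<^sup>2 + (t * D / 2)\<^sup>2"
    unfolding eq cmod_power2 using det W0 y by (simp add: power2_eq_square)
  also have "\<dots> = W * (W * (y + of_int i)\<^sup>2 + (t * D)\<^sup>2 / (4 * W))"
    using W0 by (simp add: power2_eq_square field_simps)
  finally show "(cmod (ff (c + i * a) (d + i * b)))\<^sup>2 = W * (y + of_int i)\<^sup>2 + (t * D)\<^sup>2 / (4 * W)" using W0 by simp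
qed

text \<open>Inverting the unimodular coefficient matrix recovers \<kappa> v from the two vectors, so
  Q would contain both v and \<kappa> v.\<close>

lemma V_no_common:
  assumes "a * d - b * c = 1" and Q: "max_ideal Q" "v1 \<in> Q" "v2 \<in> Q" "V1 a b \<in> Q" "V2 a b \<in> Q" "V1 c d \<in> Q" "V2 c d \<in> Q"
  shows False
proof -
  note I = idealD[OF max_ideal_ideal[OF Q(1)]]
  have "of_int a * V1 c d - of_int c * V1 a b = of_int (a * d - b * c) * (\<kappa> * v1)"
    "of_int a * V2 c d - of_int c * V2 a b = of_int (a * d - b * c) * (\<kappa> * v2)"
    unfolding V1_def V2_def by (simp_all add: algebra_simps)
  then have "of_int a * V1 c d - of_int c * V1 a b = \<kappa> * v1" "of_int a * V2 c d - of_int c * V2 a b = \<kappa> * v2"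
    unfolding assms(1) by simp_all
  then have "\<kappa> * v1 \<in> Q" "\<kappa> * v2 \<in> Q"
    using I(7)[OF I(4)[OF Q(6) O_int[of a]] I(4)[OF Q(4) O_int[of c]]]
      I(7)[OF I(4)[OF Q(7) O_int[of a]] I(4)[OF Q(5) O_int[of c]]] by simp_all
  then show False using no_max_ideal_v_kappa[OF sb kappa Q(1,2,3)] by blast
qed

text \<open>The gap condition chooses the component along \<open>v\<close> so small that \<open>\<epsilon> w + j v\<close> is still nearly
  orthogonal to \<open>v\<close> and, up to a scalar, a coprime pair. The factor \<open>\<epsilon> = 2\<close> is the price of the residues
  \<open>\<alpha>\<close> excluded in the definition of the gap.\<close>

lemma good_vector:
  assumes lower: "\<And>a b. a \<in> \<O> \<Longrightarrow> b \<in> \<O> \<Longrightarrow> cop a b \<Longrightarrow> 1 \<le> qform z t a b"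
    and J: "max_gap_below R X' \<le> J" and x: "x \<noteq> 0" "\<bar>real_of_int (x * n)\<bar> < X'"
    and common: "\<And>Q. max_ideal Q \<Longrightarrow> \<not> (v1 \<in> Q \<and> v2 \<in> Q \<and> V1 x y \<in> Q \<and> V2 x y \<in> Q)"
  shows "1 \<le> (cmod (ff x y))\<^sup>2 + G * J\<^sup>2 / 4 \<or> 1 \<le> 4 * (cmod (ff x y))\<^sup>2 + G * J\<^sup>2 / 4 \<and>
    even (x * n) \<and> (\<exists>r\<in>\<O>. \<exists>s\<in>\<O>. \<exists>b\<in>\<O>. r * v1 + s * v2 = 1 - b * 2)"
proof -
  have xn: "x * n \<noteq> 0" using x basis_simps(3) by simp
  obtain \<epsilon> :: int where \<epsilon>: "\<epsilon> = 1 \<or> \<epsilon> = 2 \<and> even (x * n) \<and> (\<exists>r\<in>\<O>. \<exists>s\<in>\<O>. \<exists>b\<in>\<O>. r * v1 + s * v2 = 1 - b * 2)"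
    and sieve: "\<And>y'. \<exists>j :: int. \<bar>y' + of_int j\<bar> \<le> J / 2 \<and>
      (\<forall>Q. max_ideal Q \<longrightarrow> of_int \<epsilon> * V1 x y + of_int j * v1 \<in> Q \<longrightarrow> of_int \<epsilon> * V2 x y + of_int j * v2 \<in> Q \<longrightarrow> principal Q)"
    using sieve_determinant[OF basis_simps(1,2) V_O V_det xn x(2) J common] by blast
  obtain j :: int where j: "\<bar>rr (\<epsilon> * x) (\<epsilon> * y) + of_int j\<bar> \<le> J / 2"
    "\<And>Q. max_ideal Q \<Longrightarrow> of_int \<epsilon> * V1 x y + of_int j * v1 \<in> Q \<Longrightarrow> of_int \<epsilon> * V2 x y + of_int j * v2 \<in> Q \<Longrightarrow> principal Q"
    using sieve[of "rr (\<epsilon> * x) (\<epsilon> * y)"] by blast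
  let ?c1 = "V1 (\<epsilon> * x) (\<epsilon> * y) + of_int j * v1" and ?c2 = "V2 (\<epsilon> * x) (\<epsilon> * y) + of_int j * v2"
  have cO: "?c1 \<in> \<O>" "?c2 \<in> \<O>" using V_O basis_simps(1,2) by simp_all
  have "v1 * ?c2 - v2 * ?c1 = of_int (\<epsilon> * x * n)" using V_det[of "\<epsilon> * x" "\<epsilon> * y"] by (simp add: algebra_simps)
  moreover have "\<epsilon> * x * n \<noteq> 0" using xn \<epsilon> by auto
  ultimately have c0: "?c1 \<noteq> 0 \<or> ?c2 \<noteq> 0" by (auto simp del: of_int_mult)
  have "principal Q" if "max_ideal Q" "?c1 \<in> Q" "?c2 \<in> Q" for Q
    using j(2)[of Q] that unfolding V_scale by blast
  then obtain g d1 d2 where g: "g \<in> \<O>" "g \<noteq> 0" "d1 \<in> \<O>" "d2 \<in> \<O>" "?c1 = g * d1" "?c2 = g * d2" "cop d1 d2"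
    using primitive_of_principal[OF cO c0] by blast
  have "1 \<le> cmod g" using O_norm_ge_1 g by blast
  \<comment> \<open>Multiplying the coprime pair by g does not shorten it, so the lower bound 1 for
    coprime pairs passes to the vector constructed.\<close>
  then have "1 * 1 \<le> (cmod g)\<^sup>2 * qform z t d1 d2" using lower g by (intro mult_mono) auto
  also have "\<dots> = qform z t ?c1 ?c2" unfolding g(5,6) qform_scale ..
  also have "\<dots> \<le> (of_int \<epsilon>)\<^sup>2 * (cmod (ff x y))\<^sup>2 + G * (J / 2)\<^sup>2"
  proof -
    have "(rr (\<epsilon> * x) (\<epsilon> * y) + of_int j)\<^sup>2 \<le> (J / 2)\<^sup>2" using j(1) abs_ge_zero[of "rr (\<epsilon> * x) (\<epsilon> * y) + of_int j"]
      by (intro power2_le_iff_abs_le[THEN iffD2]) linarith+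
    then have "G * (rr (\<epsilon> * x) (\<epsilon> * y) + of_int j)\<^sup>2 \<le> G * (J / 2)\<^sup>2" using G_pos by simp
    then show ?thesis unfolding qform_V ff_scale by (simp add: norm_mult power_mult_distrib)
  qed
  finally show ?thesis using \<epsilon> by (auto simp: power_divide)
qed

text \<open>For n = 2 k the congruence r' v1 + s' v2 = 1 - 2 b puts k = k (1 - 2 b) + b n into the
  ideal (v1, v2), whose rational integers are the multiples of n.\<close>

lemma no_half:
  assumes "even n" "r' \<in> \<O>" "s' \<in> \<O>" "b \<in> \<O>" "r' * v1 + s' * v2 = 1 - b * 2"
  shows False
proof -
  obtain k where k: "n = 2 * k" using assms(1) by blast
  obtain c d where cd: "c \<in> \<O>" "d \<in> \<O>" "of_int n = c * v1 + d * v2" using sb_bwd[OF sb kappa, of 1 0] by auto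
  have "of_int k = of_int k * (r' * v1 + s' * v2) + b * (of_int n)" unfolding assms(5) k by (simp add: algebra_simps)
  also have "\<dots> = (of_int k * r' + b * c) * v1 + (of_int k * s' + b * d) * v2" unfolding cd by (simp add: algebra_simps)
  finally obtain x y where xy: "(of_int k :: complex) = of_int x * of_int n + of_int y * (of_int r + \<omega>)"
    using sb_fwd[OF sb kappa, of "of_int k * r' + b * c" "of_int k * s' + b * d"] cd assms by auto
  have "of_int k + of_int 0 * \<omega> = of_int (x * n + y * r) + of_int y * \<omega>" unfolding xy by (simp add: algebra_simps)
  note e = O_coords_unique[OF this]
  then have "k = x * (2 * k)" using k by simp
  moreover have "0 < k" using k basis_simps(3) by simp
  ultimately have "1 = x * 2" by simp
  then show False by presburger
qed

text \<open>The determinant lies in the ideal (v1, v2), so its conjugate is n k with k a multiplier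
  of v into the ring. Then k v is a nonzero lattice vector, and minimality of v gives |k| >=
  1.\<close>

lemma det_ge_n:
  assumes ab: "a \<in> \<O>" "b \<in> \<O>" "v1 * b - v2 * a \<noteq> 0"
  shows "of_int n \<le> cmod (v1 * b - v2 * a)"
proof -
  have n: "0 < n" by (rule basis_simps)
  let ?\<eta> = "v1 * b - v2 * a"
  have "?\<eta> = b * v1 + (- a) * v2" by (simp add: algebra_simps)
  then obtain x y where xy: "?\<eta> = of_int x * of_int n + of_int y * (of_int r + \<omega>)"
    using sb_fwd[OF sb kappa ab(2), of "- a"] ab(1) by auto
  define k where "k = of_int x + of_int y * \<kappa>"
  have k: "cnj ?\<eta> = of_int n * k"
  proof -
    have "of_int n * k = of_int x * of_int n + of_int y * (\<kappa> * of_int n)" unfolding k_def by (simp add: algebra_simps)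
    then show ?thesis unfolding kappa_n[OF sb kappa] xy by (simp add: cnj_omega)
  qed
  have kv: "k * v1 \<in> \<O>" "k * v2 \<in> \<O>" unfolding k_def using kappa_v[OF sb kappa] basis_simps(1,2)
    by (simp_all add: distrib_right mult.assoc)
  have "cnj ?\<eta> \<noteq> 0" using ab(3) by (metis complex_cnj_zero_iff)
  then have "k \<noteq> 0" unfolding k by auto
  then have "G \<le> qform z t (k * v1) (k * v2)" using v(1) by (intro minimal kv) auto
  also have "\<dots> = (cmod k)\<^sup>2 * G" unfolding qform_scale v(2) ..
  finally have "1 \<le> (cmod k)\<^sup>2" using G_pos by simp
  then have "1 \<le> cmod k" using power2_le_imp_le[of 1 "cmod k"] by simp
  then have "of_int n * 1 \<le> of_int n * cmod k" using n by (intro mult_left_mono) auto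
  also have "\<dots> = cmod (cnj ?\<eta>)" unfolding k using n by (simp add: norm_mult)
  finally show ?thesis by (simp only: complex_mod_cnj mult_1_right)
qed

text \<open>If the determinant vanished, v would be a multiple g (a, b) with g in the ring, so that
  G = |g|^2 is at least 1.\<close>

lemma coprime_det_nonzero:
  assumes ab: "a \<in> \<O>" "b \<in> \<O>" "cop a b" "qform z t a b = 1" and "G < 1"
  shows "v1 * b - v2 * a \<noteq> 0"
proof
  assume 0: "v1 * b - v2 * a = 0"
  obtain x y where xy: "x \<in> \<O>" "y \<in> \<O>" "x * a + y * b = 1" using ab(3) by (auto simp: cop_def)
  define g where "g = x * v1 + y * v2"
  have "g * a = v1 * (x * a + y * b) - y * (v1 * b - v2 * a)" "g * b = v2 * (x * a + y * b) + x * (v1 * b - v2 * a)"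
    by (simp_all add: g_def algebra_simps)
  then have ga: "v1 = g * a" "v2 = g * b" unfolding 0 xy(3) by simp_all
  have "g \<in> \<O>" unfolding g_def using xy basis_simps(1,2) by simp
  moreover have "g \<noteq> 0" using ga v(1) by auto
  ultimately have "1 \<le> cmod g" by (rule O_norm_ge_1)
  then have "1 \<le> (cmod g)\<^sup>2" by simp
  moreover have "G = (cmod g)\<^sup>2" using v(2) qform_scale[of z t g a b] ab(4) ga by simp
  ultimately show False using assms(5) by simp
qed

text \<open>The determinant with v and the coordinate \<open>zc\<close> are both linear in the pair.
  Their 2 by 2 determinant therefore recovers, up to sign, the determinant m of the pairs (1, 0) and
  (l, m).\<close>

lemma det_zc: "(v1 * 0 - v2 * 1) * zc l m - (v1 * m - v2 * l) * zc 1 0 = - m"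
proof -
  define C where "C = cnj (v1 - v2 * z)"
  have "(v1 * 0 - v2 * 1) * ((l - m * z) * C + of_real (t\<^sup>2) * m * cnj v2) - (v1 * m - v2 * l) * ((1 - 0 * z) * C + of_real (t\<^sup>2) * 0 * cnj v2) =
    - m * ((v1 - v2 * z) * C + of_real (t\<^sup>2) * v2 * cnj v2)" by (simp add: algebra_simps)
  then have "(v1 * 0 - v2 * 1) * (of_real G * zc l m) - (v1 * m - v2 * l) * (of_real G * zc 1 0) = - m * of_real G"
    using G_complex G_pos unfolding zc_def C_def[symmetric] by simp
  then have "of_real G * ((v1 * 0 - v2 * 1) * zc l m - (v1 * m - v2 * l) * zc 1 0) = of_real G * (- m)" by (simp add: algebra_simps)
  then show ?thesis using G_pos by (simp only: mult_cancel_left) simp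
qed

lemma norm_e2: "(cmod e2)\<^sup>2 = G * (D / (2 * of_int n))\<^sup>2"
  unfolding e2_def Im_kappa[OF sb kappa] cmod_power2
  using G_pos by (simp add: power_mult_distrib power_divide)

lemma reduced_basis:
  obtains a b c d where "a * d - b * c = 1" "3 * ((cmod (ff a b))\<^sup>2)\<^sup>2 \<le> (t * D)\<^sup>2"
proof -
  have "Im (cnj e1 * e2) \<noteq> 0" unfolding e_det using t D_pos by simp
  then obtain a b c d where *: "a * d - b * c = 1" "3 * (cmod (ff a b)) ^ 4 \<le> 4 * (Im (cnj e1 * e2))\<^sup>2"
    using planar_lattice_reduction[of e1 e2] unfolding ff_def by blast
  have "4 * (Im (cnj e1 * e2))\<^sup>2 = (t * D)\<^sup>2" unfolding e_det by (simp add: power_divide power_mult_distrib)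
  moreover have "(cmod (ff a b)) ^ 4 = ((cmod (ff a b))\<^sup>2)\<^sup>2" by (simp flip: power_mult)
  ultimately show ?thesis using that[of a d b c] * by simp
qed

text \<open>The two vectors \<open>(1, 0)\<close> and \<open>(l, m)\<close> have determinant \<open>m\<close>, and neither has a large component
  along \<open>(v1, v2)\<close>.\<close>

lemma coprime_vector_bound_aligned:
  assumes G1: "G < 1" and W: "W = G * (D / (2 * of_int n))\<^sup>2" and \<beta>: "0 \<le> \<beta>" "\<beta> \<le> 1 / 40" "4 * \<beta> = J\<^sup>2 * (W + G)" "1 - \<beta> \<le> (t * D)\<^sup>2 / (4 * W)"
    and lm: "l \<in> \<O>" "m \<in> \<O>" "cop l m" "qform z t l m = 1"
  shows "(cmod m)\<^sup>2 \<le> J\<^sup>2 * D\<^sup>2"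
proof -
  have n: "0 < real_of_int n" using basis_simps(3) by simp
  \<comment> \<open>The squared orthogonal length of a vector of determinant n. By
    \<open>det_ge_n\<close> a coprime pair has no smaller orthogonal part, and at value 1 this
    leaves at most \<beta> for its component along v.\<close>
  have xi: "(t * D)\<^sup>2 / (4 * W) = t\<^sup>2 * (of_int n)\<^sup>2 / G"
    unfolding W using G_pos n D_pos by (simp add: power_mult_distrib power_divide field_simps)
  have comp: "t\<^sup>2 * (cmod (v1 * b - v2 * a))\<^sup>2 \<le> G \<and> G * (cmod (zc a b))\<^sup>2 \<le> \<beta>"
    if ab: "a \<in> \<O>" "b \<in> \<O>" "cop a b" "qform z t a b = 1" for a b
  proof
    have eq: "t\<^sup>2 * (cmod (v1 * b - v2 * a))\<^sup>2 / G + G * (cmod (zc a b))\<^sup>2 = 1" using qform_split[of a b] ab(4) by simp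
    moreover have "0 \<le> G * (cmod (zc a b))\<^sup>2" using G_pos by simp
    ultimately have "t\<^sup>2 * (cmod (v1 * b - v2 * a))\<^sup>2 / G \<le> 1" by linarith
    then show "t\<^sup>2 * (cmod (v1 * b - v2 * a))\<^sup>2 \<le> G" using G_pos by simp
    have "of_int n \<le> cmod (v1 * b - v2 * a)" using det_ge_n[OF ab(1,2)] coprime_det_nonzero[OF ab G1] by blast
    then have "(of_int n)\<^sup>2 \<le> (cmod (v1 * b - v2 * a))\<^sup>2" using n by (intro power_mono) auto
    then have "t\<^sup>2 * (of_int n)\<^sup>2 / G \<le> t\<^sup>2 * (cmod (v1 * b - v2 * a))\<^sup>2 / G"
      using G_pos by (intro divide_right_mono mult_left_mono) auto
    then show "G * (cmod (zc a b))\<^sup>2 \<le> \<beta>" using eq \<beta>(4) xi by linarith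
  qed
  have "cop 1 0" by (rule copI[of 1 0]) auto
  then have c0: "t\<^sup>2 * (cmod (v1 * 0 - v2 * 1))\<^sup>2 \<le> G" "G * (cmod (zc 1 0))\<^sup>2 \<le> \<beta>"
    using comp[of 1 0] by (auto simp: qform_def)
  have c1: "t\<^sup>2 * (cmod (v1 * m - v2 * l))\<^sup>2 \<le> G" "G * (cmod (zc l m))\<^sup>2 \<le> \<beta>"
    using comp[OF lm] by auto
  have prod: "t * (cmod x * cmod y) \<le> sqrt \<beta>" if "t\<^sup>2 * (cmod x)\<^sup>2 \<le> G" "G * (cmod y)\<^sup>2 \<le> \<beta>" for x y
  proof (rule real_le_rsqrt)
    have "(t\<^sup>2 * (cmod x)\<^sup>2) * (G * (cmod y)\<^sup>2) \<le> G * \<beta>" using that G_pos by (intro mult_mono) auto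
    then have "G * (t * (cmod x * cmod y))\<^sup>2 \<le> G * \<beta>" by (simp add: power_mult_distrib mult_ac)
    then show "(t * (cmod x * cmod y))\<^sup>2 \<le> \<beta>" using G_pos by simp
  qed
  have "cmod m = cmod ((v1 * 0 - v2 * 1) * zc l m - (v1 * m - v2 * l) * zc 1 0)" unfolding det_zc by simp
  also have "\<dots> \<le> cmod (v1 * 0 - v2 * 1) * cmod (zc l m) + cmod (v1 * m - v2 * l) * cmod (zc 1 0)"
    unfolding norm_mult[symmetric] by (rule norm_triangle_ineq4)
  finally have "t * cmod m \<le> t * (cmod (v1 * 0 - v2 * 1) * cmod (zc l m)) + t * (cmod (v1 * m - v2 * l) * cmod (zc 1 0))"
    using t by (simp add: distrib_left[symmetric])
  then have "t * cmod m \<le> 2 * sqrt \<beta>" using prod[OF c0(1) c1(2)] prod[OF c1(1) c0(2)] by linarith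
  then have "(t * cmod m)\<^sup>2 \<le> (2 * sqrt \<beta>)\<^sup>2" using t by (intro power_mono) auto
  then have m: "t\<^sup>2 * (cmod m)\<^sup>2 \<le> J\<^sup>2 * (W + G)" using \<beta> by (simp add: power_mult_distrib)
  \<comment> \<open>With 3 n^2 <= D^2 the factor 39/40 bounds G by 40/39 of (t D)^2 / 3 and W by
    40/39 of (t D)^2 / 4. The sum stays below (t D)^2, as 7/12 times 40/39 is less than 1.\<close>
  have "39 / 40 \<le> t\<^sup>2 * (of_int n)\<^sup>2 / G" using \<beta> xi by linarith
  then have Gn: "39 / 40 * G \<le> t\<^sup>2 * (of_int n)\<^sup>2" using G_pos by (simp add: pos_le_divide_eq)
  have Wp: "0 < W" unfolding W using G_pos n D_pos by simp
  have "39 / 40 \<le> (t * D)\<^sup>2 / (4 * W)" using \<beta> by linarith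
  then have "39 / 40 * (4 * W) \<le> (t * D)\<^sup>2" using Wp by (simp add: pos_le_divide_eq)
  moreover have "3 * (t\<^sup>2 * (of_int n)\<^sup>2) \<le> t\<^sup>2 * D\<^sup>2" using mult_left_mono[OF n_bound(1), of "t\<^sup>2"] by simp
  moreover have "0 \<le> t\<^sup>2 * D\<^sup>2" by simp
  ultimately have "W + G \<le> t\<^sup>2 * D\<^sup>2" using Gn unfolding power_mult_distrib by linarith
  then have "J\<^sup>2 * (W + G) \<le> J\<^sup>2 * (t\<^sup>2 * D\<^sup>2)" by (intro mult_left_mono) auto
  then have "t\<^sup>2 * (cmod m)\<^sup>2 \<le> t\<^sup>2 * (J\<^sup>2 * D\<^sup>2)" using m by (simp add: mult_ac)
  then show ?thesis using t by simp
qed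

text \<open>From |m| t <= 1, a value |m| >= 14 J x makes P = J x t at most 1/14. The lengths are
  estimated by multiples of P. If the reduced vector is not \<kappa> v up to sign, the vector
  constructed has squared length below 8 P, a contradiction. Otherwise the alignment with v gives
  |m| <= J D, which is less than 14 J x.\<close>

lemma coprime_vector_bound:
  assumes lower: "\<And>a b. a \<in> \<O> \<Longrightarrow> b \<in> \<O> \<Longrightarrow> cop a b \<Longrightarrow> 1 \<le> qform z t a b"
    and gap: "max_gap_below R (2 * x) \<le> J" and J: "1 \<le> J" "J * D \<le> x"
    and ramified: "\<And>p :: int. Factorial_Ring.prime p \<Longrightarrow> p dvd 4 * N - T\<^sup>2 \<Longrightarrow> D\<^sup>2 \<le> of_int p * x"
    and np: "\<And>Q. max_ideal Q \<Longrightarrow> v1 \<in> Q \<Longrightarrow> v2 \<in> Q \<Longrightarrow> \<not> principal Q"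
    and lm: "l \<in> \<O>" "m \<in> \<O>" "cop l m" "qform z t l m = 1"
  shows "cmod m < 14 * J * x"
proof (rule ccontr)
  assume "\<not> ?thesis"
  then have M: "14 * J * x \<le> cmod m" by simp
  have D: "0 < D" by (rule D_pos)
  have n0: "0 < n" by (rule basis_simps)
  have "1 * D \<le> J * D" using J(1) D by (intro mult_right_mono) auto
  then have Dx: "D \<le> x" "0 < x" using J D by linarith+
  define P where "P = J * x * t"
  define \<tau> where "\<tau> = t * D"
  have P: "P \<le> 1 / 14" "0 < P"
  proof -
    have "(cmod m * t)\<^sup>2 \<le> 1\<^sup>2" using lm(4) unfolding qform_def power_mult_distrib
      using zero_le_power2[of "cmod (l - m * z)"] by (simp, linarith)
    then have "cmod m * t \<le> 1" by (rule power2_le_imp_le) simp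
    moreover have "14 * J * x * t \<le> cmod m * t" using M t by (intro mult_right_mono) auto
    ultimately show "P \<le> 1 / 14" unfolding P_def by linarith
    show "0 < P" unfolding P_def using J t Dx by simp
  qed
  have \<tau>0: "0 < \<tau>" using t D by (simp add: \<tau>_def)
  have \<tau>x: "J * \<tau> \<le> x * t" "\<tau> \<le> x * t" using J(2) Dx t by (simp_all add: \<tau>_def mult_ac)
  have xtP: "x * t \<le> P" unfolding P_def using mult_right_mono[of 1 J "x * t"] J Dx t by (simp add: mult_ac)
  have J2: "J\<^sup>2 * \<tau> \<le> P" unfolding P_def using mult_left_mono[OF \<tau>x(1), of J] J(1) by (simp add: power2_eq_square mult_ac)
  have J21: "1 \<le> J\<^sup>2" using J(1) by simp
  have \<tau>P: "\<tau> \<le> P" using \<tau>x xtP by linarith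
  obtain a b c d where abcd: "a * d - b * c = 1" and red: "3 * ((cmod (ff a b))\<^sup>2)\<^sup>2 \<le> \<tau>\<^sup>2"
    unfolding \<tau>_def by (rule reduced_basis)
  define W where "W = (cmod (ff a b))\<^sup>2"
  define y where "y = Re (cnj (ff a b) * ff c d) / W"
  note shift = ff_shift[OF abcd W_def y_def, folded \<tau>_def]
  have W0: "0 < W" by (rule shift)
  have W3: "3 * W\<^sup>2 \<le> \<tau>\<^sup>2" using red by (simp add: W_def)
  \<comment> \<open>The factor 0.578 slightly exceeds 1 / sqrt 3.\<close>
  have W\<tau>: "W \<le> 578 / 1000 * \<tau>"
  proof (rule power2_le_imp_le)
    have "(578 / 1000 * \<tau>)\<^sup>2 = 334084 / 1000000 * \<tau>\<^sup>2" by (simp add: power_mult_distrib power2_eq_square)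
    then show "W\<^sup>2 \<le> (578 / 1000 * \<tau>)\<^sup>2" using W3 zero_le_power2[of \<tau>] by linarith
  qed (use \<tau>0 in simp)
  have JW: "J\<^sup>2 * W \<le> 578 / 1000 * P" using mult_left_mono[OF W\<tau>, of "J\<^sup>2"] J2 by simp
  have GW: "G \<le> 4 / 3 * W" unfolding W_def using W0 by (intro G_le_ff) (auto simp: W_def)
  have GJ: "G * J\<^sup>2 / 4 \<le> 193 / 1000 * P"
  proof -
    have "G * J\<^sup>2 \<le> 4 / 3 * (J\<^sup>2 * W)" using mult_right_mono[OF GW, of "J\<^sup>2"] by (simp add: mult_ac)
    then show ?thesis using JW P by linarith
  qed
  have G1: "G < 1" using GW W\<tau> \<tau>P P by linarith
  have nx: "real_of_int n < 2 * x" using n_bound(2) Dx by linarith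
  \<comment> \<open>The gap hypothesis is available only for determinants below 2 x. Since t times
    the determinant is at most sqrt G times the orthogonal length, this is again a condition on
    lengths.\<close>
  have xn: "\<bar>real_of_int (k * n)\<bar> < 2 * x" if "G * (cmod (ff k k'))\<^sup>2 < 4 * (x * t)\<^sup>2" for k k'
  proof -
    have "(t * \<bar>real_of_int (k * n)\<bar>)\<^sup>2 < (t * (2 * x))\<^sup>2" using that det_bound[of k k'] by (simp add: power_mult_distrib mult_ac)
    then have "t * \<bar>real_of_int (k * n)\<bar> < t * (2 * x)" by (rule power2_less_imp_less) (use t Dx in simp)
    then show ?thesis using t by simp
  qed
  have Gsq: "G * s \<le> 4 / 3 * (W * s)" if "0 \<le> s" for s using mult_right_mono[OF GW that] by simp
  have \<tau>x2: "\<tau>\<^sup>2 \<le> (x * t)\<^sup>2" "(J * \<tau>)\<^sup>2 \<le> (x * t)\<^sup>2" "0 < (x * t)\<^sup>2" using \<tau>x \<tau>0 J(1) Dx t by (simp_all add: power_mono)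
  have no_common: "\<not> (v1 \<in> Q \<and> v2 \<in> Q \<and> V1 a b \<in> Q \<and> V2 a b \<in> Q \<and> V1 c d \<in> Q \<and> V2 c d \<in> Q)" if "max_ideal Q" for Q
    using V_no_common[OF abcd that] by blast
  have sieve: "\<exists>i :: int. \<bar>y' + of_int i\<bar> \<le> J / 2 \<and> (\<forall>Q. max_ideal Q \<longrightarrow>
      \<not> (v1 \<in> Q \<and> v2 \<in> Q \<and> V1 (c + i * a) (d + i * b) \<in> Q \<and> V2 (c + i * a) (d + i * b) \<in> Q))" for y'
    unfolding V_add
  proof (rule sieve_common[OF basis_simps(1,2) V_O V_O n0 nx _ gap])
    show "\<exists>r\<in>\<O>. \<exists>s\<in>\<O>. of_int n = r * v1 + s * v2" using sb_bwd[OF sb kappa, of 1 0] by simp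
    show "\<not> (\<exists>a\<in>\<O>. \<exists>b\<in>\<O>. v1 = a * 2 \<and> v2 = b * 2)" using basis_simps(5)[of 2] by simp
  qed (use np no_common in blast)+
  \<comment> \<open>If \<open>a = 0\<close>, the shortest vector of the plane is \<open>\<kappa>v\<close> up to sign. Otherwise it can be used itself unless
    it shares a prime ideal with \<open>v\<close>; this prime is then ramified, which makes \<open>W\<close> large, and the second
    basis vector is short enough.\<close>
  show False
  proof (cases "a = 0")
    case True
    then have "b * c = - 1" using abcd by simp
    then have bc: "\<bar>b\<bar> = 1" "\<bar>c\<bar> = 1" by (metis abs_minus_cancel abs_mult abs_one abs_zmult_eq_1, metis abs_minus_cancel abs_mult abs_one abs_zmult_eq_1 mult.commute)
    obtain i :: int where i: "\<bar>y + of_int i\<bar> \<le> J / 2"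
      "\<And>Q. max_ideal Q \<Longrightarrow> \<not> (v1 \<in> Q \<and> v2 \<in> Q \<and> V1 c (d + i * b) \<in> Q \<and> V2 c (d + i * b) \<in> Q)"
      using sieve[of y] True by auto
    have "(cmod (ff a b))\<^sup>2 = (cmod e2)\<^sup>2" unfolding ff_def True using bc(1) by (simp add: norm_mult flip: of_int_abs)
    then have We: "W = G * (D / (2 * of_int n))\<^sup>2" unfolding W_def norm_e2 .
    define \<beta> where "\<beta> = J\<^sup>2 * (W + G) / 4"
    have \<beta>: "0 \<le> \<beta>" "\<beta> \<le> 1 / 40" "4 * \<beta> = J\<^sup>2 * (W + G)"
      using JW GJ P W0 G_pos by (simp_all add: \<beta>_def algebra_simps)
    have L: "(cmod (ff c (d + i * b)))\<^sup>2 \<le> W * J\<^sup>2 / 4 + \<tau>\<^sup>2 / (4 * W)"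
    proof -
      have "(y + of_int i)\<^sup>2 \<le> (J / 2)\<^sup>2" using i(1) J(1) by (intro power2_le_iff_abs_le[THEN iffD2]) auto
      then have "W * (y + of_int i)\<^sup>2 \<le> W * (J / 2)\<^sup>2" using W0 by (intro mult_left_mono) auto
      then show ?thesis using shift(2)[of i] True by (simp add: power_divide)
    qed
    have c0: "c \<noteq> 0" using bc by auto
    have "\<bar>real_of_int (c * n)\<bar> = of_int n" using bc(2) n0 by (simp add: abs_mult flip: of_int_abs)
    then have cn: "\<bar>real_of_int (c * n)\<bar> < 2 * x" using nx by simp
    have "\<not> (even (c * n) \<and> (\<exists>r\<in>\<O>. \<exists>s\<in>\<O>. \<exists>b\<in>\<O>. r * v1 + s * v2 = 1 - b * 2))"
    proof
      assume *: "even (c * n) \<and> (\<exists>r\<in>\<O>. \<exists>s\<in>\<O>. \<exists>b\<in>\<O>. r * v1 + s * v2 = 1 - b * 2)"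
      have "odd c" using bc(2) by presburger
      then have "even n" using * by simp
      then show False using * no_half by blast
    qed
    then have "1 \<le> (cmod (ff c (d + i * b)))\<^sup>2 + G * J\<^sup>2 / 4"
      using good_vector[OF lower gap c0 cn i(2)] by blast
    moreover have "\<beta> = W * J\<^sup>2 / 4 + G * J\<^sup>2 / 4" by (simp add: \<beta>_def field_simps)
    ultimately have "1 - \<beta> \<le> \<tau>\<^sup>2 / (4 * W)" using L by linarith
    then have m2: "(cmod m)\<^sup>2 \<le> J\<^sup>2 * D\<^sup>2"
      unfolding \<tau>_def by (intro coprime_vector_bound_aligned[OF G1 We \<beta> _ lm])
    have "J * D \<le> J * x" using Dx J(1) by (intro mult_left_mono) auto
    moreover have "0 < J * x" using J(1) Dx by simp
    ultimately have "J * D < cmod m" using M by linarith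
    then have "(J * D)\<^sup>2 < (cmod m)\<^sup>2" using J(1) D by (intro power_strict_mono) auto
    then show False using m2 by (simp add: power_mult_distrib)
  next
    case a0: False
    show False
    proof (cases "\<exists>Q. max_ideal Q \<and> v1 \<in> Q \<and> v2 \<in> Q \<and> V1 a b \<in> Q \<and> V2 a b \<in> Q")
      case False
      have "G * (cmod (ff a b))\<^sup>2 \<le> 4 / 3 * W\<^sup>2" using Gsq[of W] W0 by (simp add: W_def power2_eq_square)
      then have an: "\<bar>real_of_int (a * n)\<bar> < 2 * x" using W3 \<tau>x2 by (intro xn[of a b]) linarith
      have "1 \<le> W + G * J\<^sup>2 / 4 \<or> 1 \<le> 4 * W + G * J\<^sup>2 / 4"
        using good_vector[OF lower gap a0 an, of b] False unfolding W_def by blast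
      then show False using W0 W\<tau> \<tau>P GJ P by linarith
    next
      case True
      then obtain Q where Q: "max_ideal Q" "v1 \<in> Q" "v2 \<in> Q" "V1 a b \<in> Q" "V2 a b \<in> Q" by blast
      have "gcd a b dvd a * d - b * c" by (intro dvd_diff dvd_mult2) simp_all
      then have g: "gcd a b = 1" unfolding abcd by simp
      obtain p where p: "Factorial_Ring.prime (p :: int)" "p dvd n" "p dvd 4 * N - T\<^sup>2"
        using common_prime_ramified[OF sb kappa u Q(1) np[OF Q(1,2,3)] Q(2,3) V1_def V2_def Q(4,5) g] by blast
      have p0: "0 < p" using p(1) prime_gt_0_int by blast
      have "p dvd \<bar>a * n\<bar>" using p(2) by simp
      then have "p \<le> \<bar>a * n\<bar>" using a0 n0 by (intro zdvd_imp_le) auto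
      then have "real_of_int p \<le> \<bar>of_int (a * n)\<bar>" by linarith
      then have "(of_int p)\<^sup>2 \<le> (real_of_int (a * n))\<^sup>2" using p0 abs_le_square_iff[of "real_of_int p" "of_int (a * n)"] by simp
      then have "t\<^sup>2 * (of_int p)\<^sup>2 \<le> t\<^sup>2 * (of_int (a * n))\<^sup>2" by (intro mult_left_mono) auto
      also have "\<dots> \<le> G * W" unfolding W_def by (rule det_bound)
      also have "\<dots> \<le> 4 / 3 * W\<^sup>2" using Gsq[of W] W0 by (simp add: power2_eq_square)
      finally have pW2: "(t * of_int p)\<^sup>2 \<le> 4 / 3 * W\<^sup>2" by (simp add: power_mult_distrib)
      \<comment> \<open>The factor 0.866 is slightly below sqrt 3 / 2.\<close>
      have pW: "866 / 1000 * (t * of_int p) \<le> W"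
      proof (rule power2_le_imp_le)
        have "(866 / 1000 * (t * of_int p))\<^sup>2 = 749956 / 1000000 * (t * of_int p)\<^sup>2" by (simp add: power_mult_distrib power2_eq_square)
        then show "(866 / 1000 * (t * of_int p))\<^sup>2 \<le> W\<^sup>2" using pW2 zero_le_power2[of W] by linarith
      qed (use W0 in simp)
      \<comment> \<open>The ramified prime helps twice: p divides the determinant a n, which makes W
        large, and D^2 <= p x makes \<tau> small.\<close>
      have xi: "\<tau>\<^sup>2 / (4 * W) \<le> 289 / 1000 * P"
      proof -
        have "\<tau>\<^sup>2 \<le> t\<^sup>2 * (of_int p * x)" unfolding \<tau>_def power_mult_distrib by (intro mult_left_mono ramified[OF p(1,3)]) simp
        also have "\<dots> = (t * of_int p) * (x * t)" by (simp add: power2_eq_square mult_ac)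
        also have "\<dots> \<le> (1000 / 866 * W) * P" 
        proof (rule mult_mono)
          show "t * of_int p \<le> 1000 / 866 * W" using pW by linarith
          show "0 \<le> x * t" using Dx t by simp
        qed (use xtP W0 in simp_all)
        also have "\<dots> \<le> (289 / 1000 * P) * (4 * W)" using mult_pos_pos[OF W0 P(2)] by (simp add: mult_ac)
        finally show ?thesis using W0 by (simp add: pos_divide_le_eq)
      qed
      \<comment> \<open>Only one i can make the determinant c + i a vanish. Two intervals of length
        J whose centres differ by 11/10 J are disjoint and give two candidates, both within 1/2 +
        11/10 = 8/5 times J.\<close>
      obtain i :: int where i: "c + i * a \<noteq> 0" "\<bar>y + of_int i\<bar> \<le> 8 / 5 * J"
        "\<And>Q. max_ideal Q \<Longrightarrow> \<not> (v1 \<in> Q \<and> v2 \<in> Q \<and> V1 (c + i * a) (d + i * b) \<in> Q \<and> V2 (c + i * a) (d + i * b) \<in> Q)"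
      proof -
        obtain i1 :: int where i1: "\<bar>y + of_int i1\<bar> \<le> J / 2" 
          "\<And>Q. max_ideal Q \<Longrightarrow> \<not> (v1 \<in> Q \<and> v2 \<in> Q \<and> V1 (c + i1 * a) (d + i1 * b) \<in> Q \<and> V2 (c + i1 * a) (d + i1 * b) \<in> Q)"
          using sieve[of y] by blast
        obtain i2 :: int where i2: "\<bar>y + 11 / 10 * J + of_int i2\<bar> \<le> J / 2" 
          "\<And>Q. max_ideal Q \<Longrightarrow> \<not> (v1 \<in> Q \<and> v2 \<in> Q \<and> V1 (c + i2 * a) (d + i2 * b) \<in> Q \<and> V2 (c + i2 * a) (d + i2 * b) \<in> Q)"
          using sieve[of "y + 11 / 10 * J"] by blast
        have "i1 \<noteq> i2"
        proof
          assume "i1 = i2"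
          then show False using i1(1) i2(1) J(1) unfolding abs_le_iff by linarith
        qed
        then have "c + i1 * a \<noteq> 0 \<or> c + i2 * a \<noteq> 0" using a0 by (metis add_left_cancel mult_right_cancel)
        moreover have "\<bar>y + of_int i1\<bar> \<le> 8 / 5 * J" "\<bar>y + of_int i2\<bar> \<le> 8 / 5 * J"
          using i1(1) i2(1) J(1) unfolding abs_le_iff by linarith+
        ultimately show ?thesis using that[of i1] that[of i2] i1(2) i2(2) by blast
      qed
      have y2: "(y + of_int i)\<^sup>2 \<le> 64 / 25 * J\<^sup>2"
      proof -
        have "(y + of_int i)\<^sup>2 \<le> (8 / 5 * J)\<^sup>2" using i(2) J(1) by (intro power2_le_iff_abs_le[THEN iffD2]) auto
        then show ?thesis by (simp add: power_mult_distrib power2_eq_square)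
      qed
      define L where "L = (cmod (ff (c + i * a) (d + i * b)))\<^sup>2"
      have L: "L = W * (y + of_int i)\<^sup>2 + \<tau>\<^sup>2 / (4 * W)" unfolding L_def by (rule shift(2))
      have L0: "0 \<le> L" by (simp add: L_def)
      have LP: "L \<le> 177 / 100 * P"
      proof -
        have "W * (y + of_int i)\<^sup>2 \<le> 64 / 25 * (J\<^sup>2 * W)" using mult_left_mono[OF y2, of W] W0 by (simp add: mult_ac)
        then show ?thesis using JW xi P unfolding L by linarith
      qed
      have "W * L = W\<^sup>2 * (y + of_int i)\<^sup>2 + \<tau>\<^sup>2 / 4" unfolding L using W0 by (simp add: field_simps power2_eq_square)
      also have "\<dots> \<le> \<tau>\<^sup>2 / 3 * (64 / 25 * J\<^sup>2) + \<tau>\<^sup>2 / 4 * J\<^sup>2"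
        using W3 y2 J21 mult_left_mono[OF J21, of "\<tau>\<^sup>2 / 4"] by (intro add_mono mult_mono) auto
      also have "\<dots> \<le> 111 / 100 * (J * \<tau>)\<^sup>2" by (simp add: power_mult_distrib)
      finally have "G * L < 4 * (x * t)\<^sup>2" using Gsq[OF L0] \<tau>x2 by linarith
      then have cn: "\<bar>real_of_int ((c + i * a) * n)\<bar> < 2 * x" unfolding L_def by (rule xn)
      have "1 \<le> L + G * J\<^sup>2 / 4 \<or> 1 \<le> 4 * L + G * J\<^sup>2 / 4"
        using good_vector[OF lower gap i(1) cn i(3)] unfolding L_def by blast
      then show False using L0 LP GJ P by linarith
    qed
  qed
qed

end

lemma upper_bound_point:
  assumes t: "0 < t" and lm: "l \<in> \<O>" "m \<in> \<O>" "cop l m" "(cmod (m * z - l))\<^sup>2 + (cmod m)\<^sup>2 * t\<^sup>2 = 1"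
    and lower: "\<And>a b. a \<in> \<O> \<Longrightarrow> b \<in> \<O> \<Longrightarrow> cop a b \<Longrightarrow> 1 \<le> (cmod (b * z - a))\<^sup>2 + (cmod b)\<^sup>2 * t\<^sup>2"
    and gap: "max_gap_below R (2 * x) \<le> J" and J: "1 \<le> J" "J * D \<le> x"
    and ramified: "\<And>p :: int. Factorial_Ring.prime p \<Longrightarrow> p dvd 4 * N - T\<^sup>2 \<Longrightarrow> D\<^sup>2 \<le> of_int p * x"
  shows "cmod m < 14 * J * x"
proof -
  have q: "qform z t a b = (cmod (b * z - a))\<^sup>2 + (cmod b)\<^sup>2 * t\<^sup>2" for a b
    by (simp add: qform_def norm_minus_commute)
  obtain v1 v2 where v: "v1 \<in> \<O>" "v2 \<in> \<O>" "v1 \<noteq> 0 \<or> v2 \<noteq> 0"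
    and min: "\<And>a b. a \<in> \<O> \<Longrightarrow> b \<in> \<O> \<Longrightarrow> a \<noteq> 0 \<or> b \<noteq> 0 \<Longrightarrow> qform z t v1 v2 \<le> qform z t a b"
    using exists_minimal_vector[OF t] by blast
  have prim: "\<not> (\<exists>a\<in>\<O>. \<exists>b\<in>\<O>. v1 = a * of_int k \<and> v2 = b * of_int k)" if k: "2 \<le> k" for k :: int
  proof
    assume "\<exists>a\<in>\<O>. \<exists>b\<in>\<O>. v1 = a * of_int k \<and> v2 = b * of_int k"
    then obtain a b where "a \<in> \<O>" "b \<in> \<O>" "v1 = a * of_int k" "v2 = b * of_int k" by blast
    from minimal_vector_primitive[OF t v(3) min this] show False using k by simp
  qed
  obtain n r where sb: "standard_basis v1 v2 n r" using exists_standard_basis[OF v prim] by blast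
  define \<kappa> where "\<kappa> = (of_int r + (of_int T - \<omega>)) / of_int n"
  obtain c d where cd: "c \<in> \<O>" "d \<in> \<O>" "of_int n = c * v1 + d * v2" using sb_bwd[OF sb \<kappa>_def, of 1 0] by auto
  have u: "- d \<in> \<O>" "c \<in> \<O>" "v1 * c - v2 * (- d) = of_int n" using cd by (simp_all add: algebra_simps)
  show ?thesis
    by (rule coprime_vector_bound[OF t v(3) refl min sb \<kappa>_def u _ gap J ramified _ lm(1-3)])
      (use lower lm(4) max_ideal_minimal_vector_not_principal[OF t v(3) min] in \<open>auto simp: q\<close>)
qed

end

theorem theorem1p4:
  fixes K F :: "complex set" and \<Delta> J :: int and \<delta> :: complex
  assumes "imaginary_quadratic_field K"
    and "\<Delta> = discriminant K"
    and "fundamental_parallelogram (carrier (integers_of K)) F"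
    and "\<delta> \<in> carrier (integers_of K)"
    and "properfactor (integers_of K) \<delta> (of_int \<Delta>)"
    and "\<And>d. d \<in> carrier (integers_of K) \<Longrightarrow>
           properfactor (integers_of K) d (of_int \<Delta>) \<Longrightarrow> cmod d \<le> cmod \<delta>"
    and "max_gap_below (integers_of K) (2 * max (cmod \<delta>) (real_of_int J * sqrt \<bar>real_of_int \<Delta>\<bar>))
           \<le> real_of_int J"
  shows "max (cmod \<delta> / 8) ((sqrt \<bar>real_of_int \<Delta>\<bar> - 2) / sqrt 3) < swan_number K F \<and>
         swan_number K F < 14 * real_of_int J * max (cmod \<delta>) (real_of_int J * sqrt \<bar>real_of_int \<Delta>\<bar>)"
proof -
  obtain v w where "lattice_basis (carrier (integers_of K)) v w"
    using assms(3) by (auto simp: fundamental_parallelogram_def)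
  then obtain \<omega> T N where iq: "imag_quad \<omega> T N" and O: "carrier (integers_of K) = imag_quad.\<O> \<omega>"
    and disc: "discriminant K = T\<^sup>2 - 4 * N"
    using imaginary_quadratic_field_imag_quad[OF assms(1)] by blast
  then interpret imag_quad_field \<omega> T N K by (simp add: imag_quad_field_def imag_quad_field_axioms_def)
  have \<Delta>: "\<Delta> = T\<^sup>2 - 4 * N" using disc assms(2) by simp
  have D2: "D\<^sup>2 = - real_of_int \<Delta>" unfolding D_square \<Delta> by simp
  then have \<Delta>neg: "\<Delta> < 0" using D_pos by (metis neg_0_less_iff_less of_int_less_0_iff zero_less_power)
  have sqrt: "sqrt \<bar>real_of_int \<Delta>\<bar> = D" using D2 D_pos \<Delta>neg by (intro real_sqrt_unique) auto
  have pf: "properfactor R a (of_int \<Delta>) \<longleftrightarrow> (\<exists>e\<in>\<O>. of_int \<Delta> = a * e) \<and> (\<forall>c\<in>\<O>. a \<noteq> of_int \<Delta> * c)" for a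
    by (auto simp: properfactor_def factor_def)
  have \<delta>O: "\<delta> \<in> \<O>" using assms(4) by simp
  obtain e where e: "e \<in> \<O>" "of_int \<Delta> = \<delta> * e" using assms(5) unfolding pf by blast
  have \<delta>1: "1 \<le> cmod \<delta>" using O_norm_ge_1[OF \<delta>O] e(2) \<Delta>neg by force
  define x where "x = max (cmod \<delta>) (real_of_int J * D)"
  have x: "1 \<le> x" "cmod \<delta> \<le> x" "J * D \<le> x" using \<delta>1 by (auto simp: x_def)
  have gap: "max_gap_below R (2 * x) \<le> real_of_int J" using assms(7) unfolding sqrt x_def .
  have "1 \<le> max_gap_below R (2 * x)" using x by (intro max_gap_below_ge_1) simp
  then have J1: "1 \<le> real_of_int J" using gap by linarith
  have ramified: "D\<^sup>2 \<le> of_int p * x" if p: "Factorial_Ring.prime p" "p dvd 4 * N - T\<^sup>2" for p :: int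
  proof -
    have p2: "2 \<le> p" using p(1) prime_ge_2_int by blast
    obtain k where k: "4 * N - T\<^sup>2 = p * k" using p(2) by blast
    have \<Delta>k: "\<Delta> = - k * p" using k \<Delta> by (simp add: mult.commute)
    have "properfactor R (of_int (- k)) (of_int \<Delta>)"
      unfolding pf
    proof (intro conjI ballI notI)
      show "\<exists>e\<in>\<O>. of_int \<Delta> = of_int (- k) * e" by (rule bexI[of _ "of_int p"]) (auto simp: \<Delta>k)
      fix c assume c: "c \<in> \<O>" "of_int (- k) = of_int \<Delta> * c"
      have "k \<noteq> 0" using \<Delta>k \<Delta>neg by auto
      then have "of_int p * c = 1" using c(2) unfolding \<Delta>k by (simp add: mult.assoc)
      then have "of_int p * cmod c = 1" using p2 by (metis abs_of_nonneg norm_mult norm_of_int norm_one of_int_0_le_iff order_trans zero_le_numeral)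
      moreover have "1 \<le> cmod c" using O_norm_ge_1 c(1) \<open>of_int p * c = 1\<close> by force
      then have "2 * 1 \<le> of_int p * cmod c" using p2 by (intro mult_mono) auto
      ultimately show False by simp
    qed
    then have "cmod (of_int (- k)) \<le> cmod \<delta>" by (intro assms(6)) simp_all
    then have "\<bar>real_of_int k\<bar> \<le> x" using x(2) by simp
    then have "of_int p * real_of_int k \<le> of_int p * x" using p2 by (intro mult_left_mono) auto
    then show ?thesis unfolding D_square k by simp
  qed
  have upper: "s < 14 * real_of_int J * x" if s: "s \<in> swan_set F" for s
  proof (rule swan_set_point[OF s])
    fix l m z t assume p: "s = cmod m" "l \<in> \<O>" "m \<in> \<O>" "m \<noteq> 0" "cop l m" "0 < t"
      "(cmod (m * z - l))\<^sup>2 + (cmod m)\<^sup>2 * t\<^sup>2 = 1"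
      "\<And>a b. a \<in> \<O> \<Longrightarrow> b \<in> \<O> \<Longrightarrow> cop a b \<Longrightarrow> 1 \<le> (cmod (b * z - a))\<^sup>2 + (cmod b)\<^sup>2 * t\<^sup>2"
    show ?thesis unfolding p(1)
      by (rule upper_bound_point[OF p(6,2,3,5,7) _ gap J1 x(3)]) (use p(8) ramified in blast)+
  qed
  \<comment> \<open>The upper bound itself shows that the set is finite, so that its
    \<open>Max\<close> is attained and bounds all members.\<close>
  have "swan_set F \<subseteq> cmod ` {m \<in> \<O>. cmod m \<le> 14 * real_of_int J * x}"
  proof
    fix s assume s: "s \<in> swan_set F"
    then obtain m where "s = cmod m" "m \<in> \<O>" unfolding swan_set_def by auto
    then show "s \<in> cmod ` {m \<in> \<O>. cmod m \<le> 14 * real_of_int J * x}" using upper[OF s] by auto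
  qed
  then have fin: "finite (swan_set F)" by (rule finite_subset) (intro finite_imageI finite_O)
  have F: "fundamental_parallelogram \<O> F" using assms(3) by simp
  have lower: "y < swan_number K F" if "\<exists>l m. essential l m \<and> y < cmod m" for y
    using that essential_in_swan_set[OF _ F] Max_ge[OF fin] unfolding swan_number_eq by (meson less_le_trans)
  have l1: "cmod \<delta> / 8 < swan_number K F"
  proof (rule lower, rule essential_lower_bound_divisor[OF \<delta>O e(1)])
    show "of_int (T\<^sup>2 - 4 * N) = \<delta> * e" using e(2) unfolding \<Delta> .
    show "\<delta> \<noteq> of_int (T\<^sup>2 - 4 * N) * c" if "c \<in> \<O>" for c using assms(5)[unfolded pf] that unfolding \<Delta> by blast
  qed
  have l2: "(D - 2) / sqrt 3 < swan_number K F"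
    by (intro lower essential_lower_bound_sqrt)
  obtain l m where lm: "essential l m" using essential_lower_bound_sqrt by blast
  have "swan_set F \<noteq> {}" using essential_in_swan_set[OF lm F] by (rule ex_in_conv[THEN iffD1, OF exI])
  then have "Max (swan_set F) < 14 * real_of_int J * x" by (rule upper[OF Max_in[OF fin]])
  then show ?thesis using l1 l2 unfolding sqrt x_def[symmetric] swan_number_eq by simp
qed

end
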